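(* For all finite sequences of formulas $\Phi,\Psi$ and formulas $\alpha,\beta$: if $\Phi\Vdash\alpha$ and $\alpha,\Psi\Vdash\beta$, then $\Phi,\Psi\Vdash\beta$.
   Context: Formulas: built from variables $x$ and negated variables $\neg x$ by $\square$, $\diamond$, $\bigwedge\Gamma$, $\bigvee\Gamma$ ($\Gamma$ finite), $\mu\phi,\nu\phi$ ($\phi=\lambda x.\alpha$, $\neg x$ not in $\alpha$); $\phi\beta:=\alpha[x:=\beta]$. Immediate subformula: $\beta\in\Gamma$ for $\bigwedge\Gamma,\bigvee\Gamma$; $\beta$ for $\square\beta,\diamond\beta$; $\phi(\sigma\phi)$ for $\sigma\phi$. Threads: sequences stepping by immediate subformula; complexity: literals $0$, each connective/modality/quantifier adds $1$ (max over conjuncts/disjuncts); an infinite thread is a $\nu$-/$\mu$-thread according to the quantifier of the minimal-complexity formula among those occurring infinitely often. Sequent calculus (cut-free): exchange, contraction, weakening on both sides; ($\bigwedge$L) $\gamma,\Phi\Rightarrow\Psi$ / $\bigwedge\Gamma,\Phi\Rightarrow\Psi$; ($\bigvee$L) $\{\gamma,\Phi\Rightarrow\Psi\}_{\gamma\in\Gamma}$ / $\bigvee\Gamma,\Phi\Rightarrow\Psi$; ($\sigma$L) $\phi(\sigma\phi),\Phi\Rightarrow\Psi$ / $\sigma\phi,\Phi\Rightarrow\Psi$; ($\diamond$L) $\alpha,\Phi\Rightarrow\Psi$ / $\diamond\alpha,\square\Phi\Rightarrow\diamond\Psi$; ($\bigwedge$R), ($\bigvee$R), ($\sigma$R) symmetric;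 ($\square$R) $\Phi\Rightarrow\Psi,\alpha$ / $\square\Phi\Rightarrow\diamond\Psi,\square\alpha$; axioms $x,\neg x\Rightarrow$; $\Rightarrow\neg x,x$; $x\Rightarrow x$ ($x$ a variable). Traces follow formula occurrences up a branch (from principal to minor occurrence, side occurrences to their copies, through structural rules to corresponding occurrences) and support the thread of formulas at principal steps. A co-proof is a possibly infinite derivation with axiom leaves, infinitely many logical rules on each infinite branch, and each infinite branch carrying a left trace supporting a $\mu$-thread or a right trace supporting a $\nu$-thread. Constructive: every sequent has at most one formula on the right. $\Phi\Vdash\alpha$: a constructive co-proof of $\Phi\Rightarrow\alpha$ exists. *)

theory Defs
  imports Main "HOL-Library.FSet"
begin

text \<open>Var i is the variable x, NVar i the negated variable (not x). Index 0 inside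
  Mu a / Nu a refers to the variable bound by the quantifier; Mu a stands for mu(lambda x. a).
  Finite sets Gamma of formulas are finite sets (fset).\<close>

datatype fm =
    Var nat
  | NVar nat
  | Box fm
  | Dia fm
  | Conj "fm fset"
  | Disj "fm fset"
  | Mu fm
  | Nu fm

primrec lift :: "fm \<Rightarrow> nat \<Rightarrow> fm" where
  "lift (Var i) k = (if k \<le> i then Var (Suc i) else Var i)"
| "lift (NVar i) k = (if k \<le> i then NVar (Suc i) else NVar i)"
| "lift (Box a) k = Box (lift a k)"
| "lift (Dia a) k = Dia (lift a k)"
| "lift (Conj G) k = Conj (fimage (\<lambda>a. lift a k) G)"
| "lift (Disj G) k = Disj (fimage (\<lambda>a. lift a k) G)"
| "lift (Mu a) k = Mu (lift a (Suc k))"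
| "lift (Nu a) k = Nu (lift a (Suc k))"

primrec subst :: "fm \<Rightarrow> nat \<Rightarrow> fm \<Rightarrow> fm" where
  "subst (Var i) k s = (if i = k then s else if k < i then Var (i - 1) else Var i)"
| "subst (NVar i) k s = (if k < i then NVar (i - 1) else NVar i)"
| "subst (Box a) k s = Box (subst a k s)"
| "subst (Dia a) k s = Dia (subst a k s)"
| "subst (Conj G) k s = Conj (fimage (\<lambda>a. subst a k s) G)"
| "subst (Disj G) k s = Disj (fimage (\<lambda>a. subst a k s) G)"
| "subst (Mu a) k s = Mu (subst a (Suc k) (lift s 0))"
| "subst (Nu a) k s = Nu (subst a (Suc k) (lift s 0))"

text \<open>phi beta := alpha[x := beta], where phi = lambda x. alpha is represented by its body a.\<close>
definition app :: "fm \<Rightarrow> fm \<Rightarrow> fm" where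
  "app a b = subst a 0 b"

primrec nfree :: "nat \<Rightarrow> fm \<Rightarrow> bool" where
  "nfree k (Var i) = False"
| "nfree k (NVar i) = (i = k)"
| "nfree k (Box a) = nfree k a"
| "nfree k (Dia a) = nfree k a"
| "nfree k (Conj G) = (True |\<in>| fimage (nfree k) G)"
| "nfree k (Disj G) = (True |\<in>| fimage (nfree k) G)"
| "nfree k (Mu a) = nfree (Suc k) a"
| "nfree k (Nu a) = nfree (Suc k) a"

primrec wff :: "fm \<Rightarrow> bool" where
  "wff (Var i) = True"
| "wff (NVar i) = True"
| "wff (Box a) = wff a"
| "wff (Dia a) = wff a"
| "wff (Conj G) = fBall (fimage wff G) id"
| "wff (Disj G) = fBall (fimage wff G) id"
| "wff (Mu a) = (wff a \<and> \<not> nfree 0 a)"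
| "wff (Nu a) = (wff a \<and> \<not> nfree 0 a)"

primrec cx :: "fm \<Rightarrow> nat" where
  "cx (Var i) = 0"
| "cx (NVar i) = 0"
| "cx (Box a) = Suc (cx a)"
| "cx (Dia a) = Suc (cx a)"
| "cx (Conj G) = Suc (fMax (finsert 0 (fimage cx G)))"
| "cx (Disj G) = Suc (fMax (finsert 0 (fimage cx G)))"
| "cx (Mu a) = Suc (cx a)"
| "cx (Nu a) = Suc (cx a)"

fun isub :: "fm \<Rightarrow> fm \<Rightarrow> bool" where
  "isub (Conj G) b = (b |\<in>| G)"
| "isub (Disj G) b = (b |\<in>| G)"
| "isub (Box a) b = (b = a)"
| "isub (Dia a) b = (b = a)"
| "isub (Mu a) b = (b = app a (Mu a))"
| "isub (Nu a) b = (b = app a (Nu a))"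
| "isub _ b = False"

definition thread :: "(nat \<Rightarrow> fm) \<Rightarrow> bool" where
  "thread t \<longleftrightarrow> (\<forall>j. isub (t j) (t (Suc j)))"

definition inf_occ :: "(nat \<Rightarrow> fm) \<Rightarrow> fm \<Rightarrow> bool" where
  "inf_occ t b \<longleftrightarrow> (\<exists>\<^sub>\<infinity>j. t j = b)"

definition mu_thread :: "(nat \<Rightarrow> fm) \<Rightarrow> bool" where
  "mu_thread t \<longleftrightarrow> thread t \<and>
     (\<exists>a. inf_occ t (Mu a) \<and> (\<forall>b. inf_occ t b \<longrightarrow> cx (Mu a) \<le> cx b))"

definition nu_thread :: "(nat \<Rightarrow> fm) \<Rightarrow> bool" where
  "nu_thread t \<longleftrightarrow> thread t \<and>
     (\<exists>a. inf_occ t (Nu a) \<and> (\<forall>b. inf_occ t b \<longrightarrow> cx (Nu a) \<le> cx b))"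

type_synonym seqt = "fm list \<times> fm list"

datatype side = Lft | Rgt

type_synonym occ = "side \<times> nat"

definition fmat :: "seqt \<Rightarrow> occ \<Rightarrow> fm" where
  "fmat S oc = (case fst oc of Lft \<Rightarrow> fst S ! snd oc | Rgt \<Rightarrow> snd S ! snd oc)"

text \<open>A link between a conclusion and one premise of a rule instance:
  triples (occurrence in conclusion, corresponding occurrence in premise, principal step?).
  Principal steps go from a principal occurrence to a minor occurrence (an immediate
  subformula); non-principal steps go from side occurrences to their copies.\<close>
type_synonym link = "(occ \<times> occ \<times> bool) set"

definition cp :: "side \<Rightarrow> (nat \<Rightarrow> nat) \<Rightarrow> nat \<Rightarrow> link" where
  "cp s f n = {((s, f i), (s, i), False) | i. i < n}"

definition idl :: "side \<Rightarrow> nat set \<Rightarrow> bool \<Rightarrow> link" where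
  "idl s A b = {((s, i), (s, i), b) | i. i \<in> A}"

definition swp :: "nat \<Rightarrow> nat \<Rightarrow> nat" where
  "swp k i = (if i = k then Suc k else if i = Suc k then k else i)"

definition lkL :: "fm list \<Rightarrow> fm list \<Rightarrow> link" where
  "lkL \<Phi> \<Psi> = {((Lft, 0), (Lft, 0), True)} \<union> idl Lft {1..<Suc (length \<Phi>)} False
                \<union> idl Rgt {..<length \<Psi>} False"

definition lkR :: "fm list \<Rightarrow> fm list \<Rightarrow> link" where
  "lkR \<Phi> \<Psi> = {((Rgt, length \<Psi>), (Rgt, length \<Psi>), True)} \<union> idl Lft {..<length \<Phi>} False
                \<union> idl Rgt {..<length \<Psi>} False"

text \<open>step lg S P: S is the conclusion of a rule instance with premises (and links) P;
  lg says whether the rule is a logical rule.\<close>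
inductive step :: "bool \<Rightarrow> seqt \<Rightarrow> (seqt \<times> link) list \<Rightarrow> bool" where
  ax1: "step False ([Var x, NVar x], []) []"
| ax2: "step False ([], [NVar x, Var x]) []"
| ax3: "step False ([Var x], [Var x]) []"
| exL: "step False (\<Phi>1 @ a # b # \<Phi>2, \<Psi>)
          [((\<Phi>1 @ b # a # \<Phi>2, \<Psi>),
            cp Lft (swp (length \<Phi>1)) (length \<Phi>1 + 2 + length \<Phi>2) \<union> cp Rgt id (length \<Psi>))]"
| exR: "step False (\<Phi>, \<Psi>1 @ a # b # \<Psi>2)
          [((\<Phi>, \<Psi>1 @ b # a # \<Psi>2),
            cp Lft id (length \<Phi>) \<union> cp Rgt (swp (length \<Psi>1)) (length \<Psi>1 + 2 + length \<Psi>2))]"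
| ctL: "step False (a # \<Phi>, \<Psi>)
          [((a # a # \<Phi>, \<Psi>), cp Lft (\<lambda>i. i - 1) (length \<Phi> + 2) \<union> cp Rgt id (length \<Psi>))]"
| ctR: "step False (\<Phi>, \<Psi> @ [a])
          [((\<Phi>, \<Psi> @ [a, a]), cp Lft id (length \<Phi>) \<union> cp Rgt (\<lambda>i. min i (length \<Psi>)) (length \<Psi> + 2))]"
| wkL: "step False (a # \<Phi>, \<Psi>) [((\<Phi>, \<Psi>), cp Lft Suc (length \<Phi>) \<union> cp Rgt id (length \<Psi>))]"
| wkR: "step False (\<Phi>, \<Psi> @ [a]) [((\<Phi>, \<Psi>), cp Lft id (length \<Phi>) \<union> cp Rgt id (length \<Psi>))]"
| conjL: "g |\<in>| G \<Longrightarrow> step True (Conj G # \<Phi>, \<Psi>) [((g # \<Phi>, \<Psi>), lkL \<Phi> \<Psi>)]"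
| disjL: "set gs = fset G \<Longrightarrow>
          step True (Disj G # \<Phi>, \<Psi>) (map (\<lambda>g. ((g # \<Phi>, \<Psi>), lkL \<Phi> \<Psi>)) gs)"
| muL: "step True (Mu a # \<Phi>, \<Psi>) [((app a (Mu a) # \<Phi>, \<Psi>), lkL \<Phi> \<Psi>)]"
| nuL: "step True (Nu a # \<Phi>, \<Psi>) [((app a (Nu a) # \<Phi>, \<Psi>), lkL \<Phi> \<Psi>)]"
| diaL: "step True (Dia a # map Box \<Phi>, map Dia \<Psi>)
          [((a # \<Phi>, \<Psi>), idl Lft {..<Suc (length \<Phi>)} True \<union> idl Rgt {..<length \<Psi>} True)]"
| conjR: "set gs = fset G \<Longrightarrow>
          step True (\<Phi>, \<Psi> @ [Conj G]) (map (\<lambda>g. ((\<Phi>, \<Psi> @ [g]), lkR \<Phi> \<Psi>)) gs)"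
| disjR: "g |\<in>| G \<Longrightarrow> step True (\<Phi>, \<Psi> @ [Disj G]) [((\<Phi>, \<Psi> @ [g]), lkR \<Phi> \<Psi>)]"
| muR: "step True (\<Phi>, \<Psi> @ [Mu a]) [((\<Phi>, \<Psi> @ [app a (Mu a)]), lkR \<Phi> \<Psi>)]"
| nuR: "step True (\<Phi>, \<Psi> @ [Nu a]) [((\<Phi>, \<Psi> @ [app a (Nu a)]), lkR \<Phi> \<Psi>)]"
| boxR: "step True (map Box \<Phi>, map Dia \<Psi> @ [Box a])
          [((\<Phi>, \<Psi> @ [a]), idl Lft {..<length \<Phi>} True \<union> idl Rgt {..<Suc (length \<Psi>)} True)]"

codatatype ptree = PNode (root: seqt) (logic: bool) (kids: "(ptree \<times> link) list")

coinductive wfd :: "ptree \<Rightarrow> bool" where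
  "step b S (map (\<lambda>(u, l). (root u, l)) ks) \<Longrightarrow> (\<forall>p \<in> set ks. wfd (fst p)) \<Longrightarrow>
   wfd (PNode S b ks)"

inductive_set subtrees :: "ptree \<Rightarrow> ptree set" for T where
  "T \<in> subtrees T"
| "u \<in> subtrees T \<Longrightarrow> p \<in> set (kids u) \<Longrightarrow> fst p \<in> subtrees T"

definition branch :: "ptree \<Rightarrow> (nat \<Rightarrow> ptree) \<Rightarrow> (nat \<Rightarrow> link) \<Rightarrow> bool" where
  "branch T br lk \<longleftrightarrow> br 0 = T \<and> (\<forall>n. (br (Suc n), lk n) \<in> set (kids (br n)))"

definition trace :: "(nat \<Rightarrow> link) \<Rightarrow> nat \<Rightarrow> (nat \<Rightarrow> occ) \<Rightarrow> (nat \<Rightarrow> bool) \<Rightarrow> bool" where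
  "trace lk k oc pf \<longleftrightarrow> (\<forall>n\<ge>k. (oc n, oc (Suc n), pf n) \<in> lk n)"

definition supports ::
  "(nat \<Rightarrow> ptree) \<Rightarrow> nat \<Rightarrow> (nat \<Rightarrow> occ) \<Rightarrow> (nat \<Rightarrow> bool) \<Rightarrow> (nat \<Rightarrow> fm) \<Rightarrow> bool" where
  "supports br k oc pf t \<longleftrightarrow>
     (\<exists>p. strict_mono p \<and> range p = {n. k \<le> n \<and> pf n} \<and>
          (\<forall>j. t j = fmat (root (br (p j))) (oc (p j))))"

definition coproof :: "ptree \<Rightarrow> bool" where
  "coproof T \<longleftrightarrow> wfd T \<and>
     (\<forall>br lk. branch T br lk \<longrightarrow>
        (\<exists>\<^sub>\<infinity>n. logic (br n)) \<and>
        (\<exists>k oc pf t. trace lk k oc pf \<and> supports br k oc pf t \<and>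
           (((\<forall>n\<ge>k. fst (oc n) = Lft) \<and> mu_thread t) \<or>
            ((\<forall>n\<ge>k. fst (oc n) = Rgt) \<and> nu_thread t))))"

definition constructive :: "ptree \<Rightarrow> bool" where
  "constructive T \<longleftrightarrow> (\<forall>u \<in> subtrees T. length (snd (root u)) \<le> 1)"

definition forces :: "fm list \<Rightarrow> fm \<Rightarrow> bool" where
  "forces \<Phi> a \<longleftrightarrow> (\<exists>T. coproof T \<and> constructive T \<and> root T = (\<Phi>, [a]))"

end

theory Submission
  imports Defs "HOL-Library.Infinite_Set"
begin

text \<open>
  Because a constructive sequent has at most one formula on the right, a cut can be eliminated by
  letting a main proof M interact with proofs of its cut formulas: a state consists of M together
  with, for some of the antecedent formulas of M, a constructive proof of that formula. Contraction
  in M duplicates such proofs, and these never need cut formulas of their own. If the rule at the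
  root of M acts on a cut formula, the attached proof emits its own rules until its right formula is
  principal, and then both proofs advance silently. The rules emitted form the cut-free proof.

  An infinite run yields an infinite branch of M or of a single attached proof, and hence a winning
  trace there. If this trace is visible, it is a winning trace of the output; in particular
  infinitely many rules have been emitted. Otherwise M has a left \<open>\<mu>\<close>-trace through cut formulas, or
  an attached proof has a right \<open>\<nu>\<close>-trace. In an attached proof for which M waits forever the
  right formula is never principal; and if M and an attached proof advance together along a
  \<open>\<mu>\<close>-thread that is also a \<open>\<nu>\<close>-thread, we contradict the uniqueness of the simplest formula that
  occurs infinitely often in a thread.
\<close>

text \<open>That a sequent has at most one formula on the right is used twice. If the last rule of
  an attached proof is neither structural nor a left rule, then its right formula is principal or
  the proof is an axiom, so some reduction is always available. And the right side of the output is
  always that of M, so right traces of attached proofs stay hidden. Sometimes an attached proof must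
  replace M altogether: when it weakens its right formula away, and when M is the identity axiom on
  the cut formula. Winning depends only on tails of a branch, so no trace has to pass such a point.
  No measure bounds the number of silent steps beforehand. Productivity of the output comes from the
  argument for its correctness: every run has a winning trace, and a winning trace has infinitely
  many principal steps. Uniqueness of the simplest recurring formula is not immediate: unfolding
  \<open>Mu a\<close> to \<open>app a (Mu a)\<close> can increase complexity, and distinct formulas
  can have equal complexity. Comparison by free subformulas is the finer tool used there.\<close>

section \<open>Free subformulas and threads\<close>

text \<open>\<open>fsub p a\<close>: p is a free subformula of a, that is, \<open>a = b[x := p]\<close> for some b in which x occurs.\<close>

inductive fsub :: "fm \<Rightarrow> fm \<Rightarrow> bool" where
  fsub_refl: "fsub a a"
| fsub_Box: "fsub p a \<Longrightarrow> fsub p (Box a)"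
| fsub_Dia: "fsub p a \<Longrightarrow> fsub p (Dia a)"
| fsub_Conj: "fsub p a \<Longrightarrow> a |\<in>| G \<Longrightarrow> fsub p (Conj G)"
| fsub_Disj: "fsub p a \<Longrightarrow> a |\<in>| G \<Longrightarrow> fsub p (Disj G)"
| fsub_Mu: "fsub (lift p 0) a \<Longrightarrow> fsub p (Mu a)"
| fsub_Nu: "fsub (lift p 0) a \<Longrightarrow> fsub p (Nu a)"

primrec vfree :: "nat \<Rightarrow> fm \<Rightarrow> bool" where
  "vfree k (Var i) = (i = k)"
| "vfree k (NVar i) = False"
| "vfree k (Box a) = vfree k a"
| "vfree k (Dia a) = vfree k a"
| "vfree k (Conj G) = (True |\<in>| fimage (vfree k) G)"
| "vfree k (Disj G) = (True |\<in>| fimage (vfree k) G)"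
| "vfree k (Mu a) = vfree (Suc k) a"
| "vfree k (Nu a) = vfree (Suc k) a"

section \<open>Lifting, substitution and free indices\<close>

lemma lift_lift: "i \<le> k \<Longrightarrow> lift (lift a k) i = lift (lift a i) (Suc k)"
  by (induction a arbitrary: i k) (auto simp: fimage_fimage)

lemma subst_lift [simp]: "subst (lift a k) k s = a"
  by (induction a arbitrary: k s) (auto simp: fimage_fimage cong: fimage_cong)

lemma lift_subst:
  "i \<le> k \<Longrightarrow> lift (subst a k s) i = subst (lift a i) (Suc k) (lift s i)"
  by (induction a arbitrary: i k s) (auto simp: fimage_fimage lift_lift cong: fimage_cong)

lemma lift_inj: "lift a k = lift b k \<Longrightarrow> a = b"
  by (metis subst_lift)

text \<open>With index \<open>k\<close> absent in both polarities, substitution at \<open>k\<close>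
  merely closes the gap that lifting opens, and \<open>s\<close> is a filler. The negative polarity
  needs its own assumption because \<open>subst\<close> leaves \<open>NVar k\<close> in
  place.\<close>

lemma lift_subst_notfree:
  "\<not> vfree k a \<Longrightarrow> \<not> nfree k a \<Longrightarrow> lift (subst a k s) k = a"
proof (induction a arbitrary: k s)
  case (Conj G)
  then have "(\<lambda>a. lift (subst a k s) k) |`| G = id |`| G"
    by (intro fimage_cong) (auto simp: image_iff)
  then show ?case by (simp add: fimage_fimage comp_def)
next
  case (Disj G)
  then have "(\<lambda>a. lift (subst a k s) k) |`| G = id |`| G"
    by (intro fimage_cong) (auto simp: image_iff)
  then show ?case by (simp add: fimage_fimage comp_def)
qed auto

lemma vfree_lift_Suc: "k \<le> j \<Longrightarrow> vfree k (lift a (Suc j)) = vfree k a"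
  by (induction a arbitrary: k j) (auto simp: image_iff)

lemma vfree_lift_self: "\<not> vfree k (lift a k)"
  by (induction a arbitrary: k) (auto simp: image_iff)

lemma vfree_subst: "j \<le> k \<Longrightarrow> vfree j a \<Longrightarrow> vfree j (subst a (Suc k) s)"
  by (induction a arbitrary: k j s) (auto simp: image_iff, blast+)

lemma nfree_lift_Suc: "k \<le> j \<Longrightarrow> nfree k (lift a (Suc j)) = nfree k a"
  by (induction a arbitrary: k j) (auto simp: image_iff)

lemma nfree_lift_self: "\<not> nfree k (lift a k)"
  by (induction a arbitrary: k) (auto simp: image_iff)

lemma nfree_lift_below: "j \<le> k \<Longrightarrow> nfree (Suc k) (lift a j) = nfree k a"
  by (induction a arbitrary: k j) (auto simp: image_iff)

lemma nfree_subst: "j \<le> k \<Longrightarrow> nfree j a \<Longrightarrow> nfree j (subst a (Suc k) s)"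
  by (induction a arbitrary: k j s) (auto simp: image_iff, blast+)

lemma not_nfree_subst:
  "j \<le> k \<Longrightarrow> \<not> nfree j a \<Longrightarrow> \<not> nfree j s \<Longrightarrow> \<not> nfree j (subst a (Suc k) s)"
  by (induction a arbitrary: k j s) (auto simp: image_iff nfree_lift_below)

lemma wff_lift: "wff a \<Longrightarrow> wff (lift a k)"
  by (induction a arbitrary: k) (auto simp: nfree_lift_Suc)

lemma wff_subst: "wff a \<Longrightarrow> wff s \<Longrightarrow> wff (subst a k s)"
  by (induction a arbitrary: k s) (auto simp: wff_lift not_nfree_subst nfree_lift_self)

lemma wff_isub: "isub a b \<Longrightarrow> wff a \<Longrightarrow> wff b"
  by (induction a b rule: isub.induct) (auto simp: app_def wff_subst)

lemma cx_lift [simp]: "cx (lift a k) = cx a"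
  by (induction a arbitrary: k) (auto simp: fimage_fimage cong: fimage_cong)

lemma cx_Conj: "a |\<in>| G \<Longrightarrow> cx a < cx (Conj G)"
  by (auto simp: less_Suc_eq_le)

lemma cx_Disj: "a |\<in>| G \<Longrightarrow> cx a < cx (Disj G)"
  by (auto simp: less_Suc_eq_le)

section \<open>The free subformula relation, its order properties and its behaviour under
  substitution\<close>

lemma fsub_cx: "fsub p a \<Longrightarrow> p = a \<or> cx p < cx a"
proof (induction rule: fsub.induct)
  case (fsub_Conj p a G)
  then show ?case using cx_Conj[of a G] by (metis order_less_trans)
next
  case (fsub_Disj p a G)
  then show ?case using cx_Disj[of a G] by (metis order_less_trans)
qed auto

lemma fsub_lift: "fsub p a \<Longrightarrow> fsub (lift p k) (lift a k)"
proof (induction arbitrary: k rule: fsub.induct)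
  case (fsub_Conj p a G)
  then show ?case by (auto intro!: fsub.fsub_Conj[of _ "lift a k"])
next
  case (fsub_Disj p a G)
  then show ?case by (auto intro!: fsub.fsub_Disj[of _ "lift a k"])
qed (auto intro: fsub.intros simp: lift_lift)

lemma fsub_trans: "fsub q b \<Longrightarrow> fsub p q \<Longrightarrow> fsub p b"
  by (induction arbitrary: p rule: fsub.induct) (auto intro: fsub.intros fsub_lift)

inductive_cases fsub_VarE: "fsub p (Var i)"
inductive_cases fsub_NVarE: "fsub p (NVar i)"
inductive_cases fsub_BoxE: "fsub p (Box a)"
inductive_cases fsub_DiaE: "fsub p (Dia a)"
inductive_cases fsub_ConjE: "fsub p (Conj G)"
inductive_cases fsub_DisjE: "fsub p (Disj G)"
inductive_cases fsub_MuE: "fsub p (Mu a)"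
inductive_cases fsub_NuE: "fsub p (Nu a)"
lemmas fsubEs = fsub_VarE fsub_NVarE fsub_BoxE fsub_DiaE fsub_ConjE fsub_DisjE fsub_MuE fsub_NuE

text \<open>Binder case of \<open>fsub_lift_inv\<close>: the left side avoids index 0, hence so does
  \<open>q\<close>, which is therefore itself a lifting. The argument \<open>s\<close> is an
  arbitrary filler for the absent variable.\<close>

lemma lift_eq_lift:
  assumes "lift p 0 = lift q (Suc k)"
  shows "lift (subst q 0 s) 0 = q" "p = lift (subst q 0 s) k"
proof -
  have "\<not> vfree 0 q" "\<not> nfree 0 q"
    using assms vfree_lift_Suc[of 0 k q] vfree_lift_self[of 0 p] nfree_lift_Suc[of 0 k q]
      nfree_lift_self[of 0 p] by auto
  then show *: "lift (subst q 0 s) 0 = q" by (rule lift_subst_notfree)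
  show "p = lift (subst q 0 s) k"
    using lift_lift[of 0 k "subst q 0 s"] * assms by (metis le0 lift_inj)
qed

lemma fsub_lift_inv: "fsub p (lift a k) \<Longrightarrow> \<exists>q. p = lift q k \<and> fsub q a"
proof (induction a arbitrary: p k)
  case (Box a)
  from Box(2) have "p = lift (Box a) k \<or> fsub p (lift a k)" by (auto elim: fsubEs)
  then show ?case using Box(1) by (metis fsub_refl fsub_Box)
next
  case (Dia a)
  from Dia(2) have "p = lift (Dia a) k \<or> fsub p (lift a k)" by (auto elim: fsubEs)
  then show ?case using Dia(1) by (metis fsub_refl fsub_Dia)
next
  case (Conj G)
  from Conj(2) have "p = lift (Conj G) k \<or> (\<exists>a. a |\<in>| G \<and> fsub p (lift a k))"
    by (auto elim: fsubEs)
  then show ?case using Conj(1) by (metis fsub.intros(1,4))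
next
  case (Disj G)
  from Disj(2) have "p = lift (Disj G) k \<or> (\<exists>a. a |\<in>| G \<and> fsub p (lift a k))"
    by (auto elim: fsubEs)
  then show ?case using Disj(1) by (metis fsub.intros(1,5))
next
  case (Mu a)
  from Mu(2) have "p = lift (Mu a) k \<or> fsub (lift p 0) (lift a (Suc k))"
    by (auto elim: fsubEs)
  then show ?case
  proof
    assume "fsub (lift p 0) (lift a (Suc k))"
    then obtain q where q: "lift p 0 = lift q (Suc k)" "fsub q a" using Mu(1) by blast
    then show ?thesis using lift_eq_lift[OF q(1)] by (metis fsub_Mu)
  qed (blast intro: fsub_refl)
next
  case (Nu a)
  from Nu(2) have "p = lift (Nu a) k \<or> fsub (lift p 0) (lift a (Suc k))"
    by (auto elim: fsubEs)
  then show ?case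
  proof
    assume "fsub (lift p 0) (lift a (Suc k))"
    then obtain q where q: "lift p 0 = lift q (Suc k)" "fsub q a" using Nu(1) by blast
    then show ?thesis using lift_eq_lift[OF q(1)] by (metis fsub_Nu)
  qed (blast intro: fsub_refl)
next
  case (Var i)
  then have "p = lift (Var i) k" by (auto elim: fsubEs split: if_splits)
  then show ?case using fsub_refl by blast
next
  case (NVar i)
  then have "p = lift (NVar i) k" by (auto elim: fsubEs split: if_splits)
  then show ?case using fsub_refl by blast
qed

lemma fsub_unlift: "fsub (lift p k) (lift a k) \<Longrightarrow> fsub p a"
  using fsub_lift_inv lift_inj by blast

text \<open>Binder case of \<open>fsub_subst\<close>. Substitution at \<open>Suc k\<close> preserves
  occurrences of index 0, so \<open>g\<close> has none and the outer lifting can be stripped from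
  both sides.\<close>

lemma lift_eq_subst:
  assumes "lift p 0 = subst g (Suc k) (lift s 0)"
  obtains q where "g = lift q 0" "p = subst q k s"
proof -
  have "\<not> vfree 0 g" "\<not> nfree 0 g"
    using assms vfree_lift_self[of 0 p] nfree_lift_self[of 0 p] vfree_subst[of 0 k g "lift s 0"]
      nfree_subst[of 0 k g "lift s 0"] by auto
  then have *: "lift (subst g 0 s) 0 = g" by (rule lift_subst_notfree)
  moreover have "p = subst (subst g 0 s) k s"
    using lift_subst[of 0 k "subst g 0 s" s] * assms by (metis le0 lift_inj)
  ultimately show ?thesis using that by metis
qed

lemma fsub_subst: "fsub p (subst a k s) \<Longrightarrow> fsub p s \<or> (\<exists>g. fsub g a \<and> p = subst g k s)"
proof (induction a arbitrary: p k s)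
  case (Box a)
  from Box(2) have "p = subst (Box a) k s \<or> fsub p (subst a k s)" by (auto elim: fsubEs)
  then show ?case using Box(1) by (metis fsub_refl fsub_Box)
next
  case (Dia a)
  from Dia(2) have "p = subst (Dia a) k s \<or> fsub p (subst a k s)" by (auto elim: fsubEs)
  then show ?case using Dia(1) by (metis fsub_refl fsub_Dia)
next
  case (Conj G)
  from Conj(2) have "p = subst (Conj G) k s \<or> (\<exists>a. a |\<in>| G \<and> fsub p (subst a k s))"
    by (auto elim: fsubEs)
  then show ?case using Conj(1) by (metis fsub.intros(1,4))
next
  case (Disj G)
  from Disj(2) have "p = subst (Disj G) k s \<or> (\<exists>a. a |\<in>| G \<and> fsub p (subst a k s))"
    by (auto elim: fsubEs)
  then show ?case using Disj(1) by (metis fsub.intros(1,5))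
next
  case (Mu a)
  from Mu(2) have "p = subst (Mu a) k s \<or> fsub (lift p 0) (subst a (Suc k) (lift s 0))"
    by (auto elim: fsubEs)
  then show ?case
    using Mu(1)[of "lift p 0" "Suc k" "lift s 0"]
    by (metis fsub_Mu fsub_refl fsub_unlift lift_eq_subst)
next
  case (Nu a)
  from Nu(2) have "p = subst (Nu a) k s \<or> fsub (lift p 0) (subst a (Suc k) (lift s 0))"
    by (auto elim: fsubEs)
  then show ?case
    using Nu(1)[of "lift p 0" "Suc k" "lift s 0"]
    by (metis fsub_Nu fsub_refl fsub_unlift lift_eq_subst)
next
  case (Var i)
  then have "fsub p s \<or> p = subst (Var i) k s" by (auto elim: fsubEs split: if_splits)
  then show ?case using fsub_refl by blast
next
  case (NVar i)
  then have "p = subst (NVar i) k s" by (auto elim: fsubEs split: if_splits)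
  then show ?case using fsub_refl by blast
qed

lemma fsub_subst_self: "vfree k a \<Longrightarrow> fsub s (subst a k s)"
  by (induction a arbitrary: k s) (auto intro: fsub.intros simp: image_iff)

lemma nfree_fsub: "fsub p a \<Longrightarrow> nfree k p \<Longrightarrow> nfree k a"
proof (induction arbitrary: k rule: fsub.induct)
  case (fsub_Mu p a) then show ?case using nfree_lift_below[of 0 k p] by auto
next
  case (fsub_Nu p a) then show ?case using nfree_lift_below[of 0 k p] by auto
qed (auto simp: image_iff)

text \<open>An instance of a part \<open>g\<close> of the body either contains the bound variable,
  hence a copy of \<open>s\<close>, or avoids it and was already free below the binder. A part
  mentioning the bound variable only negatively would be neither, which is why
  \<open>nfree 0 a\<close> is excluded.\<close>

lemma fsub_unfold:
  assumes "fsub p (app a s)" "s = Mu a \<or> s = Nu a" "\<not> nfree 0 a"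
  shows "fsub p s \<or> fsub s p"
proof -
  { fix g assume g: "fsub g a" "p = subst g 0 s" "\<not> fsub s p"
    then have "\<not> vfree 0 g" "\<not> nfree 0 g"
      using fsub_subst_self nfree_fsub assms(3) by blast+
    then have "lift p 0 = g" using g(2) lift_subst_notfree by blast
    then have "fsub p s" using g(1) assms(2) fsub_Mu fsub_Nu by blast }
  then show ?thesis using fsub_subst[of p a 0 s] assms(1) unfolding app_def by blast
qed

text \<open>For connectives and modalities \<open>p\<close> already lies inside \<open>a\<close>;
  only unfolding a fixpoint can produce something larger, and then \<open>fsub_unfold\<close> keeps
  it comparable with \<open>a\<close>.\<close>

lemma isub_fsub:
  assumes "isub a b" "wff a" "fsub p b"
  shows "fsub p a \<or> fsub a p"
  using assms fsub_unfold[of p _ a] by (cases a) (auto intro: fsub.intros)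

lemma finite_fsub: "finite {p. fsub p a}"
proof (induction a)
  case (Conj G)
  have "{p. fsub p (Conj G)} \<subseteq> insert (Conj G) (\<Union>a\<in>fset G. {p. fsub p a})"
    by (auto elim: fsubEs)
  then show ?case by (rule finite_subset) (use Conj in auto)
next
  case (Disj G)
  have "{p. fsub p (Disj G)} \<subseteq> insert (Disj G) (\<Union>a\<in>fset G. {p. fsub p a})"
    by (auto elim: fsubEs)
  then show ?case by (rule finite_subset) (use Disj in auto)
next
  case (Mu a)
  have "{p. fsub p (Mu a)} \<subseteq> insert (Mu a) ((\<lambda>p. lift p 0) -` {p. fsub p a})"
    by (auto elim: fsubEs)
  moreover have "finite ((\<lambda>p. lift p 0) -` {p. fsub p a})"
    by (rule finite_vimageI[OF Mu]) (auto intro: injI lift_inj)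
  ultimately show ?case by (meson finite.insertI finite_subset)
next
  case (Nu a)
  have "{p. fsub p (Nu a)} \<subseteq> insert (Nu a) ((\<lambda>p. lift p 0) -` {p. fsub p a})"
    by (auto elim: fsubEs)
  moreover have "finite ((\<lambda>p. lift p 0) -` {p. fsub p a})"
    by (rule finite_vimageI[OF Nu]) (auto intro: injI lift_inj)
  ultimately show ?case by (meson finite.insertI finite_subset)
next
  case (Box a)
  have "{p. fsub p (Box a)} \<subseteq> insert (Box a) {p. fsub p a}" by (auto elim: fsubEs)
  then show ?case using Box by (meson finite.insertI finite_subset)
next
  case (Dia a)
  have "{p. fsub p (Dia a)} \<subseteq> insert (Dia a) {p. fsub p a}" by (auto elim: fsubEs)
  then show ?case using Dia by (meson finite.insertI finite_subset)
next
  case (Var i)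
  have "{p. fsub p (Var i)} \<subseteq> {Var i}" by (auto elim: fsubEs)
  then show ?case by (meson finite.simps finite_subset)
next
  case (NVar i)
  have "{p. fsub p (NVar i)} \<subseteq> {NVar i}" by (auto elim: fsubEs)
  then show ?case by (meson finite.simps finite_subset)
qed

section \<open>Stuttering threads and their simplest recurring formula\<close>

definition sthread :: "(nat \<Rightarrow> fm) \<Rightarrow> bool" where
  "sthread f \<longleftrightarrow> (\<forall>n. f (Suc n) = f n \<or> isub (f n) (f (Suc n)))"

lemma sthread_wff: "sthread f \<Longrightarrow> wff (f 0) \<Longrightarrow> wff (f n)"
  by (induction n) (auto simp: sthread_def, metis wff_isub)

text \<open>Extending a segment at its front works because, by \<open>isub_fsub\<close>, the old witness and the new
  first formula are comparable; extending it at its end would not.\<close>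

lemma sthread_segment:
  assumes "sthread f" "wff (f 0)"
  shows "\<exists>l\<ge>i. \<forall>j. i \<le> j \<longrightarrow> j \<le> i + n \<longrightarrow> fsub (f l) (f j)"
proof (induction n arbitrary: i)
  case 0
  show ?case by (intro exI[of _ i]) (auto intro: fsub_refl)
next
  case (Suc n)
  obtain l where l: "l \<ge> Suc i" "\<And>j. Suc i \<le> j \<Longrightarrow> j \<le> Suc i + n \<Longrightarrow> fsub (f l) (f j)"
    using Suc[of "Suc i"] by blast
  have "f (Suc i) = f i \<or> isub (f i) (f (Suc i))" using assms(1) by (auto simp: sthread_def)
  moreover have "fsub (f l) (f (Suc i))" using l(2) by simp
  ultimately have "fsub (f l) (f i) \<or> fsub (f i) (f l)"
    using isub_fsub sthread_wff[OF assms] by metis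
  then show ?case
  proof
    assume a: "fsub (f l) (f i)"
    have "fsub (f l) (f j)" if "i \<le> j" "j \<le> i + Suc n" for j
      using a l(2)[of j] that by (cases "j = i") auto
    then show ?thesis using l(1) by (intro exI[of _ l]) auto
  next
    assume a: "fsub (f i) (f l)"
    have "fsub (f i) (f j)" if "i \<le> j" "j \<le> i + Suc n" for j
      using fsub_trans[OF l(2)[of j] a] that by (cases "j = i") (auto intro: fsub_refl)
    then show ?thesis by (intro exI[of _ i]) auto
  qed
qed

text \<open>If a and b differ, then every tail of f visits a common free subformula of both, which is
  strictly simpler than a; as there are finitely many candidates, one of them recurs.\<close>

lemma sthread_least_unique:
  assumes "sthread f" "wff (f 0)"
    and a: "inf_occ f a" "\<And>c. inf_occ f c \<Longrightarrow> cx a \<le> cx c"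
    and b: "inf_occ f b" "\<And>c. inf_occ f c \<Longrightarrow> cx b \<le> cx c"
  shows "a = b"
proof (rule ccontr)
  assume "a \<noteq> b"
  have cx: "cx a = cx b" using a b by (simp add: antisym)
  have "\<exists>l\<ge>N. f l \<in> {p. fsub p a \<and> cx p < cx a}" for N
  proof -
    obtain i where i: "i \<ge> N" "f i = a" using a(1) by (auto simp: inf_occ_def INFM_nat_le)
    obtain j where j: "j \<ge> i" "f j = b" using b(1) by (auto simp: inf_occ_def INFM_nat_le)
    obtain l where l: "l \<ge> i" "\<And>m. i \<le> m \<Longrightarrow> m \<le> i + (j - i) \<Longrightarrow> fsub (f l) (f m)"
      using sthread_segment[OF assms(1,2)] by blast
    have "fsub (f l) a" "fsub (f l) b" using l(2)[of i] l(2)[of j] i j by auto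
    \<comment> \<open>If \<open>f l\<close> were \<open>a\<close> itself, then \<open>a\<close>
      would be a free subformula of the different formula \<open>b\<close> and hence strictly
      simpler than \<open>b\<close>.\<close>
    then have "cx (f l) < cx a" using fsub_cx \<open>a \<noteq> b\<close> cx by (metis order_less_irrefl)
    then show ?thesis using \<open>fsub (f l) a\<close> l(1) i(1) by (intro exI[of _ l]) auto
  qed
  then have "\<exists>\<^sub>\<infinity>n. \<exists>p\<in>{p. fsub p a \<and> cx p < cx a}. f n = p"
    by (auto simp: INFM_nat_le)
  then obtain p where "cx p < cx a" "\<exists>\<^sub>\<infinity>n. f n = p"
    using finite_subset[OF _ finite_fsub[of a], of "{p. fsub p a \<and> cx p < cx a}"]
    by (subst (asm) INFM_finite_Bex_distrib) auto
  then show False using a(2)[of p] by (simp add: inf_occ_def)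
qed

section \<open>Winning traces along branches\<close>

text \<open>Here f lists the formulas of a trace at all times, and \<open>pf\<close> marks its principal steps. A
  formula changes only at principal steps, so the thread supported by the trace has the same
  formulas occurring infinitely often as f itself (\<open>inf_occ_sample\<close>).\<close>

definition win :: "(fm \<Rightarrow> fm) \<Rightarrow> (nat \<Rightarrow> fm) \<Rightarrow> (nat \<Rightarrow> bool) \<Rightarrow> bool" where
  "win C f pf \<longleftrightarrow> (\<exists>\<^sub>\<infinity>n. pf n) \<and>
     (\<exists>a. inf_occ f (C a) \<and> (\<forall>b. inf_occ f b \<longrightarrow> cx (C a) \<le> cx b))"

definition good_trace ::
  "(nat \<Rightarrow> seqt) \<Rightarrow> (nat \<Rightarrow> link) \<Rightarrow> nat \<Rightarrow> (nat \<Rightarrow> occ) \<Rightarrow> (nat \<Rightarrow> bool) \<Rightarrow> bool" where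
  "good_trace S lk k oc pf \<longleftrightarrow> trace lk k oc pf \<and>
     ((\<forall>n\<ge>k. fst (oc n) = Lft) \<and> win Mu (\<lambda>n. fmat (S n) (oc n)) pf \<or>
      (\<forall>n\<ge>k. fst (oc n) = Rgt) \<and> win Nu (\<lambda>n. fmat (S n) (oc n)) pf)"

text \<open>The link of an idle step, used to synchronize branches that advance at different speeds.\<close>

definition stay :: link where
  "stay = {(oc, oc, False) | oc. True}"

section \<open>Recurrence under shifts, changes of speed and sampling\<close>

lemma win_cong_inf_occ:
  assumes "\<And>b. inf_occ f b \<longleftrightarrow> inf_occ g b" "\<exists>\<^sub>\<infinity>n. qf n" "win C f pf"
  shows "win C g qf"
  using assms by (simp add: win_def)

lemma INFM_Suc: "(\<exists>\<^sub>\<infinity>n. P (Suc n)) \<longleftrightarrow> (\<exists>\<^sub>\<infinity>n. P n)"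
  unfolding cofinite_eq_sequentially frequently_def
  using eventually_sequentially_Suc[of "\<lambda>n. \<not> P n"] by simp

lemma inf_occ_Suc: "inf_occ (\<lambda>n. f (Suc n)) b \<longleftrightarrow> inf_occ f b"
  using INFM_Suc[of "\<lambda>n. f n = b"] by (simp add: inf_occ_def)

text \<open>A monotone surjection of the naturals repeats each index only finitely often, so it
  changes the speed but not what recurs.\<close>

lemma inf_occ_comp:
  fixes h :: "nat \<Rightarrow> nat"
  assumes "mono h" "surj h"
  shows "inf_occ (\<lambda>n. f (h n)) b \<longleftrightarrow> inf_occ f b"
proof
  assume *: "inf_occ (\<lambda>n. f (h n)) b"
  show "inf_occ f b"
    unfolding inf_occ_def INFM_nat_le
  proof
    fix m
    obtain n where "m = h n" using \<open>surj h\<close> by (metis surjD)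
    moreover obtain n' where "n' \<ge> n" "f (h n') = b"
      using * by (auto simp: inf_occ_def INFM_nat_le)
    ultimately show "\<exists>n\<ge>m. f n = b" using \<open>mono h\<close> by (auto dest: monoD)
  qed
next
  assume *: "inf_occ f b"
  show "inf_occ (\<lambda>n. f (h n)) b"
    unfolding inf_occ_def INFM_nat_le
  proof
    fix m
    obtain n' where n': "n' \<ge> Suc (h m)" "f n' = b"
      using * by (auto simp: inf_occ_def INFM_nat_le)
    then obtain n where "n' = h n" using \<open>surj h\<close> by (metis surjD)
    moreover from this n' have "m \<le> n" using \<open>mono h\<close> by (metis monoD nat_le_linear not_less_eq_eq)
    ultimately show "\<exists>n\<ge>m. f (h n) = b" using n' by auto
  qed
qed

lemma const_until:
  assumes "\<And>m. n \<le> m \<Longrightarrow> m < n' \<Longrightarrow> f (Suc m) = f m" "n \<le> (n'::nat)"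
  shows "f n' = f n"
  using assms(2,1) by (induction n' rule: dec_induct) auto

text \<open>Every value persists until the next marked step, so sampling there loses nothing. Marked
  steps need only be included in \<open>range p\<close>: \<open>coproof_iff\<close> samples exactly
  at the principal steps, \<open>good_trace_sample\<close> at all moves.\<close>

lemma inf_occ_sample:
  assumes p: "strict_mono p" "\<And>n. n \<ge> k \<Longrightarrow> pf n \<Longrightarrow> n \<in> range p"
    and f: "\<And>n. n \<ge> k \<Longrightarrow> \<not> pf n \<Longrightarrow> f (Suc n) = f n"
    and inf: "\<exists>\<^sub>\<infinity>n. pf n"
  shows "inf_occ (\<lambda>j. f (p j)) b \<longleftrightarrow> inf_occ f b"
proof
  assume "inf_occ (\<lambda>j. f (p j)) b"
  then show "inf_occ f b"
    using p(1) unfolding inf_occ_def INFM_nat_le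
    by (meson order_trans strict_mono_imp_increasing)
next
  assume *: "inf_occ f b"
  show "inf_occ (\<lambda>j. f (p j)) b"
    unfolding inf_occ_def INFM_nat_le
  proof
    fix m
    obtain n where n: "n \<ge> max k (p m)" "f n = b"
      using * unfolding inf_occ_def INFM_nat_le by blast
    define n' where "n' = (LEAST n'. n' \<ge> n \<and> pf n')"
    have "\<exists>n'. n' \<ge> n \<and> pf n'" using inf unfolding INFM_nat_le by blast
    then have n': "n' \<ge> n" "pf n'" unfolding n'_def by (metis (mono_tags, lifting) LeastI)+
    have "\<not> pf j" if "n \<le> j" "j < n'" for j
      using that not_less_Least[of j "\<lambda>n'. n' \<ge> n \<and> pf n'"] unfolding n'_def by blast
    then have "f (Suc j) = f j" if "n \<le> j" "j < n'" for j
      using f[of j] that n by auto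
    then have "f n' = f n" using n'(1) by (rule const_until)
    moreover from n n' have "n' \<in> range p" by (intro p(2)) auto
    then obtain j where j: "n' = p j" by blast
    moreover have "p m \<le> p j" using n n' j by linarith
    then have "m \<le> j" using p(1) by (simp add: strict_mono_less_eq)
    ultimately show "\<exists>j\<ge>m. f (p j) = b" using n by auto
  qed
qed

text \<open>In this locale \<open>mtime j\<close> is the time of the j-th move and \<open>idx n\<close> the number of moves before time n.\<close>

locale moves =
  fixes mv :: "nat \<Rightarrow> bool"
  assumes inf_mv: "\<exists>\<^sub>\<infinity>n. mv n"
begin

definition mtime :: "nat \<Rightarrow> nat" where "mtime = enumerate {n. mv n}"
definition idx :: "nat \<Rightarrow> nat" where "idx n = card {m. m < n \<and> mv m}"

lemma infinite_mv: "infinite {n. mv n}"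
  using inf_mv by (simp add: INFM_iff_infinite)

lemma mtime_strict: "strict_mono mtime"
  unfolding mtime_def by (rule strict_mono_enumerate[OF infinite_mv])

lemma mtime_range: "range mtime = {n. mv n}"
  unfolding mtime_def by (rule range_enumerate[OF infinite_mv])

lemma mv_mtime: "mv (mtime j)"
  using mtime_range by auto

lemma idx_mtime: "idx (mtime j) = j"
proof -
  have "{m. m < mtime j \<and> mv m} = mtime ` {..<j}"
  proof (intro set_eqI iffI)
    fix m assume m: "m \<in> {m. m < mtime j \<and> mv m}"
    then obtain i where "m = mtime i" using mtime_range by blast
    then show "m \<in> mtime ` {..<j}" using m mtime_strict by (auto simp: strict_mono_less)
  next
    fix m assume "m \<in> mtime ` {..<j}"
    then show "m \<in> {m. m < mtime j \<and> mv m}"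
      using mtime_range mtime_strict by (auto simp: strict_mono_less)
  qed
  moreover have "inj_on mtime {..<j}"
    using strict_mono_imp_inj_on[OF mtime_strict] by (rule inj_on_subset) (rule subset_UNIV)
  ultimately show ?thesis by (simp add: idx_def card_image)
qed

lemma idx_0 [simp]: "idx 0 = 0"
  by (simp add: idx_def)

lemma idx_Suc: "idx (Suc n) = (if mv n then Suc (idx n) else idx n)"
proof -
  have "{m. m < Suc n \<and> mv m} = (if mv n then insert n {m. m < n \<and> mv m} else {m. m < n \<and> mv m})"
    by (auto simp: less_Suc_eq)
  then show ?thesis by (simp add: idx_def)
qed

lemma mono_idx: "mono idx"
  by (rule mono_iff_le_Suc[THEN iffD2]) (simp add: idx_Suc)

lemma surj_idx: "surj idx"
  using idx_mtime by (metis surjI)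

lemma mtime_idx: "mv n \<Longrightarrow> mtime (idx n) = n"
  using mtime_range idx_mtime by (metis imageE mem_Collect_eq)

text \<open>As \<open>idx n\<close> counts the moves strictly before \<open>n\<close>,
  \<open>mtime (idx n)\<close> is the first move at or after \<open>n\<close>.\<close>

lemma le_mtime_idx: "n \<le> mtime (idx n)"
proof (rule ccontr)
  assume "\<not> n \<le> mtime (idx n)"
  then have "idx (Suc (mtime (idx n))) \<le> idx n" by (intro monoD[OF mono_idx]) auto
  then show False by (simp add: idx_Suc mv_mtime idx_mtime)
qed

lemma no_move: "n \<le> m \<Longrightarrow> m < mtime (idx n) \<Longrightarrow> \<not> mv m"
proof
  assume "n \<le> m" "m < mtime (idx n)" "mv m"
  then have "mtime (idx m) < mtime (idx n)" by (simp add: mtime_idx)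
  then have "idx m < idx n" using mtime_strict by (simp add: strict_mono_less)
  with monoD[OF mono_idx \<open>n \<le> m\<close>] show False by simp
qed

lemma const_mtime:
  assumes "\<And>m. n \<le> m \<Longrightarrow> \<not> mv m \<Longrightarrow> f (Suc m) = f m"
  shows "f (mtime (idx n)) = f n"
proof (rule const_until)
  fix m assume "n \<le> m" "m < mtime (idx n)"
  with assms no_move show "f (Suc m) = f m" by blast
qed (rule le_mtime_idx)

lemma const_mtime_Suc:
  assumes "\<And>m. mtime j \<le> m \<Longrightarrow> \<not> mv m \<Longrightarrow> f (Suc m) = f m"
  shows "f (mtime (Suc j)) = f (Suc (mtime j))"
proof -
  have "f (mtime (idx (Suc (mtime j)))) = f (Suc (mtime j))"
    by (rule const_mtime) (use assms in simp)
  then show ?thesis by (simp add: idx_Suc mv_mtime idx_mtime)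
qed

end

section \<open>Links of rule instances, and co-proofs in terms of winning traces\<close>

definition valid_occ :: "seqt \<Rightarrow> occ \<Rightarrow> bool" where
  "valid_occ S oc \<longleftrightarrow> snd oc < length (case fst oc of Lft \<Rightarrow> fst S | Rgt \<Rightarrow> snd S)"

text \<open>This is what trace arguments need from the rules: the flag decides whether the formula
  may change, and a set flag forces a logical rule.\<close>

lemma step_link:
  assumes "step b S P" "(S', l) \<in> set P" "(oc, oc', p) \<in> l"
  shows "valid_occ S oc" "valid_occ S' oc'" "fst oc' = fst oc"
    "if p then b \<and> isub (fmat S oc) (fmat S' oc') else fmat S' oc' = fmat S oc"
  using assms
  by (induction rule: step.induct;
      force simp: valid_occ_def fmat_def cp_def idl_def lkL_def lkR_def swp_def nth_append nth_Cons' split: if_splits)+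

lemma wfd_step:
  assumes "wfd T"
  shows "step (logic T) (root T) (map (\<lambda>(u, l). (root u, l)) (kids T))"
    and "(u, l) \<in> set (kids T) \<Longrightarrow> wfd u"
  using assms by (cases, force)+

lemma wfd_link:
  assumes "wfd T" "(u, l) \<in> set (kids T)" "(oc, oc', p) \<in> l"
  shows "valid_occ (root T) oc" "valid_occ (root u) oc'" "fst oc' = fst oc"
    "if p then logic T \<and> isub (fmat (root T) oc) (fmat (root u) oc')
     else fmat (root u) oc' = fmat (root T) oc"
  using step_link[OF wfd_step(1)[OF assms(1)], of "root u" l oc oc' p] assms by force+

lemma wfd_branch: "wfd T \<Longrightarrow> branch T br lk \<Longrightarrow> wfd (br n)"
proof (induction n)
  case (Suc n)
  then have "(br (Suc n), lk n) \<in> set (kids (br n))" by (simp add: branch_def)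
  with Suc show ?case using wfd_step(2) by blast
qed (simp add: branch_def)

text \<open>The supported thread consists of the trace formulas sampled at principal steps. In
  between nothing changes, so consecutive samples are immediate subformulas and the same formulas
  recur. Principal steps occur only at logical rules, so a winning trace also yields infinitely many
  of these.\<close>

lemma coproof_iff:
  "coproof T \<longleftrightarrow> wfd T \<and>
     (\<forall>br lk. branch T br lk \<longrightarrow> (\<exists>k oc pf. good_trace (\<lambda>n. root (br n)) lk k oc pf))"
proof -
  { fix br lk k oc pf
    assume wfd: "wfd T" and br: "branch T br lk" and tr: "trace lk k oc pf"
    let ?f = "\<lambda>n. fmat (root (br n)) (oc n)"
    have lnk: "if pf n then logic (br n) \<and> isub (?f n) (?f (Suc n)) else ?f (Suc n) = ?f n"
      if "n \<ge> k" for n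
      using wfd_link(4)[of "br n" "br (Suc n)" "lk n" "oc n" "oc (Suc n)" "pf n"]
        wfd_branch[OF wfd br] br tr that by (auto simp: branch_def trace_def)
    { fix t assume "supports br k oc pf t"
      then obtain p where p: "strict_mono p" "range p = {n. k \<le> n \<and> pf n}" "\<And>j. t j = ?f (p j)"
        by (auto simp: supports_def)
      have "infinite (range p)" using p(1) by (simp add: range_inj_infinite strict_mono_imp_inj_on)
      then have inf: "\<exists>\<^sub>\<infinity>n. pf n"
        unfolding INFM_iff_infinite using p(2) by (metis (no_types, lifting) finite_subset mem_Collect_eq subsetI)
      have "inf_occ t b \<longleftrightarrow> inf_occ ?f b" for b
        using inf_occ_sample[of p k pf ?f b] p lnk inf by (auto simp: p(3)[abs_def])
      then have "mu_thread t \<Longrightarrow> win Mu ?f pf" "nu_thread t \<Longrightarrow> win Nu ?f pf"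
        using inf by (auto simp: win_def mu_thread_def nu_thread_def) }
    note 1 = this
    { assume inf: "\<exists>\<^sub>\<infinity>n. pf n"
      then interpret moves "\<lambda>n. k \<le> n \<and> pf n"
        by unfold_locales (auto simp: INFM_nat_le, meson nat_le_linear order_trans)
      have mt: "k \<le> mtime j" "pf (mtime j)" for j using mv_mtime by auto
      have sup: "supports br k oc pf (\<lambda>j. ?f (mtime j))"
        unfolding supports_def using mtime_strict mtime_range by blast
      have "?f (mtime (Suc j)) = ?f (Suc (mtime j))" for j
      proof (rule const_mtime_Suc)
        fix m assume m: "mtime j \<le> m" "\<not> (k \<le> m \<and> pf m)"
        then have "k \<le> m" using mt(1)[of j] by linarith
        with lnk[OF this] m show "?f (Suc m) = ?f m" by simp
      qed
      then have "isub (?f (mtime j)) (?f (mtime (Suc j)))" for j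
        using lnk[OF mt(1)[of j]] mt(2)[of j] by simp
      then have th: "thread (\<lambda>j. ?f (mtime j))" by (simp add: thread_def)
      have "inf_occ (\<lambda>j. ?f (mtime j)) b \<longleftrightarrow> inf_occ ?f b" for b
        by (rule inf_occ_sample[of mtime k pf]) (use lnk inf mtime_strict mtime_range in auto)
      then have "win Mu ?f pf \<Longrightarrow> mu_thread (\<lambda>j. ?f (mtime j))"
        "win Nu ?f pf \<Longrightarrow> nu_thread (\<lambda>j. ?f (mtime j))"
        using th by (auto simp: win_def mu_thread_def nu_thread_def)
      moreover have "\<exists>\<^sub>\<infinity>n. logic (br n)"
        using inf lnk unfolding INFM_nat_le by (meson nat_le_linear order_trans)
      ultimately have "\<exists>\<^sub>\<infinity>n. logic (br n)"
        "win Mu ?f pf \<Longrightarrow> \<exists>t. supports br k oc pf t \<and> mu_thread t"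
        "win Nu ?f pf \<Longrightarrow> \<exists>t. supports br k oc pf t \<and> nu_thread t"
        using sup by blast+ }
    note 2 = this
    have "((\<exists>\<^sub>\<infinity>n. logic (br n)) \<and> (\<exists>t. supports br k oc pf t \<and>
           (((\<forall>n\<ge>k. fst (oc n) = Lft) \<and> mu_thread t) \<or>
            ((\<forall>n\<ge>k. fst (oc n) = Rgt) \<and> nu_thread t)))) \<Longrightarrow> good_trace (\<lambda>n. root (br n)) lk k oc pf"
      "good_trace (\<lambda>n. root (br n)) lk k oc pf \<Longrightarrow>
       ((\<exists>\<^sub>\<infinity>n. logic (br n)) \<and> (\<exists>t. supports br k oc pf t \<and>
           (((\<forall>n\<ge>k. fst (oc n) = Lft) \<and> mu_thread t) \<or>
            ((\<forall>n\<ge>k. fst (oc n) = Rgt) \<and> nu_thread t))))"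
      subgoal using 1 tr unfolding good_trace_def by blast
      subgoal premises prems
      proof -
        have "\<exists>\<^sub>\<infinity>n. pf n" using prems by (auto simp: good_trace_def win_def)
        from 2[OF this] prems show ?thesis unfolding good_trace_def by blast
      qed
      done }
  note * = this
  have tr: "good_trace S lk k oc pf \<Longrightarrow> trace lk k oc pf" for S lk k oc pf
    by (simp add: good_trace_def)
  show ?thesis
    unfolding coproof_def using *(1) *(2) tr by (smt (verit, best))
qed

section \<open>Branches with idle steps\<close>

definition srun :: "(nat \<Rightarrow> ptree) \<Rightarrow> (nat \<Rightarrow> bool) \<Rightarrow> (nat \<Rightarrow> link) \<Rightarrow> bool" where
  "srun M mv lk \<longleftrightarrow>
     (\<forall>n. if mv n then (M (Suc n), lk n) \<in> set (kids (M n)) else M (Suc n) = M n)"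

text \<open>Deleting the idle steps leaves a genuine branch. Its winning trace is slowed down again
  along \<open>idx\<close>, with idle steps counted as non-principal. Validity of an occurrence is
  read off the next link of the branch.\<close>

lemma coproof_srun:
  assumes "coproof (M 0)" "srun M mv lk" "\<exists>\<^sub>\<infinity>n. mv n"
  obtains k oc pf where
    "good_trace (\<lambda>n. root (M n)) (\<lambda>n. if mv n then lk n else stay) k oc pf"
    "\<And>n. n \<ge> k \<Longrightarrow> valid_occ (root (M n)) (oc n)"
proof -
  interpret moves mv by unfold_locales fact
  define br where "br j = M (mtime j)" for j
  have M: "M n = br (idx n)" for n
    unfolding br_def using assms(2) by (subst const_mtime) (auto simp: srun_def split: if_splits)
  have branch: "branch (M 0) br (\<lambda>j. lk (mtime j))"
    unfolding branch_def
  proof (intro conjI allI)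
    show "br 0 = M 0" using M[of 0] by simp
    fix j
    have "(M (Suc (mtime j)), lk (mtime j)) \<in> set (kids (M (mtime j)))"
      using assms(2) mv_mtime[of j] by (auto simp: srun_def)
    then show "(br (Suc j), lk (mtime j)) \<in> set (kids (br j))"
      by (simp add: M idx_Suc mv_mtime idx_mtime)
  qed
  then obtain k oc pf where gt: "good_trace (\<lambda>j. root (br j)) (\<lambda>j. lk (mtime j)) k oc pf"
    using assms(1) coproof_iff by blast
  let ?f = "\<lambda>j. fmat (root (br j)) (oc j)"
  let ?pf = "\<lambda>n. mv n \<and> pf (idx n)"
  have le: "k \<le> idx n" if "mtime k \<le> n" for n
    using monoD[OF mono_idx that] by (simp add: idx_mtime)
  have io: "inf_occ (\<lambda>n. fmat (root (M n)) (oc (idx n))) b \<longleftrightarrow> inf_occ ?f b" for b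
    unfolding M using inf_occ_comp[OF mono_idx surj_idx, of ?f] by simp
  have pf: "\<exists>\<^sub>\<infinity>n. ?pf n" if "\<exists>\<^sub>\<infinity>n. pf n"
    unfolding INFM_nat_le
  proof
    fix m
    from that[unfolded INFM_nat_le, rule_format, of m] obtain j where "j \<ge> m" "pf j" by blast
    then have "mtime j \<ge> m \<and> ?pf (mtime j)"
      using mv_mtime strict_mono_imp_increasing[OF mtime_strict, of j] by (simp add: idx_mtime)
    then show "\<exists>n\<ge>m. ?pf n" by blast
  qed
  have wm: "win C (\<lambda>n. fmat (root (M n)) (oc (idx n))) ?pf" if "win C ?f pf" for C
    using win_cong_inf_occ[OF _ _ that] io pf that by (simp add: win_def)
  have "trace (\<lambda>n. if mv n then lk n else stay) (mtime k) (\<lambda>n. oc (idx n)) ?pf"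
    unfolding trace_def
  proof (intro allI impI)
    fix n assume "mtime k \<le> n"
    then have "(oc (idx n), oc (Suc (idx n)), pf (idx n)) \<in> lk (mtime (idx n))"
      using gt le by (auto simp: good_trace_def trace_def)
    then show "(oc (idx n), oc (idx (Suc n)), ?pf n) \<in> (if mv n then lk n else stay)"
      by (auto simp: idx_Suc mtime_idx stay_def)
  qed
  then have "good_trace (\<lambda>n. root (M n)) (\<lambda>n. if mv n then lk n else stay) (mtime k) (\<lambda>n. oc (idx n)) ?pf"
    using gt le wm unfolding good_trace_def by metis
  moreover have "valid_occ (root (M n)) (oc (idx n))" if "n \<ge> mtime k" for n
  proof -
    have "(br (Suc (idx n)), lk (mtime (idx n))) \<in> set (kids (br (idx n)))"
      using branch by (simp add: branch_def)
    moreover have "(oc (idx n), oc (Suc (idx n)), pf (idx n)) \<in> lk (mtime (idx n))"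
      using gt le[OF that] by (simp add: good_trace_def trace_def)
    moreover have "wfd (br (idx n))"
      using branch assms(1) wfd_branch by (auto simp: coproof_def)
    ultimately show ?thesis unfolding M by (metis wfd_link(1))
  qed
  ultimately show ?thesis by (rule that)
qed

text \<open>Converse of the slowing down in \<open>coproof_srun\<close>: idle steps fix the
  occurrence and carry no principal step, so the restriction to the moves is still a trace and the
  same formulas recur.\<close>

lemma good_trace_sample:
  assumes mv: "\<exists>\<^sub>\<infinity>n. mv n"
    and gt: "good_trace S (\<lambda>n. if mv n then lk n else stay) k oc pf"
    and f: "\<And>n. n \<ge> k \<Longrightarrow> \<not> pf n \<Longrightarrow> fmat (S (Suc n)) (oc (Suc n)) = fmat (S n) (oc n)"
  shows "\<exists>k oc pf. good_trace (\<lambda>j. S (moves.mtime mv j)) (\<lambda>j. lk (moves.mtime mv j)) k oc pf"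
proof -
  interpret moves mv by unfold_locales fact
  let ?f = "\<lambda>n. fmat (S n) (oc n)"
  have le: "k \<le> mtime j" if "idx k \<le> j" for j
    using that le_mtime_idx[of k] mtime_strict by (meson order_trans strict_mono_less_eq)
  have tr: "(oc n, oc (Suc n), pf n) \<in> (if mv n then lk n else stay)" if "n \<ge> k" for n
    using gt that by (simp add: good_trace_def trace_def)
  have nmv: "\<not> pf n \<and> oc (Suc n) = oc n" if "n \<ge> k" "\<not> mv n" for n
    using tr[OF that(1)] that(2) by (auto simp: stay_def)
  have "oc (mtime (Suc j)) = oc (Suc (mtime j))" if "idx k \<le> j" for j
    using le[OF that] nmv by (intro const_mtime_Suc) auto
  then have trace: "trace (\<lambda>j. lk (mtime j)) (idx k) (\<lambda>j. oc (mtime j)) (\<lambda>j. pf (mtime j))"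
    unfolding trace_def using tr le mv_mtime by (metis (full_types))
  have "win C (\<lambda>j. ?f (mtime j)) (\<lambda>j. pf (mtime j))" if w: "win C ?f pf" for C
  proof -
    have inf: "\<exists>\<^sub>\<infinity>n. pf n" using w by (simp add: win_def)
    have "\<exists>\<^sub>\<infinity>j. pf (mtime j)" unfolding INFM_nat_le
    proof
      fix m
      from inf[unfolded INFM_nat_le, rule_format, of "max k (mtime m)"]
      obtain n where n: "n \<ge> max k (mtime m)" "pf n" by blast
      then have "mv n" using nmv by auto
      then have "pf (mtime (idx n))" "m \<le> idx n"
        using n mtime_idx monoD[OF mono_idx, of "mtime m" n] by (auto simp: idx_mtime)
      then show "\<exists>j\<ge>m. pf (mtime j)" by blast
    qed
    moreover have "inf_occ (\<lambda>j. ?f (mtime j)) b \<longleftrightarrow> inf_occ ?f b" for b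
      by (rule inf_occ_sample[of mtime k pf]) (use nmv f inf mtime_strict mtime_range in auto)
    ultimately show ?thesis using win_cong_inf_occ[OF _ _ w] by blast
  qed
  then have "good_trace (\<lambda>j. S (mtime j)) (\<lambda>j. lk (mtime j)) (idx k) (\<lambda>j. oc (mtime j)) (\<lambda>j. pf (mtime j))"
    using trace gt le unfolding good_trace_def by blast
  then show ?thesis by blast
qed

text \<open>Prepending the edge turns a branch of \<open>u\<close> into one of \<open>T\<close>, and
  winning is insensitive to a shift by one.\<close>

lemma coproof_kid:
  assumes "coproof T" "(u, l) \<in> set (kids T)"
  shows "coproof u"
  unfolding coproof_iff
proof (intro conjI allI impI)
  show "wfd u" using assms wfd_step(2) coproof_def by blast
  fix br lk assume "branch u br lk"
  then have "branch T (case_nat T br) (case_nat l lk)"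
    using assms(2) by (auto simp: branch_def split: nat.split)
  then obtain k oc pf where
    gt: "good_trace (\<lambda>n. root (case_nat T br n)) (case_nat l lk) k oc pf"
    using assms(1) coproof_iff by blast
  have tr: "trace lk k (\<lambda>n. oc (Suc n)) (\<lambda>n. pf (Suc n))"
    unfolding trace_def
  proof (intro allI impI)
    fix n assume "k \<le> n"
    then have "(oc (Suc n), oc (Suc (Suc n)), pf (Suc n)) \<in> case_nat l lk (Suc n)"
      using gt unfolding good_trace_def trace_def by (meson le_SucI)
    then show "(oc (Suc n), oc (Suc (Suc n)), pf (Suc n)) \<in> lk n" by simp
  qed
  have "win C (\<lambda>n. fmat (root (br n)) (oc (Suc n))) (\<lambda>n. pf (Suc n))"
    if "win C (\<lambda>n. fmat (root (case_nat T br n)) (oc n)) pf" for C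
    using that inf_occ_Suc[of "\<lambda>n. fmat (root (case_nat T br n)) (oc n)"]
      INFM_Suc[of pf] by (simp add: win_def)
  then have "good_trace (\<lambda>n. root (br n)) lk k (\<lambda>n. oc (Suc n)) (\<lambda>n. pf (Suc n))"
    using gt tr unfolding good_trace_def by (blast intro: le_SucI)
  then show "\<exists>k oc pf. good_trace (\<lambda>n. root (br n)) lk k oc pf" by blast
qed

section \<open>Realizing transition systems by co-proofs\<close>

text \<open>Finite derivations from the sequent of a state to the sequents of its successors. A leaf
  carries the successor and the links promised to it; a derivation that is just a leaf is a silent
  step.\<close>

datatype 'l deriv = Lf 'l | is_Nd: Nd (nd_seq: seqt) (nd_logic: bool) (nd_kids: "('l deriv \<times> link) list")

primrec dseq :: "('s \<Rightarrow> seqt) \<Rightarrow> ('s \<times> 'k) deriv \<Rightarrow> seqt" where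
  "dseq sq (Lf p) = sq (fst p)"
| "dseq sq (Nd S b ks) = S"

text \<open>At most one of the two steps may be principal: otherwise the composite would hide a formula of
  the supported thread.\<close>

definition lcomp :: "link \<Rightarrow> link \<Rightarrow> link" where
  "lcomp L l = {(a, c, r). \<exists>b p q. (a, b, p) \<in> L \<and> (b, c, q) \<in> l \<and> \<not> (p \<and> q) \<and> r = (p \<or> q)}"

lemma in_lcomp:
  "(a, c, r) \<in> lcomp L l \<longleftrightarrow>
    (\<exists>b p q. (a, b, p) \<in> L \<and> (b, c, q) \<in> l \<and> \<not> (p \<and> q) \<and> r = (p \<or> q))"
  by (simp add: lcomp_def)

text \<open>L is the composed link from the root of the derivation.\<close>

inductive valid_deriv :: "('s \<Rightarrow> seqt) \<Rightarrow> ('s \<Rightarrow> link \<Rightarrow> bool) \<Rightarrow> link \<Rightarrow> ('s \<times> link) deriv \<Rightarrow> bool"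
  for sq P where
  valid_deriv_Lf: "A \<subseteq> L \<Longrightarrow> P s A \<Longrightarrow> valid_deriv sq P L (Lf (s, A))"
| valid_deriv_Nd: "step b S (map (\<lambda>(d, l). (dseq sq d, l)) ks) \<Longrightarrow> length (snd S) \<le> 1 \<Longrightarrow>
    (\<And>d l. (d, l) \<in> set ks \<Longrightarrow> valid_deriv sq P (lcomp L l) d) \<Longrightarrow> valid_deriv sq P L (Nd S b ks)"

inductive_cases valid_deriv_LfE: "valid_deriv sq P L (Lf x)"

lemma valid_deriv_NdD:
  assumes "valid_deriv sq P L d" "is_Nd d"
  shows "step (nd_logic d) (dseq sq d) (map (\<lambda>(d, l). (dseq sq d, l)) (nd_kids d))"
    "length (snd (dseq sq d)) \<le> 1" "nd_seq d = dseq sq d"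
    "(d', l) \<in> set (nd_kids d) \<Longrightarrow> valid_deriv sq P (lcomp L l) d'"
  using assms by (auto elim: valid_deriv.cases)

definition adv :: "('s \<Rightarrow> ('s \<times> link) deriv) \<Rightarrow> ('s \<times> link) deriv \<Rightarrow> ('s \<times> link) deriv" where
  "adv D d = (case d of Lf p \<Rightarrow> D (fst p) | Nd S b ks \<Rightarrow> d)"

text \<open>Silent steps are skipped. If they never end, the value is unspecified; this cannot happen when
  all runs are good (\<open>silent_terminates\<close>).\<close>

definition norm :: "('s \<Rightarrow> ('s \<times> link) deriv) \<Rightarrow> ('s \<times> link) deriv \<Rightarrow> ('s \<times> link) deriv" where
  "norm D d = (adv D ^^ (LEAST n. is_Nd ((adv D ^^ n) d))) d"

primcorec tree :: "('s \<Rightarrow> ('s \<times> link) deriv) \<Rightarrow> ('s \<times> link) deriv \<Rightarrow> ptree" where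
  "root (tree D d) = nd_seq (norm D d)"
| "logic (tree D d) = nd_logic (norm D d)"
| "kids (tree D d) = map (map_prod (tree D) id) (nd_kids (norm D d))"

lemma norm_Nd: "is_Nd d \<Longrightarrow> norm D d = d"
  by (simp add: norm_def Least_eq_0)

lemma norm_adv:
  assumes "\<exists>n. is_Nd ((adv D ^^ n) (D s))"
  shows "norm D (Lf (s, A)) = norm D (D s)"
proof -
  have *: "(adv D ^^ Suc n) (Lf (s, A)) = (adv D ^^ n) (D s)" for n
    by (simp add: funpow_Suc_right adv_def del: funpow.simps)
  obtain n where "is_Nd ((adv D ^^ Suc n) (Lf (s, A)))" using assms * by metis
  then have "(LEAST n. is_Nd ((adv D ^^ n) (Lf (s, A)))) =
      Suc (LEAST n. is_Nd ((adv D ^^ Suc n) (Lf (s, A))))"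
    by (rule Least_Suc) simp
  then show ?thesis unfolding norm_def by (simp only: *)
qed

lemma tree_adv:
  assumes "\<exists>n. is_Nd ((adv D ^^ n) (D s))"
  shows "tree D (Lf (s, A)) = tree D (D s)"
  by (rule ptree.expand) (simp add: norm_adv[OF assms])

section \<open>The tree generated by derivations between states\<close>

locale realization =
  fixes sq :: "'s \<Rightarrow> seqt" and Inv :: "'s \<Rightarrow> bool" and tr :: "'s \<Rightarrow> 's \<Rightarrow> link \<Rightarrow> bool"
    and D :: "'s \<Rightarrow> ('s \<times> link) deriv"
  assumes D: "Inv s \<Longrightarrow> dseq sq (D s) = sq s \<and> valid_deriv sq (\<lambda>s' A. tr s s' A \<and> Inv s') stay (D s)"
    and run: "\<And>s A. (\<And>n. Inv (s n)) \<Longrightarrow> (\<And>n. tr (s n) (s (Suc n)) (A n)) \<Longrightarrow>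
      \<exists>k oc pf. good_trace (\<lambda>n. sq (s n)) A k oc pf"
begin

abbreviation valid_deriv' where "valid_deriv' s \<equiv> valid_deriv sq (\<lambda>s' A. tr s s' A \<and> Inv s')"

text \<open>The source state is forgotten: goodness passes to children and across leaves, while the
  state whose transitions are being realized changes at each leaf.\<close>

definition good where "good d \<longleftrightarrow> (\<exists>s L. valid_deriv' s L d)"

text \<open>An endless chain of leaves is a run whose links all lie in \<open>stay\<close> and so
  contain no principal step, whereas the trace supplied by \<open>run\<close> has infinitely
  many.\<close>

lemma silent_terminates:
  assumes "Inv s"
  shows "\<exists>n. is_Nd ((adv D ^^ n) (D s))"
proof (rule ccontr)
  assume "\<not> ?thesis"
  then have "\<not> is_Nd ((adv D ^^ n) (D s))" for n by blast
  then have *: "\<exists>p. (adv D ^^ n) (D s) = Lf p" for n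
    by (metis deriv.disc(2) deriv.exhaust)
  define p where "p n = (SOME p. (adv D ^^ n) (D s) = Lf p)" for n
  have p: "(adv D ^^ n) (D s) = Lf (p n)" for n
    unfolding p_def using * by (rule someI_ex)
  define t where "t n = case_nat s (\<lambda>n. fst (p n)) n" for n
  have Dt: "D (t n) = Lf (p n)" for n
  proof (cases n)
    case 0 then show ?thesis using p[of 0] by (simp add: t_def)
  next
    case (Suc m) then show ?thesis using p[of "Suc m"] p[of m] by (simp add: t_def adv_def)
  qed
  have leaf: "Inv (t n) \<Longrightarrow> snd (p n) \<subseteq> stay \<and> tr (t n) (t (Suc n)) (snd (p n)) \<and> Inv (t (Suc n))" for n
    using D[of "t n"] Dt[of n] by (auto simp: t_def elim!: valid_deriv_LfE)
  have Inv: "Inv (t n)" for n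
    by (induction n) (use assms leaf in \<open>auto simp: t_def\<close>)
  obtain k oc pf where gt: "good_trace (\<lambda>n. sq (t n)) (\<lambda>n. snd (p n)) k oc pf"
    using run[of t "\<lambda>n. snd (p n)"] Inv leaf by blast
  then have "\<exists>\<^sub>\<infinity>n. pf n" by (auto simp: good_trace_def win_def)
  then obtain n where "n \<ge> k" "pf n" by (auto simp: INFM_nat_le)
  moreover from this gt have "(oc n, oc (Suc n), pf n) \<in> snd (p n)"
    by (auto simp: good_trace_def trace_def)
  ultimately show False using leaf[OF Inv[of n]] by (auto simp: stay_def)
qed

lemma good_D: "Inv s \<Longrightarrow> good (D s)"
  using D by (auto simp: good_def)

lemma good_norm:
  assumes "good d"
  shows "is_Nd (norm D d)" "good (norm D d)" "nd_seq (norm D d) = dseq sq d"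
proof -
  have adv: "good (adv D d) \<and> dseq sq (adv D d) = dseq sq d" if "good d" for d
    using that D good_D by (cases d) (auto simp: good_def adv_def elim!: valid_deriv_LfE)
  have n: "good ((adv D ^^ n) d) \<and> dseq sq ((adv D ^^ n) d) = dseq sq d" for n
    by (induction n) (use assms adv in auto)
  have "\<exists>n. is_Nd ((adv D ^^ n) d)"
  proof (cases d)
    case (Lf p)
    then have "Inv (fst p)" using assms by (auto simp: good_def elim!: valid_deriv_LfE)
    from silent_terminates[OF this] obtain n where "is_Nd ((adv D ^^ n) (D (fst p)))" by blast
    then have "is_Nd ((adv D ^^ Suc n) d)"
      by (simp add: funpow_Suc_right adv_def Lf del: funpow.simps)
    then show ?thesis by blast
  qed (auto intro: exI[of _ 0])
  then show nd: "is_Nd (norm D d)" unfolding norm_def by (rule LeastI_ex)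
  show g: "good (norm D d)" using n unfolding norm_def by blast
  then obtain s L where "valid_deriv' s L (norm D d)" by (auto simp: good_def)
  then have "nd_seq (norm D d) = dseq sq (norm D d)" using nd by (rule valid_deriv_NdD(3))
  then show "nd_seq (norm D d) = dseq sq d" using n by (simp add: norm_def)
qed

lemma root_tree: "good d \<Longrightarrow> root (tree D d) = dseq sq d"
  by (simp add: good_norm)

lemma good_kid: "good d \<Longrightarrow> is_Nd d \<Longrightarrow> (d', l) \<in> set (nd_kids d) \<Longrightarrow> good d'"
  unfolding good_def using valid_deriv_NdD(4) by blast

lemma wfd_tree: "good d \<Longrightarrow> wfd (tree D d)"
proof (coinduction arbitrary: d rule: wfd.coinduct)
  case wfd
  let ?n = "norm D d"
  from good_norm[OF wfd] obtain s L where n: "is_Nd ?n" "valid_deriv' s L ?n" by (auto simp: good_def)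
  have k: "good d'" if "(d', l) \<in> set (nd_kids ?n)" for d' l
    using good_kid good_norm[OF wfd] that by blast
  have "step (nd_logic ?n) (nd_seq ?n) (map (\<lambda>(d, l). (dseq sq d, l)) (nd_kids ?n))"
    using valid_deriv_NdD[OF n(2,1)] by simp
  also have "map (\<lambda>(d, l). (dseq sq d, l)) (nd_kids ?n) =
      map (\<lambda>(u, l). (root u, l)) (map (map_prod (tree D) id) (nd_kids ?n))"
    using root_tree[OF k] by (auto simp: map_prod_def)
  finally show ?case
    using k by (intro exI conjI) (rule tree.code, assumption, auto)
qed

lemma constructive_tree:
  assumes "good d"
  shows "constructive (tree D d)"
  unfolding constructive_def
proof
  fix u assume "u \<in> subtrees (tree D d)"
  then have "\<exists>d'. good d' \<and> u = tree D d'"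
  proof induction
    case 1 show ?case using assms by blast
  next
    case (2 u p)
    then obtain d' where d': "good d'" "u = tree D d'" by blast
    with 2 obtain d'' l where "(d'', l) \<in> set (nd_kids (norm D d'))" "fst p = tree D d''" by auto
    then show ?case using good_kid good_norm d' by blast
  qed
  then obtain d' where d': "good d'" "u = tree D d'" by blast
  obtain s L where "valid_deriv' s L (norm D d')" using good_norm(2)[OF d'(1)] by (auto simp: good_def)
  from valid_deriv_NdD(2,3)[OF this good_norm(1)[OF d'(1)]]
  show "length (snd (root u)) \<le> 1" by (simp add: d'(2))
qed

end

section \<open>Winning traces along the branches of the generated tree\<close>

locale realization_branch = realization +
  fixes s0 br lk
  assumes s0: "Inv s0" and br: "branch (tree D (D s0)) br lk"
begin

text \<open>A branch of the tree is replayed with its silent steps. The components are the current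
  derivation, the link composed since the last leaf, the current state and the position in the
  branch.\<close>

fun nxt where
  "nxt (Lf p, L, s, n) = (D (fst p), stay, fst p, n)"
| "nxt (Nd S b ks, L, s, n) =
    (SOME d'. (d', lk n) \<in> set ks \<and> tree D d' = br (Suc n), lcomp L (lk n), s, Suc n)"

definition X where "X r = (nxt ^^ r) (D s0, stay, s0, 0)"
definition xd where "xd r = fst (X r)"
definition xL where "xL r = fst (snd (X r))"
definition xs where "xs r = fst (snd (snd (X r)))"
definition xn where "xn r = snd (snd (snd (X r)))"
definition mv where "mv r = is_Nd (xd r)"

lemma X_eq: "X r = (xd r, xL r, xs r, xn r)"
  by (simp add: xd_def xL_def xs_def xn_def)

lemma X_0: "xd 0 = D s0" "xL 0 = stay" "xs 0 = s0" "xn 0 = 0"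
  by (simp_all add: xd_def xL_def xs_def xn_def X_def)

lemma X_Suc_eq: "X (Suc r) = nxt (X r)"
  by (simp add: X_def)

lemma X_leaf:
  assumes "\<not> mv r"
  obtains p where "xd r = Lf p" "xd (Suc r) = D (fst p)" "xL (Suc r) = stay"
    "xs (Suc r) = fst p" "xn (Suc r) = xn r"
proof -
  from assms obtain p where p: "xd r = Lf p" by (cases "xd r") (auto simp: mv_def)
  with X_Suc_eq[of r] have "X (Suc r) = (D (fst p), stay, fst p, xn r)" by (simp add: X_eq[of r])
  then show ?thesis using p that by (simp add: X_eq[of "Suc r"])
qed

lemma X_node:
  assumes "mv r"
  shows "xd (Suc r) = (SOME d'. (d', lk (xn r)) \<in> set (nd_kids (xd r)) \<and> tree D d' = br (Suc (xn r)))"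
    "xL (Suc r) = lcomp (xL r) (lk (xn r))" "xs (Suc r) = xs r" "xn (Suc r) = Suc (xn r)"
proof -
  from assms obtain S b ks where p: "xd r = Nd S b ks" by (cases "xd r") (auto simp: mv_def)
  with X_Suc_eq[of r] have "X (Suc r) =
    (SOME d'. (d', lk (xn r)) \<in> set ks \<and> tree D d' = br (Suc (xn r)), lcomp (xL r) (lk (xn r)), xs r, Suc (xn r))"
    by (simp add: X_eq[of r])
  then show "xd (Suc r) = (SOME d'. (d', lk (xn r)) \<in> set (nd_kids (xd r)) \<and> tree D d' = br (Suc (xn r)))"
    "xL (Suc r) = lcomp (xL r) (lk (xn r))" "xs (Suc r) = xs r" "xn (Suc r) = Suc (xn r)"
    using p by (simp_all add: X_eq[of "Suc r"])
qed

text \<open>Different child derivations can generate the same tree, so the branch does not determine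
  the child; any child with the right link and the right tree will do.\<close>

lemma X_node_kid:
  assumes "mv r" "tree D (xd r) = br (xn r)"
  shows "(xd (Suc r), lk (xn r)) \<in> set (nd_kids (xd r)) \<and> tree D (xd (Suc r)) = br (Suc (xn r))"
proof -
  have "kids (br (xn r)) = map (map_prod (tree D) id) (nd_kids (xd r))"
    using assms(1) by (simp add: assms(2)[symmetric] norm_Nd mv_def)
  moreover have "(br (Suc (xn r)), lk (xn r)) \<in> set (kids (br (xn r)))"
    using br by (simp add: branch_def)
  ultimately have "\<exists>d'. (d', lk (xn r)) \<in> set (nd_kids (xd r)) \<and> tree D d' = br (Suc (xn r))"
    by auto
  then show ?thesis unfolding X_node(1)[OF assms(1)] by (rule someI_ex)
qed

lemma X_inv: "Inv (xs r) \<and> valid_deriv' (xs r) (xL r) (xd r) \<and> tree D (xd r) = br (xn r)"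
proof (induction r)
  case 0
  show ?case using s0 D br by (simp add: X_0 branch_def)
next
  case (Suc r)
  show ?case
  proof (cases "mv r")
    case True
    have "(xd (Suc r), lk (xn r)) \<in> set (nd_kids (xd r))" "tree D (xd (Suc r)) = br (Suc (xn r))"
      using X_node_kid[OF True] Suc by auto
    then show ?thesis
      using Suc valid_deriv_NdD(4)[of sq _ "xL r" "xd r"] True by (simp add: X_node mv_def)
  next
    case False
    then obtain p where p: "xd r = Lf p" "xd (Suc r) = D (fst p)" "xL (Suc r) = stay"
      "xs (Suc r) = fst p" "xn (Suc r) = xn r" by (rule X_leaf)
    then have "Inv (fst p)" using Suc by (auto elim!: valid_deriv_LfE)
    then show ?thesis
      using Suc p D tree_adv[OF silent_terminates, of "fst p" "snd p"] by auto
  qed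
qed

lemma xd_good: "good (xd r)"
  using X_inv unfolding good_def by blast

lemma root_br: "root (br (xn r)) = dseq sq (xd r)"
  using X_inv[of r] root_tree[OF xd_good[of r]] by simp

lemma br_link:
  assumes "(a, a', p) \<in> lk n"
  shows "fst a' = fst a" "\<not> p \<Longrightarrow> fmat (root (br (Suc n))) a' = fmat (root (br n)) a"
proof -
  have w: "wfd (br n)" using wfd_branch[OF wfd_tree[OF good_D[OF s0]] br] .
  have k: "(br (Suc n), lk n) \<in> set (kids (br n))" using br by (simp add: branch_def)
  show "fst a' = fst a" "\<not> p \<Longrightarrow> fmat (root (br (Suc n))) a' = fmat (root (br n)) a"
    using wfd_link(3,4)[OF w k assms] by auto
qed

lemma X_link:
  assumes "mv r" "(a, a', p) \<in> lk (xn r)" "\<not> p"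
  shows "fmat (dseq sq (xd (Suc r))) a' = fmat (dseq sq (xd r)) a"
  using br_link(2)[OF assms(2,3)] root_br[of r] root_br[of "Suc r"] assms(1) by (simp add: X_node)

text \<open>From any derivation of the replay, \<open>norm\<close> reaches a node after finitely
  many leaves.\<close>

lemma inf_mv: "\<exists>\<^sub>\<infinity>r. mv r"
  unfolding INFM_nat_le
proof (rule ccontr)
  assume "\<not> (\<forall>m. \<exists>n\<ge>m. mv n)"
  then obtain m where m: "\<And>n. n \<ge> m \<Longrightarrow> \<not> mv n" by auto
  have adv: "xd (m + n) = (adv D ^^ n) (xd m)" for n
  proof (induction n)
    case (Suc n)
    obtain p where "xd (m + n) = Lf p" "xd (Suc (m + n)) = D (fst p)"
      using X_leaf[OF m[of "m + n"]] by (metis le_add1)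
    then have "xd (Suc (m + n)) = adv D (xd (m + n))" by (simp add: adv_def)
    with Suc show ?case by simp
  qed simp
  have "is_Nd (norm D (xd m))" using good_norm xd_good by blast
  then show False using m adv by (metis le_add1 mv_def norm_def)
qed

lemma nd_kids_size: "(d', l) \<in> set (nd_kids d) \<Longrightarrow> is_Nd d \<Longrightarrow> size d' < size d"
proof (cases d)
  case (Nd S b ks)
  assume "(d', l) \<in> set (nd_kids d)"
  with Nd have "(d', l) \<in> set ks" by simp
  then have "size_prod size (\<lambda>_. 0) (d', l) \<le> size_list (size_prod size (\<lambda>_. 0)) ks"
    by (intro size_list_estimation'[OF _ order_refl])
  then show ?thesis using Nd by simp
qed simp

text \<open>Derivations are finite: each node step passes to a strictly smaller one.\<close>

lemma inf_leaf: "\<exists>\<^sub>\<infinity>r. \<not> mv r"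
  unfolding INFM_nat_le
proof (rule ccontr)
  assume "\<not> (\<forall>m. \<exists>n\<ge>m. \<not> mv n)"
  then obtain m where m: "\<And>n. n \<ge> m \<Longrightarrow> mv n" by auto
  have "size (xd (m + n)) + n \<le> size (xd m)" for n
  proof (induction n)
    case (Suc n)
    have mv: "mv (m + n)" using m by simp
    have "size (xd (Suc (m + n))) < size (xd (m + n))"
      using nd_kids_size X_node_kid[OF mv] X_inv[of "m + n"] mv unfolding mv_def by blast
    with Suc show ?case by simp
  qed simp
  from this[of "Suc (size (xd m))"] show False by simp
qed

text \<open>A concrete path \<open>q\<close> with flags \<open>g\<close> that realizes a composed
  link from \<open>u\<close> to \<open>v\<close> inside one macro step. As \<open>lcomp\<close>
  admits at most one principal step, the path shows no formula besides those at its two ends; this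
  keeps stray formulas from recurring.\<close>

definition seg where
  "seg a r u v b q g \<longleftrightarrow> q a = u \<and> q r = v \<and>
    (\<forall>i. a \<le> i \<longrightarrow> i < r \<longrightarrow> (q i, q (Suc i), g i) \<in> lk (xn i)) \<and>
    (\<forall>i. a \<le> i \<longrightarrow> i \<le> r \<longrightarrow> fmat (dseq sq (xd i)) (q i) \<in>
       {fmat (dseq sq (xd a)) u, fmat (dseq sq (xd r)) v}) \<and>
    (b \<longrightarrow> (\<exists>i. a \<le> i \<and> i < r \<and> g i)) \<and>
    (\<not> b \<longrightarrow> fmat (dseq sq (xd r)) v = fmat (dseq sq (xd a)) u)"

lemma segment:
  assumes "xL a = stay" "a \<le> r" "\<And>i. a \<le> i \<Longrightarrow> i < r \<Longrightarrow> mv i" "(u, v, b) \<in> xL r"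
  shows "\<exists>q g. seg a r u v b q g"
  using assms(2-4)
proof (induction r arbitrary: v b rule: dec_induct)
  case base
  then have "u = v" "\<not> b" using assms(1) by (auto simp: stay_def)
  then show ?case by (intro exI[of _ "\<lambda>_. u"]) (auto simp: seg_def)
next
  case (step r)
  have mv: "mv r" using step by auto
  have mv': "\<And>i. a \<le> i \<Longrightarrow> i < r \<Longrightarrow> mv i" using step(4) by simp
  obtain w c c' where c: "(u, w, c) \<in> xL r" "(w, v, c') \<in> lk (xn r)" "b = (c \<or> c')" "\<not> (c \<and> c')"
    using step(5) unfolding X_node[OF mv] in_lcomp by blast
  obtain q g where "seg a r u w c q g" using step(3)[OF mv' c(1)] by blast
  then have q: "q a = u" "q r = w"
    "\<And>i. a \<le> i \<Longrightarrow> i < r \<Longrightarrow> (q i, q (Suc i), g i) \<in> lk (xn i)"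
    "\<And>i. a \<le> i \<Longrightarrow> i \<le> r \<Longrightarrow> fmat (dseq sq (xd i)) (q i) \<in>
       {fmat (dseq sq (xd a)) u, fmat (dseq sq (xd r)) w}"
    "c \<Longrightarrow> \<exists>i. a \<le> i \<and> i < r \<and> g i"
    "\<not> c \<Longrightarrow> fmat (dseq sq (xd r)) w = fmat (dseq sq (xd a)) u"
    unfolding seg_def by blast+
  have f: "\<not> c' \<Longrightarrow> fmat (dseq sq (xd (Suc r))) v = fmat (dseq sq (xd r)) w"
    using X_link[OF mv c(2)] by simp
  define q' where "q' = q(Suc r := v)"
  define g' where "g' = g(r := c')"
  have "q' a = u" "q' (Suc r) = v" using q step(1) by (auto simp: q'_def)
  moreover have "(q' i, q' (Suc i), g' i) \<in> lk (xn i)" if "a \<le> i" "i < Suc r" for i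
    using q(2) q(3)[of i] c(2) that by (auto simp: q'_def g'_def less_Suc_eq)
  \<comment> \<open>If the new step is principal, no earlier one was, so all formulas up to
    \<open>r\<close> equal the one at the start; otherwise the formula at the end is
    unchanged.\<close>
  moreover have "fmat (dseq sq (xd i)) (q' i) \<in>
      {fmat (dseq sq (xd a)) u, fmat (dseq sq (xd (Suc r))) v}" if "a \<le> i" "i \<le> Suc r" for i
    using q(4)[of i] q(6) f c(4) that by (auto simp: q'_def le_Suc_eq)
  moreover have "\<exists>i. a \<le> i \<and> i < Suc r \<and> g' i" if b
  proof (cases c)
    case True
    then obtain i where "a \<le> i" "i < r" "g i" using q(5) by blast
    then show ?thesis by (intro exI[of _ i]) (auto simp: g'_def)
  next
    case False
    then show ?thesis using c(3) that step(1) by (intro exI[of _ r]) (auto simp: g'_def)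
  qed
  moreover have "\<not> b \<Longrightarrow> fmat (dseq sq (xd (Suc r))) v = fmat (dseq sq (xd a)) u"
    using c f q(6) by auto
  ultimately have "seg a (Suc r) u v b q' g'" unfolding seg_def by blast
  then show ?case by blast
qed

text \<open>Two clocks on the replay: \<open>N\<close> counts the edges of the branch,
  \<open>LF\<close> the completed macro steps.\<close>

sublocale N: moves mv by unfold_locales (rule inf_mv)
sublocale LF: moves "\<lambda>r. \<not> mv r" by unfold_locales (rule inf_leaf)

lemma xn_idx: "xn r = N.idx r"
proof (induction r)
  case (Suc r)
  then show ?case
    by (cases "mv r") (auto simp: N.idx_Suc X_node elim: X_leaf)
qed (simp add: X_0)

text \<open>Macro step \<open>m\<close> runs from \<open>st m\<close>, just after the leaf that
  ended the previous one, to the leaf at \<open>LF.mtime m\<close>.\<close>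

definition st where "st m = (case m of 0 \<Rightarrow> 0 | Suc m' \<Rightarrow> Suc (LF.mtime m'))"
definition leafl where "leafl m = (case xd (LF.mtime m) of Lf p \<Rightarrow> snd p)"

lemma st_stay: "xL (st m) = stay"
proof (cases m)
  case (Suc m')
  show ?thesis using X_leaf[OF LF.mv_mtime[of m']] Suc by (metis nat.case(2) st_def)
qed (simp add: st_def X_0)

lemma LF_idx_st: "LF.idx (st m) = m"
  by (cases m) (simp_all add: st_def LF.idx_Suc LF.mv_mtime LF.idx_mtime)

lemma le_st: "m \<le> st m"
  by (cases m) (auto simp: st_def intro: strict_mono_imp_increasing LF.mtime_strict)

lemma st_le: "st (LF.idx r) \<le> r"
proof (cases "LF.idx r")
  case (Suc m)
  have "LF.mtime m < r"
  proof (rule ccontr)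
    assume "\<not> LF.mtime m < r"
    then have "LF.idx r \<le> LF.idx (LF.mtime m)" by (intro monoD[OF LF.mono_idx]) simp
    then show False by (simp add: LF.idx_mtime Suc)
  qed
  then show ?thesis by (simp add: st_def Suc)
qed (simp add: st_def)

lemma st_mv: "st m \<le> i \<Longrightarrow> i < LF.mtime m \<Longrightarrow> mv i"
  using LF.no_move[of "st m" i] by (simp add: LF_idx_st)

lemma st_le_mtime: "st m \<le> LF.mtime m"
  using LF.le_mtime_idx[of "st m"] by (simp add: LF_idx_st)

lemma xs_mtime: "xs (LF.mtime m) = xs (st m)"
  using LF.const_mtime[of "st m" xs] X_node(3) by (simp add: LF_idx_st)

lemma leaf_mtime:
  "xd (LF.mtime m) = Lf (xs (st (Suc m)), leafl m)"
  using X_leaf[OF LF.mv_mtime[of m]] by (metis (no_types, lifting) deriv.case(1) leafl_def nat.case(2) prod.collapse st_def)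

lemma macro_step: "tr (xs (st m)) (xs (st (Suc m))) (leafl m)" "leafl m \<subseteq> xL (LF.mtime m)"
  using X_inv[of "LF.mtime m"] by (auto simp: leaf_mtime xs_mtime elim!: valid_deriv_LfE)

lemma dseq_st: "dseq sq (xd (st m)) = sq (xs (st m))"
proof (cases m)
  case 0
  show ?thesis using D s0 by (simp add: 0 st_def X_0)
next
  case (Suc m')
  have "xd (Suc (LF.mtime m')) = D (xs (Suc (LF.mtime m')))"
    using LF.mv_mtime[of m'] by (rule X_leaf) simp
  moreover have "Inv (xs (Suc (LF.mtime m')))" using X_inv by blast
  ultimately show ?thesis using D by (simp add: Suc st_def)
qed

text \<open>Each link of the winning trace of the run is replaced by its segment. The result is a
  winning trace of the replay that idles at leaves; sampling it at the nodes gives one of the branch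
  itself.\<close>

lemma branch_good: "\<exists>k oc pf. good_trace (\<lambda>n. root (br n)) lk k oc pf"
proof -
  let ?S = "\<lambda>r. dseq sq (xd r)"
  obtain k oc pf where gt: "good_trace (\<lambda>m. sq (xs (st m))) leafl k oc pf"
    using run[of "\<lambda>m. xs (st m)" leafl] macro_step(1) X_inv by blast
  let ?f = "\<lambda>m. fmat (sq (xs (st m))) (oc m)"
  define good_seg where
    "good_seg m = seg (st m) (LF.mtime m) (oc m) (oc (Suc m)) (pf m)" for m
  have S: "?S (st m) = sq (xs (st m))" "?S (LF.mtime m) = sq (xs (st (Suc m)))" for m
    by (simp_all add: dseq_st leaf_mtime)
  have "\<exists>q g. good_seg m q g" if "m \<ge> k" for m
  proof -
    have "(oc m, oc (Suc m), pf m) \<in> xL (LF.mtime m)"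
      using gt that macro_step(2) by (auto simp: good_trace_def trace_def)
    from segment[OF st_stay st_le_mtime st_mv this] show ?thesis
      unfolding good_seg_def .
  qed
  then obtain q g where qg: "\<And>m. m \<ge> k \<Longrightarrow> good_seg m (q m) (g m)" by metis
  note good_seg_def = good_seg_def seg_def S
  \<comment> \<open>\<open>LF.idx r\<close> is the macro step to which time \<open>r\<close>
    belongs, its closing leaf included.\<close>
  define oc' where "oc' r = q (LF.idx r) r" for r
  define pf' where "pf' r \<longleftrightarrow> mv r \<and> g (LF.idx r) r" for r
  let ?K = "LF.mtime k"
  have le: "k \<le> LF.idx r" if "?K \<le> r" for r
    using monoD[OF LF.mono_idx that] by (simp add: LF.idx_mtime)
  have tr: "(oc' r, oc' (Suc r), pf' r) \<in> (if mv r then lk (xn r) else stay)" if "?K \<le> r" for r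
  proof (cases "mv r")
    case True
    have "r \<noteq> LF.mtime (LF.idx r)" using LF.mv_mtime True by metis
    then have "r < LF.mtime (LF.idx r)" using LF.le_mtime_idx[of r] by simp
    then show ?thesis
      using qg[OF le[OF that]] True st_le[of r] by (simp add: good_seg_def oc'_def pf'_def LF.idx_Suc)
  next
    case False
    then have "r = LF.mtime (LF.idx r)" using LF.mtime_idx by metis
    then have "oc' r = oc (Suc (LF.idx r))"
      using qg[OF le[OF that]] by (simp add: oc'_def good_seg_def)
    moreover have "st (Suc (LF.idx r)) = Suc r" using \<open>r = _\<close> by (simp add: st_def)
    then have "oc' (Suc r) = oc (Suc (LF.idx r))"
      using qg[of "Suc (LF.idx r)"] le[OF that] False by (simp add: oc'_def LF.idx_Suc good_seg_def)
    ultimately show ?thesis using False by (simp add: pf'_def stay_def)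
  qed
  have fr: "fmat (?S r) (oc' r) \<in> {?f (LF.idx r), ?f (Suc (LF.idx r))}" if "?K \<le> r" for r
    using qg[OF le[OF that]] st_le[of r] LF.le_mtime_idx[of r] by (simp add: good_seg_def oc'_def)
  \<comment> \<open>Segments show only formulas of the run, and each formula of the run is shown at
    the start of its segment.\<close>
  have io: "inf_occ (\<lambda>r. fmat (?S r) (oc' r)) b \<longleftrightarrow> inf_occ ?f b" for b
  proof
    assume *: "inf_occ (\<lambda>r. fmat (?S r) (oc' r)) b"
    show "inf_occ ?f b" unfolding inf_occ_def INFM_nat_le
    proof
      fix N
      obtain r where r: "r \<ge> LF.mtime (max k N)" "fmat (?S r) (oc' r) = b"
        using *[unfolded inf_occ_def INFM_nat_le, rule_format, of "LF.mtime (max k N)"] by blast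
      then have "max k N \<le> LF.idx r"
        using monoD[OF LF.mono_idx r(1)] by (simp add: LF.idx_mtime)
      moreover have "?K \<le> r" using r(1) LF.mtime_strict
        by (meson max.cobounded1 order_trans strict_mono_less_eq)
      ultimately show "\<exists>n\<ge>N. ?f n = b" using fr[of r] r(2)
        by (metis insertE le_SucI max.bounded_iff singletonD)
    qed
  next
    assume *: "inf_occ ?f b"
    show "inf_occ (\<lambda>r. fmat (?S r) (oc' r)) b" unfolding inf_occ_def INFM_nat_le
    proof
      fix N
      obtain m where m: "m \<ge> max k N" "?f m = b"
        using *[unfolded inf_occ_def INFM_nat_le, rule_format, of "max k N"] by blast
      then have "oc' (st m) = oc m" using qg[of m] by (simp add: oc'_def LF_idx_st good_seg_def)
      then have "fmat (?S (st m)) (oc' (st m)) = b" using m by (simp add: dseq_st)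
      moreover have "N \<le> st m" using m le_st[of m] by simp
      ultimately show "\<exists>n\<ge>N. fmat (?S n) (oc' n) = b" by blast
    qed
  qed
  have infpf: "\<exists>\<^sub>\<infinity>r. pf' r" if *: "\<exists>\<^sub>\<infinity>m. pf m"
    unfolding INFM_nat_le
  proof
    fix N
    obtain m where m: "m \<ge> max k N" "pf m" using *[unfolded INFM_nat_le, rule_format, of "max k N"] by blast
    then obtain i where i: "st m \<le> i" "i < LF.mtime m" "g m i"
      using qg[of m] by (auto simp: good_seg_def)
    have "LF.idx i = m"
      using monoD[OF LF.mono_idx i(1)] monoD[OF LF.mono_idx, of i "LF.mtime m"] i(2)
      by (simp add: LF_idx_st LF.idx_mtime)
    then have "pf' i" using i st_mv by (auto simp: pf'_def)
    moreover have "N \<le> i" using m le_st[of m] i(1) by simp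
    ultimately show "\<exists>n\<ge>N. pf' n" by blast
  qed
  have wn: "win C (\<lambda>r. fmat (?S r) (oc' r)) pf'" if "win C ?f pf" for C
    using win_cong_inf_occ[OF _ _ that] io infpf that by (simp add: win_def)
  have sd: "\<forall>n\<ge>?K. fst (oc' n) = X" if X: "\<forall>n\<ge>k. fst (oc n) = X" for X
  proof -
    have 0: "oc' (st k) = oc k" "oc' (st (Suc k)) = oc (Suc k)"
      using qg[of k] qg[of "Suc k"] by (simp_all add: oc'_def LF_idx_st good_seg_def)
    have "fst (oc' r) = X" if "st (Suc k) \<le> r" for r
      using that
    proof (induction r rule: dec_induct)
      case base show ?case using 0 X by simp
    next
      case (step r)
      have "?K \<le> r" using step(1) by (simp add: st_def)
      from tr[OF this] have "fst (oc' (Suc r)) = fst (oc' r)"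
        using br_link(1)[of "oc' r" "oc' (Suc r)" "pf' r" "xn r"]
        by (auto simp: stay_def split: if_splits)
      then show ?case using step by simp
    qed
    moreover have "fst (oc' ?K) = X"
      using qg[of k] X by (simp add: oc'_def good_seg_def LF.idx_mtime)
    \<comment> \<open>\<open>?K\<close> is the leaf that closes macro step \<open>k\<close>, so
      macro step \<open>Suc k\<close> starts at \<open>Suc ?K\<close>.\<close>
    moreover have "n = ?K \<or> st (Suc k) \<le> n" if "?K \<le> n" for n
      using that by (auto simp: st_def)
    ultimately show ?thesis by blast
  qed
  have "good_trace ?S (\<lambda>r. if mv r then lk (xn r) else stay) ?K oc' pf'"
    using gt tr wn sd unfolding good_trace_def trace_def by blast
  moreover have "fmat (?S (Suc n)) (oc' (Suc n)) = fmat (?S n) (oc' n)"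
    if "?K \<le> n" "\<not> pf' n" for n
  proof (cases "mv n")
    case True then show ?thesis using tr[OF that(1)] X_link[of n] that(2) by auto
  next
    case False
    then obtain p where "xd n = Lf p" "xd (Suc n) = D (fst p)" by (rule X_leaf)
    then show ?thesis
      using tr[OF that(1)] False X_inv[of n] D by (auto simp: stay_def elim!: valid_deriv_LfE)
  qed
  ultimately obtain k' oc'' pf'' where
    gt': "good_trace (\<lambda>j. ?S (N.mtime j)) (\<lambda>j. lk (xn (N.mtime j))) k' oc'' pf''"
    using good_trace_sample[OF inf_mv, of ?S "\<lambda>r. lk (xn r)" ?K oc' pf'] by blast
  have "xn (N.mtime j) = j" for j by (simp add: xn_idx N.idx_mtime)
  then show ?thesis using gt' by (auto simp: root_br[symmetric])
qed

end

lemma (in realization) realized: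
  assumes "Inv s0"
  shows "coproof (tree D (D s0)) \<and> constructive (tree D (D s0)) \<and> root (tree D (D s0)) = sq s0"
proof -
  have g: "good (D s0)" using assms by (rule good_D)
  have "\<exists>k oc pf. good_trace (\<lambda>n. root (br n)) lk k oc pf"
    if "branch (tree D (D s0)) br lk" for br lk
  proof -
    interpret realization_branch sq Inv tr D s0 br lk
      by unfold_locales (use assms that in auto)
    show ?thesis by (rule branch_good)
  qed
  then show ?thesis
    using wfd_tree[OF g] constructive_tree[OF g] root_tree[OF g] D[OF assms]
    unfolding coproof_iff by simp
qed

text \<open>No coherence between the derivations of different states is required, so one can be
  chosen for each state separately.\<close>

theorem realize:
  fixes sq :: "'s \<Rightarrow> seqt" and tr :: "'s \<Rightarrow> 's \<Rightarrow> link \<Rightarrow> bool"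
  assumes der: "\<And>s. Inv s \<Longrightarrow> \<exists>d. dseq sq d = sq s \<and> valid_deriv sq (\<lambda>s' A. tr s s' A \<and> Inv s') stay d"
    and run: "\<And>s A. (\<And>n. Inv (s n)) \<Longrightarrow> (\<And>n. tr (s n) (s (Suc n)) (A n)) \<Longrightarrow>
      \<exists>k oc pf. good_trace (\<lambda>n. sq (s n)) A k oc pf"
    and "Inv s0"
  shows "\<exists>T. coproof T \<and> constructive T \<and> root T = sq s0"
proof -
  define D where "D s = (SOME d. dseq sq d = sq s \<and> valid_deriv sq (\<lambda>s' A. tr s s' A \<and> Inv s') stay d)" for s
  have "dseq sq (D s) = sq s \<and> valid_deriv sq (\<lambda>s' A. tr s s' A \<and> Inv s') stay (D s)" if "Inv s" for s
    unfolding D_def using der[OF that] by (rule someI_ex)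
  then interpret realization sq Inv tr D
    by unfold_locales (use run in blast)+
  show ?thesis using realized[OF \<open>Inv s0\<close>] by blast
qed

section \<open>Structural macro steps\<close>

lemma lcompI:
  "(a, b, p) \<in> L \<Longrightarrow> (b, c, q) \<in> l \<Longrightarrow> \<not> (p \<and> q) \<Longrightarrow> r = (p \<or> q) \<Longrightarrow> (a, c, r) \<in> lcomp L l"
  unfolding in_lcomp by metis

lemma in_stay: "(a, b, p) \<in> stay \<longleftrightarrow> a = b \<and> \<not> p"
  unfolding stay_def by blast

lemma lcomp_stay [simp]: "lcomp stay l = l"
proof -
  have "(a, c, r) \<in> lcomp stay l \<longleftrightarrow> (a, c, r) \<in> l" for a c r
    by (cases r) (simp_all add: in_lcomp in_stay ex_bool_eq)
  then show ?thesis by (simp add: set_eq_iff split_paired_All)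
qed

lemma lcomp_mono: "L \<subseteq> L' \<Longrightarrow> lcomp L l \<subseteq> lcomp L' l"
  unfolding lcomp_def by blast

lemma valid_deriv_mono: "valid_deriv sq P L d \<Longrightarrow> L \<subseteq> L' \<Longrightarrow> valid_deriv sq P L' d"
proof (induction arbitrary: L' rule: valid_deriv.induct)
  case (valid_deriv_Nd b S ks L)
  show ?case
    by (rule valid_deriv.valid_deriv_Nd[OF valid_deriv_Nd(1,2)]) (use valid_deriv_Nd(4) lcomp_mono[OF valid_deriv_Nd(5)] in blast)
qed (auto intro: valid_deriv.valid_deriv_Lf)

definition derivable :: "('s \<Rightarrow> seqt) \<Rightarrow> ('s \<Rightarrow> link \<Rightarrow> bool) \<Rightarrow> link \<Rightarrow> seqt \<Rightarrow> bool" where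
  "derivable sq P L S \<longleftrightarrow> (\<exists>d. dseq sq d = S \<and> valid_deriv sq P L d)"

lemma derivable_mono: "derivable sq P L S \<Longrightarrow> L \<subseteq> L' \<Longrightarrow> derivable sq P L' S"
  unfolding derivable_def using valid_deriv_mono by blast

lemma derivable_leaf: "P s A \<Longrightarrow> A \<subseteq> L \<Longrightarrow> derivable sq P L (sq s)"
  unfolding derivable_def by (intro exI[of _ "Lf (s, A)"]) (auto intro: valid_deriv.valid_deriv_Lf)

lemma derivable_step:
  assumes "step b S Ps" "length (snd S) \<le> 1"
    and "\<And>S' l. (S', l) \<in> set Ps \<Longrightarrow> derivable sq P (lcomp L l) S'"
  shows "derivable sq P L S"
proof -
  define dd where "dd = (\<lambda>(S', l). SOME d. dseq sq d = S' \<and> valid_deriv sq P (lcomp L l) d)"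
  have dd: "dseq sq (dd (S', l)) = S' \<and> valid_deriv sq P (lcomp L l) (dd (S', l))" if "(S', l) \<in> set Ps" for S' l
    unfolding dd_def using assms(3)[OF that] unfolding derivable_def prod.case by (rule someI_ex)
  define ks where "ks = map (\<lambda>(S', l). (dd (S', l), l)) Ps"
  have "map (\<lambda>(d, l). (dseq sq d, l)) ks = Ps"
    unfolding ks_def map_map by (rule map_idI) (use dd in force)
  then have "valid_deriv sq P L (Nd S b ks)"
    using assms(1,2) by (intro valid_deriv.valid_deriv_Nd) (auto simp: ks_def dd)
  then show ?thesis unfolding derivable_def by (intro exI[of _ "Nd S b ks"]) auto
qed

text \<open>f maps each position of the premise to the position in the conclusion of which it is a copy.\<close>

inductive restructure :: "fm list \<Rightarrow> (nat \<Rightarrow> nat) \<Rightarrow> fm list \<Rightarrow> bool" where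
  restructure_id: "(\<And>i. i < length \<Phi> \<Longrightarrow> f i = i) \<Longrightarrow> restructure \<Phi> f \<Phi>"
| restructure_ex: "restructure (\<Phi>1 @ b # a # \<Phi>2) g \<Phi>' \<Longrightarrow> (\<And>i. i < length \<Phi>' \<Longrightarrow> f i = swp (length \<Phi>1) (g i)) \<Longrightarrow>
    restructure (\<Phi>1 @ a # b # \<Phi>2) f \<Phi>'"
| restructure_ct: "restructure (a # a # \<Phi>) g \<Phi>' \<Longrightarrow> (\<And>i. i < length \<Phi>' \<Longrightarrow> f i = g i - 1) \<Longrightarrow> restructure (a # \<Phi>) f \<Phi>'"
| restructure_wk: "restructure \<Phi> g \<Phi>' \<Longrightarrow> (\<And>i. i < length \<Phi>' \<Longrightarrow> f i = Suc (g i)) \<Longrightarrow> restructure (a # \<Phi>) f \<Phi>'"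

lemma restructure_bound: "restructure \<Phi> f \<Phi>' \<Longrightarrow> i < length \<Phi>' \<Longrightarrow> f i < length \<Phi>"
  by (induction rule: restructure.induct) (auto simp: swp_def split: if_splits)

lemma restructure_trans: "restructure \<Phi> f \<Phi>' \<Longrightarrow> restructure \<Phi>' g \<Phi>'' \<Longrightarrow> (\<And>i. i < length \<Phi>'' \<Longrightarrow> h i = f (g i)) \<Longrightarrow> restructure \<Phi> h \<Phi>''"
proof (induction arbitrary: h rule: restructure.induct)
  case (restructure_id \<Phi> f)
  from restructure_id(2) show ?case
  proof (cases rule: restructure.cases)
    case restructure_id
    then show ?thesis using restructure_id.prems \<open>\<And>i. i < length \<Phi> \<Longrightarrow> f i = i\<close> by (auto intro!: restructure.restructure_id)
  next
    case (restructure_ex \<Phi>1 b a \<Phi>2 g')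
    then show ?thesis
      using restructure_id restructure_bound[OF restructure_id(2)] by (auto intro!: restructure.restructure_ex[of _ _ _ _ g'])
  next
    case (restructure_ct a \<Phi>0 g')
    then show ?thesis
      using restructure_id restructure_bound[OF restructure_id(2)] by (auto intro!: restructure.restructure_ct[of _ _ g'])
  next
    case (restructure_wk \<Phi>0 g' a)
    then show ?thesis
      using restructure_id restructure_bound[OF restructure_id(2)] by (auto intro!: restructure.restructure_wk[of _ g'])
  qed
next
  case (restructure_ex \<Phi>1 b a \<Phi>2 f' \<Phi>' f)
  show ?case
    by (rule restructure.restructure_ex[OF restructure_ex(3)[OF restructure_ex(4) refl]])
      (use restructure_ex(2,5) restructure_bound[OF restructure_ex(4)] in auto)
next
  case (restructure_ct a \<Phi> f' \<Phi>' f)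
  show ?case
    by (rule restructure.restructure_ct[OF restructure_ct(3)[OF restructure_ct(4) refl]])
      (use restructure_ct(2,5) restructure_bound[OF restructure_ct(4)] in auto)
next
  case (restructure_wk \<Phi> f' \<Phi>' f)
  show ?case
    by (rule restructure.restructure_wk[OF restructure_wk(3)[OF restructure_wk(4) refl]])
      (use restructure_wk(2,5) restructure_bound[OF restructure_wk(4)] in auto)
qed

lemma restructure_front:
  "restructure (A @ x # B) (\<lambda>i. if i = 0 then length A else if i \<le> length A then i - 1 else i) (x # A @ B)"
proof (induction A arbitrary: B rule: rev_induct)
  case (snoc y A)
  have "restructure (A @ y # x # B) (\<lambda>i. if i = 0 then length (A @ [y]) else if i \<le> length (A @ [y]) then i - 1 else i)
      (x # A @ y # B)"
    by (rule restructure_ex[OF snoc[of "y # B"]]) (auto simp: swp_def)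
  then show ?case by simp
qed (auto intro: restructure_id)

lemma restructure_back:
  "restructure (C @ x # A @ B) (\<lambda>i. if i < length C then i else if i < length C + length A then Suc i
     else if i = length C + length A then length C else i) (C @ A @ x # B)"
proof (induction A arbitrary: C)
  case (Cons y A)
  have "restructure (C @ x # y # A @ B) (\<lambda>i. if i < length C then i else if i < length C + length (y # A) then Suc i
     else if i = length C + length (y # A) then length C else i) (C @ y # A @ x # B)"
    by (rule restructure_ex[OF Cons[of "C @ [y]", simplified]]) (auto simp: swp_def)
  then show ?case by simp
qed (auto intro: restructure_id)

text \<open>The formula moves to the front, a contraction (read upwards) doubles it there, and one
  of the two copies travels back to the old place.\<close>

lemma restructure_copy:
  assumes "p < length \<Phi>"
  shows "restructure \<Phi> (\<lambda>i. if i = 0 then p else i - 1) (\<Phi> ! p # \<Phi>)"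
proof -
  define A B x where "A = take p \<Phi>" and "B = drop (Suc p) \<Phi>" and "x = \<Phi> ! p"
  have \<Phi>: "\<Phi> = A @ x # B" and p: "length A = p"
    using assms by (auto simp: A_def B_def x_def id_take_nth_drop[symmetric])
  have "restructure (x # A @ B) (\<lambda>i. (if i < 1 then i else if i < 1 + length A then Suc i
      else if i = 1 + length A then 1 else i) - 1) (x # A @ x # B)"
    by (rule restructure_ct[OF restructure_back[of "[x]" x A B, simplified]]) auto
  then have "restructure (A @ x # B) (\<lambda>i. if i = 0 then p else i - 1) (x # A @ x # B)"
    by (rule restructure_trans[OF restructure_front[of A x B]]) (simp add: p; linarith)
  moreover have "(A @ x # B) ! p = x" using p by (simp add: nth_append)
  ultimately show ?thesis by (simp add: \<Phi>)
qed

lemma restructure_extend: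
  assumes "\<And>i. i < length \<Phi>' \<Longrightarrow> f i < length \<Phi> \<and> \<Phi>' ! i = \<Phi> ! f i"
  shows "restructure \<Phi> (\<lambda>i. if i < length \<Phi>' then f i else i - length \<Phi>') (\<Phi>' @ \<Phi>)"
  using assms
proof (induction \<Phi>' arbitrary: f)
  case (Cons x \<Phi>')
  have IH: "restructure \<Phi> (\<lambda>i. if i < length \<Phi>' then f (Suc i) else i - length \<Phi>') (\<Phi>' @ \<Phi>)"
    using Cons(2)[of "Suc i" for i] by (intro Cons(1)) auto
  have 0: "f 0 < length \<Phi>" "x = \<Phi> ! f 0" using Cons(2)[of 0] by auto
  have "restructure (\<Phi>' @ \<Phi>) (\<lambda>i. if i = 0 then length \<Phi>' + f 0 else i - 1) (x # \<Phi>' @ \<Phi>)"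
    using restructure_copy[of "length \<Phi>' + f 0" "\<Phi>' @ \<Phi>"] 0 by simp
  then have "restructure \<Phi> (\<lambda>i. if i < length (x # \<Phi>') then f i else i - length (x # \<Phi>')) (x # \<Phi>' @ \<Phi>)"
    by (rule restructure_trans[OF IH]) auto
  then show ?case by simp
qed (auto intro: restructure_id)

lemma restructure_drop: "restructure (\<Phi>' @ \<Phi>) id \<Phi>'"
proof (induction \<Phi>)
  case (Cons x \<Phi>)
  show ?case
    by (rule restructure_trans[OF restructure_front[of \<Phi>' x \<Phi>] restructure_wk[OF Cons, of Suc]]) auto
qed (auto intro: restructure_id)

text \<open>Copies of all wanted formulas are put in front of the context, and then the old context
  is weakened away. This handles repetitions, omissions and permutations uniformly.\<close>

lemma restructure_all:
  assumes "\<And>i. i < length \<Phi>' \<Longrightarrow> f i < length \<Phi> \<and> \<Phi>' ! i = \<Phi> ! f i"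
  shows "restructure \<Phi> f \<Phi>'"
  by (rule restructure_trans[OF restructure_extend[OF assms] restructure_drop]) auto

definition cpf :: "(nat \<Rightarrow> nat) \<Rightarrow> fm list \<Rightarrow> fm list \<Rightarrow> link" where
  "cpf f \<Phi> \<Delta> = cp Lft f (length \<Phi>) \<union> cp Rgt id (length \<Delta>)"

lemma cpf_comp:
  assumes "\<And>i. i < length \<Phi>' \<Longrightarrow> g i < length \<Phi>0 \<and> f i = f0 (g i)"
  shows "lcomp L (cpf f \<Phi>' \<Delta>) \<subseteq> lcomp (lcomp L (cpf f0 \<Phi>0 \<Delta>)) (cpf g \<Phi>' \<Delta>)"
proof
  fix t assume "t \<in> lcomp L (cpf f \<Phi>' \<Delta>)"
  moreover obtain a c r where "t = (a, c, r)" by (cases t) auto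
  ultimately consider a i p where "t = (a, (Lft, i), p)" "i < length \<Phi>'" "(a, (Lft, f i), p) \<in> L"
    | a i p where "t = (a, (Rgt, i), p)" "i < length \<Delta>" "(a, (Rgt, i), p) \<in> L"
    by (auto simp: in_lcomp cpf_def cp_def)
  then show "t \<in> lcomp (lcomp L (cpf f0 \<Phi>0 \<Delta>)) (cpf g \<Phi>' \<Delta>)"
  proof cases
    case 1
    then have "((Lft, f i), (Lft, g i), False) \<in> cpf f0 \<Phi>0 \<Delta>"
      "((Lft, g i), (Lft, i), False) \<in> cpf g \<Phi>' \<Delta>"
      using assms by (auto simp: cpf_def cp_def)
    then show ?thesis using 1 by (auto intro!: lcompI)
  next
    case 2
    then have "((Rgt, i), (Rgt, i), False) \<in> cpf f0 \<Phi>0 \<Delta>"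
      "((Rgt, i), (Rgt, i), False) \<in> cpf g \<Phi>' \<Delta>"
      using assms by (auto simp: cpf_def cp_def)
    then show ?thesis using 2 by (auto intro!: lcompI)
  qed
qed

lemma lcomp_id: "(\<And>i. i < length \<Phi> \<Longrightarrow> f i = i) \<Longrightarrow> lcomp L (cpf f \<Phi> \<Delta>) \<subseteq> L"
  by (auto simp: in_lcomp cpf_def cp_def)

lemma derivable_strc:
  assumes "restructure \<Phi> f \<Phi>'" "length \<Delta> \<le> 1" "derivable sq P (lcomp L (cpf f \<Phi>' \<Delta>)) (\<Phi>', \<Delta>)"
  shows "derivable sq P L (\<Phi>, \<Delta>)"
  using assms
proof (induction arbitrary: L rule: restructure.induct)
  case (restructure_id \<Phi> f)
  then show ?case using derivable_mono[OF _ lcomp_id] by blast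
next
  case (restructure_ex \<Phi>1 b a \<Phi>2 g \<Phi>' f)
  have "derivable sq P (lcomp L (cpf (swp (length \<Phi>1)) (\<Phi>1 @ b # a # \<Phi>2) \<Delta>)) (\<Phi>1 @ b # a # \<Phi>2, \<Delta>)"
    by (rule restructure_ex(3)[OF restructure_ex(4) derivable_mono[OF restructure_ex(5) cpf_comp]])
      (use restructure_ex(2) restructure_bound[OF restructure_ex(1)] in auto)
  then show ?case
    using restructure_ex(4) by (intro derivable_step[OF step.exL]) (auto simp: cpf_def)
next
  case (restructure_ct a \<Phi> g \<Phi>' f)
  have "derivable sq P (lcomp L (cpf (\<lambda>i. i - 1) (a # a # \<Phi>) \<Delta>)) (a # a # \<Phi>, \<Delta>)"
    by (rule restructure_ct(3)[OF restructure_ct(4) derivable_mono[OF restructure_ct(5) cpf_comp]])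
      (use restructure_ct(2) restructure_bound[OF restructure_ct(1)] in auto)
  then show ?case
    using restructure_ct(4) by (intro derivable_step[OF step.ctL]) (auto simp: cpf_def)
next
  case (restructure_wk \<Phi> g \<Phi>' f a)
  have "derivable sq P (lcomp L (cpf Suc \<Phi> \<Delta>)) (\<Phi>, \<Delta>)"
    by (rule restructure_wk(3)[OF restructure_wk(4) derivable_mono[OF restructure_wk(5) cpf_comp]])
      (use restructure_wk(2) restructure_bound[OF restructure_wk(1)] in auto)
  then show ?case
    using restructure_wk(4) by (intro derivable_step[OF step.wkL]) (auto simp: cpf_def)
qed

lemma derivable_str:
  assumes "\<And>i. i < length \<Phi>' \<Longrightarrow> f i < length \<Phi> \<and> \<Phi>' ! i = \<Phi> ! f i" "length \<Delta> \<le> 1"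
    and "derivable sq P (lcomp L (cpf f \<Phi>' \<Delta>)) (\<Phi>', \<Delta>)"
  shows "derivable sq P L (\<Phi>, \<Delta>)"
  using derivable_strc[OF restructure_all] assms by blast

lemma derivable_wkR: "derivable sq P (lcomp L (cp Lft id (length \<Phi>))) (\<Phi>, []) \<Longrightarrow> derivable sq P L (\<Phi>, [a])"
  by (rule derivable_step[OF step.wkR[of \<Phi> "[]" a, unfolded append_Nil]]) (auto simp: cp_def)

text \<open>Used when an attached proof takes over: the empty link promises no trace, so a right
  weakening may be inserted and \<open>L\<close> is arbitrary.\<close>

lemma derivable_restart:
  assumes "\<And>i. i < length \<Phi>' \<Longrightarrow> f i < length \<Phi> \<and> \<Phi>' ! i = \<Phi> ! f i" "length \<Delta> \<le> 1"
    and "\<Delta>' = \<Delta> \<or> \<Delta>' = []" "derivable sq P {} (\<Phi>', \<Delta>')"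
  shows "derivable sq P L (\<Phi>, \<Delta>)"
proof -
  have "derivable sq P L' (\<Phi>', \<Delta>)" for L'
  proof (cases "\<Delta>' = \<Delta>")
    case False
    then obtain a where "\<Delta> = [a]" "\<Delta>' = []" using assms(2,3) by (cases \<Delta>) auto
    then show ?thesis using assms(4) derivable_mono by (intro derivable_wkR[of sq P L' \<Phi>' a, folded \<open>\<Delta> = [a]\<close>]) blast
  qed (use assms(4) derivable_mono in blast)
  then show ?thesis using derivable_str assms(1,2) by blast
qed

section \<open>Logical rules and axioms at arbitrary positions\<close>

definition lrule :: "fm \<Rightarrow> fm list \<Rightarrow> bool" where
  "lrule C gs \<longleftrightarrow> (\<exists>G g. C = Conj G \<and> g |\<in>| G \<and> gs = [g]) \<or> (\<exists>G. C = Disj G \<and> set gs = fset G) \<or>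
     (\<exists>a. (C = Mu a \<or> C = Nu a) \<and> gs = [app a C])"

text \<open>Here and in \<open>lrule\<close>, \<open>gs\<close> lists the minor formulas, one for
  each premise. Modal rules are kept apart because they act on all formulas of the sequent at
  once.\<close>

definition rrule :: "fm \<Rightarrow> fm list \<Rightarrow> bool" where
  "rrule C gs \<longleftrightarrow> (\<exists>G g. C = Disj G \<and> g |\<in>| G \<and> gs = [g]) \<or> (\<exists>G. C = Conj G \<and> set gs = fset G) \<or>
     (\<exists>a. (C = Mu a \<or> C = Nu a) \<and> gs = [app a C])"

text \<open>The principal reduction of a cut. For \<open>Conj\<close> the left rule chooses a
  conjunct and the right rule supplies all of them, for \<open>Disj\<close> the roles are exchanged,
  and a fixpoint has the same unfolding on both sides.\<close>

lemma lrule_rrule: "lrule C gs \<Longrightarrow> rrule C hs \<Longrightarrow> \<exists>g. g \<in> set gs \<and> g \<in> set hs"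
  by (auto simp: lrule_def rrule_def)

lemma lrule_step: "lrule C gs \<Longrightarrow> step True (C # \<Phi>, \<Psi>) (map (\<lambda>g. ((g # \<Phi>, \<Psi>), lkL \<Phi> \<Psi>)) gs)"
  unfolding lrule_def by (auto intro: step.intros)

lemma rrule_step: "rrule C gs \<Longrightarrow> step True (\<Phi>, [C]) (map (\<lambda>g. ((\<Phi>, [g]), lkR \<Phi> [])) gs)"
  unfolding rrule_def
  using conjR[of gs _ \<Phi> "[]"] disjR[of _ _ \<Phi> "[]"] muR[of \<Phi> "[]"] nuR[of \<Phi> "[]"] by auto

text \<open>The rule itself acts only at the front. A copy of \<open>C\<close> is put there by
  contraction, the rule is applied to the copy, and the minor formula replaces the old
  \<open>C\<close>, which is weakened away. The composed link at \<open>p\<close> contains exactly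
  one principal step, as \<open>lcomp\<close> demands.\<close>

lemma derivable_left:
  assumes "lrule C gs" "p < length \<Phi>" "\<Phi> ! p = C" "length \<Delta> \<le> 1"
    and "\<And>g. g \<in> set gs \<Longrightarrow> derivable sq P ({((Lft, i), (Lft, i), i = p) | i. i < length \<Phi>} \<union> cp Rgt id (length \<Delta>))
           (\<Phi>[p := g], \<Delta>)"
  shows "derivable sq P stay (\<Phi>, \<Delta>)"
proof (rule derivable_str[where \<Phi>' = "C # \<Phi>" and f = "\<lambda>i. if i = 0 then p else i - 1"])
  let ?l = "cpf (\<lambda>i. if i = 0 then p else i - 1) (C # \<Phi>) \<Delta>"
  show "derivable sq P (lcomp stay ?l) (C # \<Phi>, \<Delta>)"
  proof (rule derivable_step[OF lrule_step[OF assms(1)]])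
    fix S' l assume "(S', l) \<in> set (map (\<lambda>g. ((g # \<Phi>, \<Delta>), lkL \<Phi> \<Delta>)) gs)"
    then obtain g where g: "g \<in> set gs" "S' = (g # \<Phi>, \<Delta>)" "l = lkL \<Phi> \<Delta>" by auto
    have "((Lft, i), (Lft, i), i = p) \<in> lcomp (lcomp ?l l) (cpf (\<lambda>i. if i = p then 0 else Suc i) (\<Phi>[p := g]) \<Delta>)"
      if "i < length \<Phi>" for i
      by (rule lcompI[where b = "(Lft, if i = p then 0 else Suc i)" and p = "i = p" and q = False],
          rule lcompI[where b = "(Lft, if i = p then 0 else Suc i)" and p = False and q = "i = p"])
        (use that in \<open>auto simp: g cpf_def cp_def lkL_def idl_def\<close>)
    moreover have "((Rgt, i), (Rgt, i), False) \<in> lcomp (lcomp ?l l) (cpf (\<lambda>i. if i = p then 0 else Suc i) (\<Phi>[p := g]) \<Delta>)"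
      if "i < length \<Delta>" for i
      by (rule lcompI[where b = "(Rgt, i)" and p = False and q = False],
          rule lcompI[where b = "(Rgt, i)" and p = False and q = False])
        (use that in \<open>auto simp: g cpf_def cp_def lkL_def idl_def\<close>)
    ultimately have "derivable sq P (lcomp (lcomp ?l l) (cpf (\<lambda>i. if i = p then 0 else Suc i) (\<Phi>[p := g]) \<Delta>)) (\<Phi>[p := g], \<Delta>)"
      by (intro derivable_mono[OF assms(5)[OF g(1)]]) (auto simp: cp_def)
    then have "derivable sq P (lcomp ?l l) (g # \<Phi>, \<Delta>)"
      by (rule derivable_str[rotated 2]) (use assms in \<open>auto simp: nth_list_update\<close>)
    then show "derivable sq P (lcomp (lcomp stay ?l) l) S'"
      by (simp add: g(2))
  qed (use assms in auto)
qed (use assms in \<open>auto simp: nth_Cons split: nat.split\<close>)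

lemma derivable_right:
  assumes "rrule C gs" "\<And>g. g \<in> set gs \<Longrightarrow> derivable sq P (lkR \<Phi> []) (\<Phi>, [g])"
  shows "derivable sq P stay (\<Phi>, [C])"
  by (rule derivable_step[OF rrule_step[OF assms(1)]]) (use assms(2) in auto)

definition modal_link :: "fm list \<Rightarrow> fm list \<Rightarrow> link" where
  "modal_link \<Phi> \<Delta> = idl Lft {..<length \<Phi>} True \<union> idl Rgt {..<length \<Delta>} True"

lemma derivable_box: "derivable sq P (modal_link \<Phi> [a]) (\<Phi>, [a]) \<Longrightarrow> derivable sq P stay (map Box \<Phi>, [Box a])"
  by (rule derivable_step[OF step.boxR[of \<Phi> "[]" a, unfolded append_Nil list.map]])
    (auto simp: modal_link_def)

text \<open>\<open>diaL\<close> expects its principal formula in front, so position \<open>p\<close>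
  is brought there below the rule and put back above it; \<open>X\<close> is the remaining
  context.\<close>

lemma derivable_dia:
  assumes "p < length \<Phi>" "length \<Phi>' = length \<Phi>" "\<Phi> ! p = Dia (\<Phi>' ! p)"
    and "\<And>i. i < length \<Phi> \<Longrightarrow> i \<noteq> p \<Longrightarrow> \<Phi> ! i = Box (\<Phi>' ! i)" "length \<Delta> \<le> 1"
    and "derivable sq P (modal_link \<Phi>' \<Delta>) (\<Phi>', \<Delta>)"
  shows "derivable sq P stay (\<Phi>, map Dia \<Delta>)"
proof -
  define X where "X = take p \<Phi>' @ drop (Suc p) \<Phi>'"
  have lX: "Suc (length X) = length \<Phi>'" using assms(1,2) by (simp add: X_def)
  have X: "X ! i = \<Phi>' ! (if i < p then i else Suc i)" if "i < length X" for i
    using that assms(1,2) lX by (auto simp: X_def nth_append)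
  let ?f = "\<lambda>i. if i = 0 then p else if i \<le> p then i - 1 else i"
  let ?g = "\<lambda>i. if i = p then 0 else if i < p then Suc i else i"
  let ?l = "cpf ?f (Dia (\<Phi>' ! p) # map Box X) (map Dia \<Delta>)"
  let ?m = "idl Lft {..<Suc (length X)} True \<union> idl Rgt {..<length \<Delta>} True"
  have L: "((Lft, i), (Lft, i), True) \<in> lcomp (lcomp ?l ?m) (cpf ?g \<Phi>' \<Delta>)" if "i < length \<Phi>'" for i
    by (rule lcompI[where b = "(Lft, ?g i)" and p = True and q = False],
        rule lcompI[where b = "(Lft, ?g i)" and p = False and q = True])
      (use that lX assms(1,2) in \<open>auto simp: cpf_def cp_def idl_def\<close>)
  have R: "((Rgt, i), (Rgt, i), True) \<in> lcomp (lcomp ?l ?m) (cpf ?g \<Phi>' \<Delta>)" if "i < length \<Delta>" for i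
    by (rule lcompI[where b = "(Rgt, i)" and p = True and q = False],
        rule lcompI[where b = "(Rgt, i)" and p = False and q = True])
      (use that lX in \<open>auto simp: cpf_def cp_def idl_def\<close>)
  have D: "derivable sq P (lcomp (lcomp ?l ?m) (cpf ?g \<Phi>' \<Delta>)) (\<Phi>', \<Delta>)"
    by (rule derivable_mono[OF assms(6)]) (use L R in \<open>auto simp: modal_link_def idl_def\<close>)
  have "?g i < length (\<Phi>' ! p # X) \<and> \<Phi>' ! i = (\<Phi>' ! p # X) ! ?g i"
    if "i < length \<Phi>'" for i
  proof (cases i p rule: linorder_cases)
    case greater
    then obtain j where "i = Suc j" by (cases i) auto
    then show ?thesis using that X[of j] lX greater by auto
  qed (use that X[of i] lX assms(1,2) in auto)
  then have "derivable sq P (lcomp ?l ?m) (\<Phi>' ! p # X, \<Delta>)"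
    by (rule derivable_str[OF _ assms(5) D])
  then have D': "derivable sq P (lcomp stay ?l) (Dia (\<Phi>' ! p) # map Box X, map Dia \<Delta>)"
    unfolding lcomp_stay using assms(5) by (auto intro: derivable_step[OF step.diaL])
  have F: "?f i < length \<Phi> \<and> (Dia (\<Phi>' ! p) # map Box X) ! i = \<Phi> ! ?f i"
    if "i < length (Dia (\<Phi>' ! p) # map Box X)" for i
  proof (cases i)
    case (Suc j)
    then have j: "j < length X" using that by simp
    show ?thesis
      using X[OF j] j Suc lX assms(2) assms(4)[of j] assms(4)[of "Suc j"]
      by (cases "j < p") simp_all
  qed (use assms(1,3) in simp)
  have len: "length (map Dia \<Delta>) \<le> 1" using assms(5) by simp
  show ?thesis by (rule derivable_str[OF _ len D']) (rule F)
qed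

lemma derivable_ax1:
  assumes "Var x \<in> set \<Phi>" "NVar x \<in> set \<Phi>"
  shows "derivable sq P L (\<Phi>, [])"
proof -
  obtain p q where p: "p < length \<Phi>" "\<Phi> ! p = Var x" "q < length \<Phi>" "\<Phi> ! q = NVar x"
    using assms by (metis in_set_conv_nth)
  show ?thesis
  proof (rule derivable_str[where \<Phi>' = "[Var x, NVar x]" and f = "\<lambda>i. if i = 0 then p else q"])
    show "derivable sq P (lcomp L (cpf (\<lambda>i. if i = 0 then p else q) [Var x, NVar x] [])) ([Var x, NVar x], [])"
      by (rule derivable_step[OF step.ax1]) auto
  qed (use p in \<open>auto simp: nth_Cons split: nat.split\<close>)
qed

lemma derivable_ax3:
  assumes "Var x \<in> set \<Phi>"
  shows "derivable sq P L (\<Phi>, [Var x])"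
proof -
  obtain p where p: "p < length \<Phi>" "\<Phi> ! p = Var x"
    using assms by (metis in_set_conv_nth)
  show ?thesis
  proof (rule derivable_str[where \<Phi>' = "[Var x]" and f = "\<lambda>i. p"])
    show "derivable sq P (lcomp L (cpf (\<lambda>i. p) [Var x] [Var x])) ([Var x], [Var x])"
      by (rule derivable_step[OF step.ax3]) auto
  qed (use p in auto)
qed

section \<open>The interaction of a proof with the proofs of its cut formulas\<close>

lemma inf_occ_shift: "inf_occ (\<lambda>n. f (n + K)) b \<longleftrightarrow> inf_occ f b"
proof (induction K)
  case (Suc K)
  then show ?case using inf_occ_Suc[of "\<lambda>n. f (n + K)" b] by simp
qed simp

lemma INFM_shift: "(\<exists>\<^sub>\<infinity>n. P (n + K)) \<longleftrightarrow> (\<exists>\<^sub>\<infinity>n::nat. P n)"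
proof (induction K)
  case (Suc K)
  then show ?case using INFM_Suc[of "\<lambda>n. P (n + K)"] by simp
qed simp

lemma win_shift: "win C (\<lambda>n. f (n + K)) (\<lambda>n. pf (n + K)) \<longleftrightarrow> win C f pf"
  unfolding win_def inf_occ_shift INFM_shift ..

lemma win_cong:
  assumes "\<And>n. n \<ge> K \<Longrightarrow> f n = g n" "win C f pf"
  shows "win C g pf"
proof -
  have "(\<lambda>n. f (n + K)) = (\<lambda>n. g (n + K))" using assms(1) by simp
  then show ?thesis using assms(2) win_shift by metis
qed

lemma good_trace_shift:
  assumes "good_trace (\<lambda>n. S (n + K)) (\<lambda>n. lk (n + K)) k oc pf"
  shows "good_trace S lk (k + K) (\<lambda>n. oc (n - K)) (\<lambda>n. pf (n - K))"
proof -
  have "(oc (n - K), oc (Suc n - K), pf (n - K)) \<in> lk n" if "n \<ge> k + K" for n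
  proof -
    have "(oc (n - K), oc (Suc (n - K)), pf (n - K)) \<in> lk (n - K + K)"
      using assms that unfolding good_trace_def trace_def by (metis le_diff_conv2 le_add2 le_trans)
    then show ?thesis using that by (simp add: Suc_diff_le)
  qed
  moreover have "win C (\<lambda>n. fmat (S n) (oc (n - K))) (\<lambda>n. pf (n - K))"
    if "win C (\<lambda>n. fmat (S (n + K)) (oc n)) pf" for C
    using that win_shift[of C "\<lambda>n. fmat (S n) (oc (n - K))" K "\<lambda>n. pf (n - K)"] by simp
  moreover have "k \<le> n - K" if "k + K \<le> n" for n using that by simp
  ultimately show ?thesis using assms unfolding good_trace_def trace_def by blast
qed

text \<open>In a state \<open>(M, c)\<close> the i-th antecedent formula of M is cut against U if \<open>c i = Some U\<close> and is
  visible if \<open>c i = None\<close>. The visible occurrences are named by pairs: \<open>(i, j)\<close> is the j-th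
  antecedent formula of U in the first case, \<open>(i, 0)\<close> is the formula itself in the second.\<close>

type_synonym pstate = "ptree \<times> (nat \<Rightarrow> ptree option)"

abbreviation ant :: "ptree \<Rightarrow> fm list" where "ant T \<equiv> fst (root T)"
abbreviation suc :: "ptree \<Rightarrow> fm list" where "suc T \<equiv> snd (root T)"

definition width :: "pstate \<Rightarrow> nat \<Rightarrow> nat" where
  "width s i = (case snd s i of None \<Rightarrow> 1 | Some U \<Rightarrow> length (ant U))"

definition names :: "pstate \<Rightarrow> (nat \<times> nat) list" where
  "names s = concat (map (\<lambda>i. map (Pair i) [0..<width s i]) [0..<length (ant (fst s))])"

definition label :: "pstate \<Rightarrow> nat \<times> nat \<Rightarrow> fm" where
  "label s n = (case snd s (fst n) of None \<Rightarrow> ant (fst s) ! fst n | Some U \<Rightarrow> ant U ! snd n)"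

definition state_seqt :: "pstate \<Rightarrow> seqt" where
  "state_seqt s = (map (label s) (names s), suc (fst s))"

lemma set_names: "(i, j) \<in> set (names s) \<longleftrightarrow> i < length (ant (fst s)) \<and> j < width s i"
  by (auto simp: names_def image_iff)

lemma distinct_names: "distinct (names s)"
proof -
  have "distinct (concat (map (\<lambda>i. map (Pair i) [0..<w i]) [0..<n]))" for w :: "nat \<Rightarrow> nat" and n
    by (induction n) (auto simp: distinct_map inj_on_def)
  then show ?thesis unfolding names_def .
qed

definition good_tree :: "ptree \<Rightarrow> bool" where
  "good_tree T \<longleftrightarrow> coproof T \<and> constructive T \<and> (\<forall>a\<in>set (ant T) \<union> set (suc T). wff a)"

definition valid_state :: "pstate \<Rightarrow> bool" where
  "valid_state s \<longleftrightarrow> good_tree (fst s) \<and>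
     (\<forall>i<length (ant (fst s)). \<forall>U. snd s i = Some U \<longrightarrow> good_tree U \<and> suc U = [ant (fst s) ! i])"

definition llinks :: "link \<Rightarrow> (nat \<times> nat \<times> bool) set" where
  "llinks l = {(i, i', b). ((Lft, i), (Lft, i'), b) \<in> l}"

definition main_links :: "bool \<Rightarrow> link \<Rightarrow> nat \<Rightarrow> (nat \<times> nat \<times> bool) set" where
  "main_links mv l n = (if mv then llinks l else {(i, i, False) | i. i < n})"

definition cut_links :: "bool \<Rightarrow> link \<Rightarrow> (nat \<times> nat \<times> bool) set" where
  "cut_links mv l = (if mv then llinks l else {(j, j, False) | j. True})"

text \<open>A visible formula follows the links of M. A formula of an attached proof moves inside
  that proof, while a link of M tells which position inherits the proof. The flag then comes from
  the attached proof, because the step of M on the cut formula is hidden.\<close>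

definition name_links ::
  "pstate \<Rightarrow> pstate \<Rightarrow> bool \<Rightarrow> link \<Rightarrow> (nat \<Rightarrow> bool) \<Rightarrow> (nat \<Rightarrow> link) \<Rightarrow>
     ((nat \<times> nat) \<times> (nat \<times> nat) \<times> bool) set" where
  "name_links s s' mv l mu lu = {((i, j), (i', j'), b).
     (snd s i = None \<and> snd s' i' = None \<and> j = 0 \<and> j' = 0 \<and>
        (i, i', b) \<in> main_links mv l (length (ant (fst s)))) \<or>
     (snd s i \<noteq> None \<and> snd s' i' \<noteq> None \<and>
        (\<exists>p. (i, i', p) \<in> main_links mv l (length (ant (fst s)))) \<and>
        (j, j', b) \<in> cut_links (mu i') (lu i'))}"

definition right_links :: "bool \<Rightarrow> link \<Rightarrow> bool set" where
  "right_links mv l = (if mv then {b. ((Rgt, 0), (Rgt, 0), b) \<in> l} else {False})"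

definition state_link :: "pstate \<Rightarrow> pstate \<Rightarrow> ((nat \<times> nat) \<times> (nat \<times> nat) \<times> bool) set \<Rightarrow> bool set \<Rightarrow> link" where
  "state_link s s' N R =
     {((Lft, p), (Lft, p'), b) | p p' b. p < length (names s) \<and> p' < length (names s') \<and>
        (names s ! p, names s' ! p', b) \<in> N} \<union>
     {((Rgt, 0), (Rgt, 0), b) | b. b \<in> R \<and> suc (fst s) \<noteq> [] \<and> suc (fst s') \<noteq> []}"

text \<open>The flag \<open>mv\<close> tells whether M advances along the link l; \<open>mu i\<close> tells whether the proof attached
  to the new position i advances along the link \<open>lu i\<close>. When M rests, attached proofs advance only
  by steps in which their right formula is not principal.\<close>

definition is_move ::
  "pstate \<Rightarrow> pstate \<Rightarrow> bool \<Rightarrow> link \<Rightarrow> (nat \<Rightarrow> bool) \<Rightarrow> (nat \<Rightarrow> link) \<Rightarrow> bool" where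
  "is_move s s' mv l mu lu \<longleftrightarrow>
     (if mv then (fst s', l) \<in> set (kids (fst s)) else fst s' = fst s) \<and>
     (\<forall>i i' b. (i, i', b) \<in> main_links mv l (length (ant (fst s))) \<longrightarrow>
        (snd s i = None \<and> snd s' i' = None) \<or>
        (\<exists>U U'. snd s i = Some U \<and> snd s' i' = Some U' \<and> (b \<longrightarrow> mu i') \<and>
           (if mu i' then (U', lu i') \<in> set (kids U) else U' = U))) \<and>
     (mv \<or> (\<exists>i<length (ant (fst s)). mu i \<and> snd s i \<noteq> None) \<and>
        (\<forall>i a a'. mu i \<longrightarrow> ((Rgt, a), (Rgt, a'), True) \<notin> lu i)) \<and>
     ((\<forall>i. snd s i = None) \<longrightarrow> (\<forall>i. snd s' i = None))"

text \<open>In the second case an attached proof takes over as the main proof. This happens at most once in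
  a run, so no trace has to be followed through it.\<close>

definition transition :: "pstate \<Rightarrow> pstate \<Rightarrow> link \<Rightarrow> bool" where
  "transition s s' A \<longleftrightarrow>
     (\<exists>mv l mu lu. is_move s s' mv l mu lu \<and>
        A = state_link s s' (name_links s s' mv l mu lu) (right_links mv l)) \<or>
     ((\<exists>i. snd s i \<noteq> None) \<and> (\<forall>i. snd s' i = None) \<and> A = {})"

lemma constructive_root: "constructive T \<Longrightarrow> length (suc T) \<le> 1"
  unfolding constructive_def using subtrees.intros(1) by blast

lemma constructive_kid:
  assumes "constructive T" "(u, l) \<in> set (kids T)"
  shows "constructive u"
proof -
  have "v \<in> subtrees u \<Longrightarrow> v \<in> subtrees T" for v
  proof (induction rule: subtrees.induct)
    case 1
    show ?case using subtrees.intros(2)[OF subtrees.intros(1) assms(2)] by simp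
  next
    case (2 w p)
    then show ?case using subtrees.intros(2) by blast
  qed
  then show ?thesis using assms(1) unfolding constructive_def by blast
qed

lemma step_wff:
  assumes "step b S P" "(S', l) \<in> set P" "\<forall>a\<in>set (fst S) \<union> set (snd S). wff a"
  shows "\<forall>a\<in>set (fst S') \<union> set (snd S'). wff a"
proof -
  have app: "wff (Mu a) \<Longrightarrow> wff (app a (Mu a))" "wff (Nu a) \<Longrightarrow> wff (app a (Nu a))" for a
    using wff_isub[of "Mu a"] wff_isub[of "Nu a"] by (simp_all del: wff.simps)
  show ?thesis
    using assms app by (induction rule: step.induct) (auto simp: ball_Un simp del: wff.simps(7,8))
qed

lemma good_tree_kid:
  assumes "good_tree T" "(u, l) \<in> set (kids T)"
  shows "good_tree u"
proof -
  have "wfd T" using assms(1) by (simp add: good_tree_def coproof_def)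
  from step_wff[OF wfd_step(1)[OF this], of "root u" l]
  have "\<forall>a\<in>set (ant u) \<union> set (suc u). wff a"
    using assms by (force simp: good_tree_def)
  then show ?thesis
    using assms coproof_kid constructive_kid unfolding good_tree_def by blast
qed

lemma good_tree_wfd: "good_tree T \<Longrightarrow> wfd T"
  by (simp add: good_tree_def coproof_def)

section \<open>Winning traces of runs without takeover\<close>

locale prun =
  fixes s :: "nat \<Rightarrow> pstate" and mv :: "nat \<Rightarrow> bool" and l :: "nat \<Rightarrow> link"
    and mu :: "nat \<Rightarrow> nat \<Rightarrow> bool" and lu :: "nat \<Rightarrow> nat \<Rightarrow> link"
  assumes inv: "\<And>n. valid_state (s n)"
    and move: "\<And>n. is_move (s n) (s (Suc n)) (mv n) (l n) (mu n) (lu n)"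
begin

abbreviation "M n \<equiv> fst (s n)"
abbreviation "c n \<equiv> snd (s n)"

definition mlinks where "mlinks n = main_links (mv n) (l n) (length (ant (M n)))"
definition nlinks where "nlinks n = name_links (s n) (s (Suc n)) (mv n) (l n) (mu n) (lu n)"
definition A where "A n = state_link (s n) (s (Suc n)) (nlinks n) (right_links (mv n) (l n))"

lemma goodM: "good_tree (M n)" "wfd (M n)"
  using inv[of n] good_tree_wfd by (auto simp: valid_state_def)

lemma goodU: "i < length (ant (M n)) \<Longrightarrow> c n i = Some U \<Longrightarrow> good_tree U \<and> suc U = [ant (M n) ! i]"
  using inv[of n] by (simp add: valid_state_def)

lemma srunM: "srun M mv l"
  using move by (simp add: srun_def is_move_def)

lemma mlinks_cut:
  assumes "(i, i', b) \<in> mlinks n"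
  shows "(c n i = None \<and> c (Suc n) i' = None) \<or>
        (\<exists>U U'. c n i = Some U \<and> c (Suc n) i' = Some U' \<and> (b \<longrightarrow> mu n i') \<and>
           (if mu n i' then (U', lu n i') \<in> set (kids U) else U' = U))"
  using move[of n] assms unfolding is_move_def mlinks_def by blast

lemma mlinks_valid:
  assumes "(i, i', b) \<in> mlinks n"
  shows "i < length (ant (M n))" "i' < length (ant (M (Suc n)))"
    "if b then isub (ant (M n) ! i) (ant (M (Suc n)) ! i') else ant (M (Suc n)) ! i' = ant (M n) ! i"
proof -
  have "i < length (ant (M n)) \<and> i' < length (ant (M (Suc n))) \<and>
    (if b then isub (ant (M n) ! i) (ant (M (Suc n)) ! i') else ant (M (Suc n)) ! i' = ant (M n) ! i)"
  proof (cases "mv n")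
    case True
    then have "(M (Suc n), l n) \<in> set (kids (M n))" "((Lft, i), (Lft, i'), b) \<in> l n"
      using move[of n] assms by (auto simp: is_move_def mlinks_def main_links_def llinks_def)
    from wfd_link[OF goodM(2) this] show ?thesis
      by (auto simp: valid_occ_def fmat_def split: if_splits)
  next
    case False
    then have "M (Suc n) = M n" using move[of n] by (simp add: is_move_def)
    then show ?thesis using assms False by (auto simp: mlinks_def main_links_def)
  qed
  then show "i < length (ant (M n))" "i' < length (ant (M (Suc n)))"
    "if b then isub (ant (M n) ! i) (ant (M (Suc n)) ! i') else ant (M (Suc n)) ! i' = ant (M n) ! i"
    by blast+
qed

text \<open>Traces are followed by names, since positions shift whenever an attached proof further
  left changes the length of its antecedent; positions are recovered only here.\<close>

lemma names_trace:
  assumes nm: "\<And>n. n \<ge> k \<Longrightarrow> nm n \<in> set (names (s n)) \<and> (nm n, nm (Suc n), pf n) \<in> nlinks n"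
    and w: "win Mu (\<lambda>n. label (s n) (nm n)) pf"
  shows "\<exists>k oc pf. good_trace (\<lambda>n. state_seqt (s n)) A k oc pf"
proof -
  define P where "P n = (SOME p. p < length (names (s n)) \<and> names (s n) ! p = nm n)" for n
  have P: "P n < length (names (s n)) \<and> names (s n) ! P n = nm n" if "n \<ge> k" for n
  proof -
    have "\<exists>p. p < length (names (s n)) \<and> names (s n) ! p = nm n"
      using nm[OF that] by (simp add: in_set_conv_nth)
    then show ?thesis unfolding P_def by (rule someI_ex)
  qed
  have "trace A k (\<lambda>n. (Lft, P n)) pf"
    unfolding trace_def
  proof (intro allI impI)
    fix n assume "k \<le> n"
    then have "P n < length (names (s n)) \<and> names (s n) ! P n = nm n"
      "P (Suc n) < length (names (s (Suc n))) \<and> names (s (Suc n)) ! P (Suc n) = nm (Suc n)"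
      "(nm n, nm (Suc n), pf n) \<in> nlinks n"
      using P nm by auto
    then show "((Lft, P n), (Lft, P (Suc n)), pf n) \<in> A n"
      by (auto simp: A_def state_link_def)
  qed
  moreover have "win Mu (\<lambda>n. fmat (state_seqt (s n)) (Lft, P n)) pf"
    by (rule win_cong[OF _ w, of k]) (use P in \<open>simp add: fmat_def state_seqt_def\<close>)
  ultimately have "good_trace (\<lambda>n. state_seqt (s n)) A k (\<lambda>n. (Lft, P n)) pf"
    by (simp add: good_trace_def)
  then show ?thesis by blast
qed

text \<open>The proofs attached at \<open>q n\<close> form a branch, with idle steps, of a single
  co-proof. A left winning trace there is visible under the names \<open>(q n, j)\<close>. A right
  one can only follow the single right formula, which is the cut formula
  \<open>ant (M n) ! q n\<close>; hence the second alternative.\<close>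

lemma cut_follow:
  assumes q: "\<And>n. n \<ge> k \<Longrightarrow> (q n, q (Suc n), b n) \<in> mlinks n \<and> c n (q n) \<noteq> None"
    and inf: "\<exists>\<^sub>\<infinity>n. mu n (q (Suc n))"
  shows "(\<exists>k oc pf. good_trace (\<lambda>n. state_seqt (s n)) A k oc pf) \<or>
    (\<exists>pf k. win Nu (\<lambda>n. ant (M n) ! q n) pf \<and>
       (\<forall>n\<ge>k. pf n \<longrightarrow> mu n (q (Suc n)) \<and> ((Rgt, 0), (Rgt, 0), True) \<in> lu n (q (Suc n))))"
proof -
  define U where "U n = the (c n (q n))" for n
  have U: "c n (q n) = Some (U n)" "good_tree (U n)" "suc (U n) = [ant (M n) ! q n]" if "n \<ge> k" for n
  proof -
    show *: "c n (q n) = Some (U n)" using q[OF that] by (auto simp: U_def)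
    show "good_tree (U n)" "suc (U n) = [ant (M n) ! q n]"
      using goodU[OF mlinks_valid(1) *] q[OF that] by auto
  qed
  have stp: "if mu n (q (Suc n)) then (U (Suc n), lu n (q (Suc n))) \<in> set (kids (U n)) else U (Suc n) = U n"
    if "n \<ge> k" for n
    using mlinks_cut[of "q n" "q (Suc n)" "b n" n] q[OF that] U(1)[OF that] U(1)[of "Suc n"] that by auto
  let ?m = "\<lambda>n. mu n (q (Suc n))" and ?l = "\<lambda>n. lu n (q (Suc n))"
  let ?lk = "\<lambda>n. if ?m n then ?l n else stay"
  have 1: "srun (\<lambda>n. U (n + k)) (\<lambda>n. ?m (n + k)) (\<lambda>n. ?l (n + k))"
    using stp by (simp add: srun_def)
  have 2: "coproof (U (0 + k))" using U(2)[of k] by (simp add: good_tree_def)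
  have 3: "\<exists>\<^sub>\<infinity>n. ?m (n + k)" using INFM_shift[of ?m k] inf by simp
  obtain k1 oc1 pf1 where
    "good_trace (\<lambda>n. root (U (n + k))) (\<lambda>n. ?lk (n + k)) k1 oc1 pf1"
    and val1: "\<And>n. n \<ge> k1 \<Longrightarrow> valid_occ (root (U (n + k))) (oc1 n)"
    by (rule coproof_srun[OF 2 1 3]) (rule that)
  from good_trace_shift[of "\<lambda>n. root (U n)" k ?lk, OF this(1)]
  obtain k' oc pf where gt: "good_trace (\<lambda>n. root (U n)) ?lk k' oc pf" and k': "k \<le> k'"
    and val: "\<And>n. n \<ge> k' \<Longrightarrow> valid_occ (root (U n)) (oc n)"
  proof (rule that)
    fix n assume "k1 + k \<le> n"
    then show "valid_occ (root (U n)) (oc1 (n - k))" using val1[of "n - k"] by simp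
  qed simp
  have tr: "(oc n, oc (Suc n), pf n) \<in> ?lk n" if "n \<ge> k'" for n
    using gt that by (simp add: good_trace_def trace_def)
  from gt consider
    (l) "\<forall>n\<ge>k'. fst (oc n) = Lft" "win Mu (\<lambda>n. fmat (root (U n)) (oc n)) pf" |
    (r) "\<forall>n\<ge>k'. fst (oc n) = Rgt" "win Nu (\<lambda>n. fmat (root (U n)) (oc n)) pf"
    by (auto simp: good_trace_def)
  then show ?thesis
  proof cases
    case l
    have nm: "(q n, snd (oc n)) \<in> set (names (s n)) \<and>
        ((q n, snd (oc n)), (q (Suc n), snd (oc (Suc n))), pf n) \<in> nlinks n" if "n \<ge> k'" for n
    proof -
      have L: "oc n = (Lft, snd (oc n))" "oc (Suc n) = (Lft, snd (oc (Suc n)))"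
        using l(1) that by (metis le_SucI prod.collapse)+
      have "(snd (oc n), snd (oc (Suc n)), pf n) \<in> cut_links (?m n) (?l n)"
      proof (cases "?m n")
        case True
        then have "((Lft, snd (oc n)), (Lft, snd (oc (Suc n))), pf n) \<in> ?l n"
          using tr[OF that] L by simp
        then show ?thesis using True by (simp add: cut_links_def llinks_def)
      next
        case False
        then show ?thesis using tr[OF that] by (auto simp: cut_links_def in_stay)
      qed
      moreover have "c n (q n) \<noteq> None" "c (Suc n) (q (Suc n)) \<noteq> None" "(q n, q (Suc n), b n) \<in> mlinks n"
        using q[of n] q[of "Suc n"] that k' by auto
      ultimately have "((q n, snd (oc n)), (q (Suc n), snd (oc (Suc n))), pf n) \<in> nlinks n"
        unfolding nlinks_def name_links_def mlinks_def by blast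
      moreover have "snd (oc n) < length (ant (U n))"
        using val[OF that] L(1) by (metis fst_conv side.case(1) valid_occ_def)
      then have "(q n, snd (oc n)) \<in> set (names (s n))"
        using U(1)[of n] mlinks_valid(1) q[of n] that k' by (auto simp: set_names width_def)
      ultimately show ?thesis by blast
    qed
    have "win Mu (\<lambda>n. label (s n) (q n, snd (oc n))) pf"
    proof (rule win_cong[OF _ l(2), of k'])
      fix n assume n: "n \<ge> k'"
      then show "fmat (root (U n)) (oc n) = label (s n) (q n, snd (oc n))"
        using U(1)[of n] l(1) k' by (simp add: fmat_def label_def)
    qed
    from names_trace[OF nm this] show ?thesis by blast
  next
    case r
    have oc: "oc n = (Rgt, 0)" if "n \<ge> k'" for n
      using val[OF that] r(1) that U(3)[of n] k'
      by (cases "oc n") (auto simp: valid_occ_def)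
    have "win Nu (\<lambda>n. ant (M n) ! q n) pf"
      by (rule win_cong[OF _ r(2), of k']) (use oc U(3) k' in \<open>simp add: fmat_def\<close>)
    moreover have "?m n \<and> ((Rgt, 0), (Rgt, 0), True) \<in> ?l n" if "n \<ge> k'" "pf n" for n
      using tr[OF that(1)] oc[of n] oc[of "Suc n"] that by (auto simp: in_stay split: if_splits)
    ultimately show ?thesis by blast
  qed
qed

lemma trace_main:
  assumes "\<exists>\<^sub>\<infinity>n. mv n"
  shows "\<exists>k oc pf. good_trace (\<lambda>n. state_seqt (s n)) A k oc pf"
proof -
  have cp: "coproof (M 0)" using goodM(1) by (simp add: good_tree_def)
  obtain k oc pf where
    gt: "good_trace (\<lambda>n. root (M n)) (\<lambda>n. if mv n then l n else stay) k oc pf"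
    and val: "\<And>n. n \<ge> k \<Longrightarrow> valid_occ (root (M n)) (oc n)"
    by (rule coproof_srun[OF cp srunM assms]) (rule that)
  have tr: "(oc n, oc (Suc n), pf n) \<in> (if mv n then l n else stay)" if "n \<ge> k" for n
    using gt that by (simp add: good_trace_def trace_def)
  from gt consider
    (l) "\<forall>n\<ge>k. fst (oc n) = Lft" "win Mu (\<lambda>n. fmat (root (M n)) (oc n)) pf" |
    (r) "\<forall>n\<ge>k. fst (oc n) = Rgt" "win Nu (\<lambda>n. fmat (root (M n)) (oc n)) pf"
    by (auto simp: good_trace_def)
  then show ?thesis
  proof cases
    case r
    have oc: "oc n = (Rgt, 0) \<and> suc (M n) \<noteq> []" if "n \<ge> k" for n
    proof -
      have "length (suc (M n)) \<le> 1" using goodM(1) constructive_root by (auto simp: good_tree_def)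
      then show ?thesis using val[OF that] r(1) that by (cases "oc n") (auto simp: valid_occ_def)
    qed
    have "(oc n, oc (Suc n), pf n) \<in> A n" if "n \<ge> k" for n
    proof -
      have "((Rgt, 0), (Rgt, 0), pf n) \<in> (if mv n then l n else stay)" "suc (M n) \<noteq> []" "suc (M (Suc n)) \<noteq> []"
        using tr[OF that] oc[OF that] oc[of "Suc n"] that by simp_all
      then show ?thesis
        using oc[OF that] oc[of "Suc n"] that
        by (cases "mv n") (auto simp: A_def state_link_def right_links_def in_stay)
    qed
    moreover have "win Nu (\<lambda>n. fmat (state_seqt (s n)) (oc n)) pf"
      by (rule win_cong[OF _ r(2), of k]) (use oc in \<open>simp add: fmat_def state_seqt_def\<close>)
    ultimately have "good_trace (\<lambda>n. state_seqt (s n)) A k oc pf"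
      using r(1) by (simp add: good_trace_def trace_def)
    then show ?thesis by blast
  next
    case l
    define q where "q n = snd (oc n)" for n
    have oc: "oc n = (Lft, q n)" if "n \<ge> k" for n
      using l(1) that by (metis prod.collapse q_def)
    have q: "(q n, q (Suc n), pf n) \<in> mlinks n" if "n \<ge> k" for n
    proof (cases "mv n")
      case True
      then show ?thesis
        using tr[OF that] oc[OF that] oc[of "Suc n"] that by (simp add: mlinks_def main_links_def llinks_def)
    next
      case False
      then have "q (Suc n) = q n" "\<not> pf n"
        using tr[OF that] by (simp_all add: in_stay q_def)
      moreover have "q n < length (ant (M n))"
        using val[OF that] oc[OF that] by (simp add: valid_occ_def)
      ultimately show ?thesis using False by (simp add: mlinks_def main_links_def)
    qed
    have w: "win Mu (\<lambda>n. ant (M n) ! q n) pf"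
      by (rule win_cong[OF _ l(2), of k]) (use oc in \<open>simp add: fmat_def\<close>)
    show ?thesis
    proof (cases "c k (q k) = None")
      case True
      \<comment> \<open>Links of M never lead from a cut formula to a visible one or back, so the
        status at time \<open>k\<close> persists.\<close>
      have None: "c n (q n) = None" if "n \<ge> k" for n
        using that
      proof (induction n rule: dec_induct)
        case (step n)
        then show ?case using mlinks_cut[OF q[OF step(1)]] by auto
      qed (rule True)
      have nm: "(q n, 0) \<in> set (names (s n)) \<and> ((q n, 0), (q (Suc n), 0), pf n) \<in> nlinks n" if "n \<ge> k" for n
      proof -
        have "c n (q n) = None" "c (Suc n) (q (Suc n)) = None" using None that by auto
        then show ?thesis
          using q[OF that] mlinks_valid(1)[OF q[OF that]]
          by (auto simp: set_names width_def nlinks_def name_links_def mlinks_def)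
      qed
      have "win Mu (\<lambda>n. label (s n) (q n, 0)) pf"
        by (rule win_cong[OF _ w, of k]) (use None in \<open>simp add: label_def\<close>)
      with nm show ?thesis by (rule names_trace)
    next
      case False
      have Some: "c n (q n) \<noteq> None" if "n \<ge> k" for n
        using that
      proof (induction n rule: dec_induct)
        case (step n)
        then show ?case using mlinks_cut[OF q[OF step(1)]] by auto
      qed (rule False)
      \<comment> \<open>A principal step of M on a cut formula forces the attached proof to advance,
        so that proof moves infinitely often.\<close>
      have imp: "mu n (q (Suc n))" if "n \<ge> k" "pf n" for n
        using mlinks_cut[OF q[OF that(1)]] Some[OF that(1)] that(2) by auto
      have "\<exists>\<^sub>\<infinity>n. pf (n + k)" using w INFM_shift[of pf k] by (simp add: win_def)
      then have "\<exists>\<^sub>\<infinity>n. mu (n + k) (q (Suc (n + k)))"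
        by (rule INFM_mono) (use imp in simp)
      then have "\<exists>\<^sub>\<infinity>n. mu n (q (Suc n))" using INFM_shift[of "\<lambda>n. mu n (q (Suc n))" k] by simp
      from cut_follow[OF _ this, of k pf] q Some
      consider (t) "\<exists>k oc pf. good_trace (\<lambda>n. state_seqt (s n)) A k oc pf"
        | (n) pf' where "win Nu (\<lambda>n. ant (M n) ! q n) pf'" by blast
      then show ?thesis
      proof cases
        case n
        \<comment> \<open>Both winning conditions concern this one sequence of formulas, even though
          the principal steps of M and of the attached proof may fall at different times.\<close>
        let ?h = "\<lambda>n. ant (M (n + k)) ! q (n + k)"
        have "sthread ?h"
          unfolding sthread_def
        proof
          fix n
          show "?h (Suc n) = ?h n \<or> isub (?h n) (?h (Suc n))"
            using mlinks_valid(3)[OF q[of "n + k"]] by (auto split: if_splits)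
        qed
        moreover have "wff (?h 0)"
          using goodM(1)[of k] mlinks_valid(1)[OF q[of k]] by (auto simp: good_tree_def)
        moreover obtain a where a: "inf_occ ?h (Mu a)" "\<And>b. inf_occ ?h b \<Longrightarrow> cx (Mu a) \<le> cx b"
          using w inf_occ_shift[of "\<lambda>n. ant (M n) ! q n" k] by (auto simp: win_def)
        moreover obtain a' where a': "inf_occ ?h (Nu a')" "\<And>b. inf_occ ?h b \<Longrightarrow> cx (Nu a') \<le> cx b"
          using n inf_occ_shift[of "\<lambda>n. ant (M n) ! q n" k] by (auto simp: win_def)
        ultimately have "Mu a = Nu a'" by (rule sthread_least_unique)
        then show ?thesis by simp
      qed
    qed
  qed
qed

text \<open>M has finitely many positions, so by the pigeonhole principle one attached proof
  advances infinitely often. Its constant position is followed by \<open>cut_follow\<close>, whose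
  second alternative contradicts the condition on moves at which M rests.\<close>

lemma trace_cut:
  assumes nm: "\<And>n. \<not> mv n"
  shows "\<exists>k oc pf. good_trace (\<lambda>n. state_seqt (s n)) A k oc pf"
proof -
  have M: "M n = M 0" for n
    by (induction n) (use nm move in \<open>auto simp: is_move_def\<close>)
  let ?L = "length (ant (M 0))"
  have id: "(i, i, False) \<in> mlinks n" if "i < ?L" for i n
    using that nm M[of n] by (simp add: mlinks_def main_links_def)
  have "\<exists>i\<in>{..<?L}. mu n i \<and> c n i \<noteq> None" for n
    using move[of n] nm[of n] M[of n] by (auto simp: is_move_def)
  then have "\<exists>\<^sub>\<infinity>n. \<exists>i\<in>{..<?L}. mu n i \<and> c n i \<noteq> None" unfolding INFM_nat_le by blast
  then obtain i where i: "i < ?L" "\<exists>\<^sub>\<infinity>n. mu n i \<and> c n i \<noteq> None"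
    by (subst (asm) INFM_finite_Bex_distrib) auto
  have iff: "c n i = None \<longleftrightarrow> c 0 i = None" for n
  proof (induction n)
    case (Suc n)
    then show ?case using mlinks_cut[OF id[OF i(1), of n]] by auto
  qed simp
  have "c 0 i \<noteq> None" using i(2) iff by (metis (mono_tags, lifting) INFM_E)
  then have c: "c n i \<noteq> None" for n using iff[of n] by simp
  have inf: "\<exists>\<^sub>\<infinity>n. mu n i" using i(2) by (rule INFM_mono) blast
  have "(\<exists>k oc pf. good_trace (\<lambda>n. state_seqt (s n)) A k oc pf) \<or>
    (\<exists>pf k. win Nu (\<lambda>n. ant (M n) ! i) pf \<and>
       (\<forall>n\<ge>k. pf n \<longrightarrow> mu n i \<and> ((Rgt, 0), (Rgt, 0), True) \<in> lu n i))"
    by (rule cut_follow[of 0 "\<lambda>_. i" "\<lambda>_. False"]) (use id[OF i(1)] c inf in blast)+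
  moreover have False
    if w: "win Nu (\<lambda>n. ant (M n) ! i) pf"
      and r: "\<forall>n\<ge>k. pf n \<longrightarrow> mu n i \<and> ((Rgt, 0), (Rgt, 0), True) \<in> lu n i" for pf k
  proof -
    have "\<exists>\<^sub>\<infinity>n. pf n" using w by (simp add: win_def)
    then obtain n where "n \<ge> k" "pf n" by (auto simp: INFM_nat_le)
    then have "mu n i" "((Rgt, 0), (Rgt, 0), True) \<in> lu n i" using r by auto
    moreover have "\<forall>i a a'. mu n i \<longrightarrow> ((Rgt, a), (Rgt, a'), True) \<notin> lu n i"
      using move[of n] nm[of n] unfolding is_move_def by blast
    ultimately show False by blast
  qed
  ultimately show ?thesis by blast
qed

end

text \<open>If M moves only finitely often, the run may be started where M rests forever, since a
  winning trace of a tail is one of the whole run.\<close>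

lemma prun_good:
  assumes "prun s mv l mu lu"
  shows "\<exists>k oc pf. good_trace (\<lambda>n. state_seqt (s n)) (prun.A s mv l mu lu) k oc pf"
proof (cases "\<exists>\<^sub>\<infinity>n. mv n")
  case True
  then show ?thesis by (rule prun.trace_main[OF assms])
next
  case False
  then obtain K where K: "\<And>n. n \<ge> K \<Longrightarrow> \<not> mv n" by (auto simp: INFM_nat_le)
  let ?s = "\<lambda>n. s (n + K)" and ?mv = "\<lambda>n. mv (n + K)" and ?l = "\<lambda>n. l (n + K)"
    and ?mu = "\<lambda>n. mu (n + K)" and ?lu = "\<lambda>n. lu (n + K)"
  interpret prun s mv l mu lu by fact
  interpret S: prun ?s ?mv ?l ?mu ?lu
    by unfold_locales (use inv move in simp_all)
  have "S.A = (\<lambda>n. A (n + K))"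
    by (rule ext) (simp add: S.A_def A_def S.nlinks_def nlinks_def)
  moreover have "\<exists>k oc pf. good_trace (\<lambda>n. state_seqt (s (n + K))) S.A k oc pf"
    by (rule S.trace_cut) (use K in simp)
  ultimately show ?thesis using good_trace_shift[of "\<lambda>n. state_seqt (s n)" K A] by metis
qed

text \<open>A takeover needs something attached and leaves nothing attached, and moves from such a
  state attach nothing new. Hence from some time on all transitions are moves.\<close>

lemma ptr_run_good:
  assumes inv: "\<And>n. valid_state (s n)" and tr: "\<And>n. transition (s n) (s (Suc n)) (A n)"
  shows "\<exists>k oc pf. good_trace (\<lambda>n. state_seqt (s n)) A k oc pf"
proof -
  define reset where
    "reset n \<longleftrightarrow> (\<exists>i. snd (s n) i \<noteq> None) \<and> (\<forall>i. snd (s (Suc n)) i = None)" for n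
  define mvs where "mvs n \<longleftrightarrow> (\<exists>mv l mu lu. is_move (s n) (s (Suc n)) mv l mu lu \<and>
        A n = state_link (s n) (s (Suc n)) (name_links (s n) (s (Suc n)) mv l mu lu) (right_links mv l))" for n
  have or: "mvs n \<or> reset n" for n
    using tr[of n] unfolding transition_def mvs_def reset_def by blast
  have "\<exists>K. \<forall>n\<ge>K. mvs n"
  proof (cases "\<exists>m. reset m")
    case True
    then obtain m where m: "\<forall>i. snd (s (Suc m)) i = None" by (auto simp: reset_def)
    have None: "\<forall>i. snd (s n) i = None" if "n \<ge> Suc m" for n
      using that
    proof (induction n rule: dec_induct)
      case (step n)
      from or[of n] step show ?case unfolding mvs_def is_move_def reset_def by blast
    qed (rule m)
    then have "\<not> reset n" if "n \<ge> Suc m" for n using that by (auto simp: reset_def)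
    then show ?thesis using or by blast
  next
    case False
    then show ?thesis using or by blast
  qed
  then obtain K where K: "\<And>n. mvs (n + K)" by (metis le_add2)
  then have "\<forall>n. \<exists>mv l mu lu. is_move (s (n + K)) (s (Suc n + K)) mv l mu lu \<and>
        A (n + K) = state_link (s (n + K)) (s (Suc n + K)) (name_links (s (n + K)) (s (Suc n + K)) mv l mu lu) (right_links mv l)"
    by (simp add: mvs_def)
  then obtain mv l mu lu where *: "\<And>n. is_move (s (n + K)) (s (Suc n + K)) (mv n) (l n) (mu n) (lu n)"
    "\<And>n. A (n + K) = state_link (s (n + K)) (s (Suc n + K))
       (name_links (s (n + K)) (s (Suc n + K)) (mv n) (l n) (mu n) (lu n)) (right_links (mv n) (l n))"
    by metis
  interpret prun "\<lambda>n. s (n + K)" mv l mu lu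
    by unfold_locales (rule inv, rule *(1))
  have "(\<lambda>n. A (n + K)) = local.A" using *(2) by (auto simp: A_def nlinks_def)
  then show ?thesis
    using prun_good[OF prun_axioms] good_trace_shift[of "\<lambda>n. state_seqt (s n)" K A] by metis
qed

section \<open>Macro steps on states\<close>

definition structural_node :: "ptree \<Rightarrow> bool" where
  "structural_node T \<longleftrightarrow> (\<exists>u f. (u, cpf f (ant u) (suc T)) \<in> set (kids T) \<and> suc u = suc T \<and>
     (\<forall>i<length (ant u). f i < length (ant T) \<and> ant u ! i = ant T ! f i))"

definition weakening_node :: "ptree \<Rightarrow> bool" where
  "weakening_node T \<longleftrightarrow> (\<exists>u a. (u, cp Lft id (length (ant T))) \<in> set (kids T) \<and>
     ant u = ant T \<and> suc u = [] \<and> suc T = [a])"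

definition left_node :: "ptree \<Rightarrow> bool" where
  "left_node T \<longleftrightarrow> (\<exists>C X gs. ant T = C # X \<and> lrule C gs \<and>
     (\<forall>g\<in>set gs. \<exists>u. (u, lkL X (suc T)) \<in> set (kids T) \<and> root u = (g # X, suc T)))"

definition right_node :: "ptree \<Rightarrow> bool" where
  "right_node T \<longleftrightarrow> (\<exists>C gs. suc T = [C] \<and> rrule C gs \<and>
     (\<forall>g\<in>set gs. \<exists>u. (u, lkR (ant T) []) \<in> set (kids T) \<and> root u = (ant T, [g])))"

definition box_node :: "ptree \<Rightarrow> bool" where
  "box_node T \<longleftrightarrow> (\<exists>u a. (u, modal_link (ant u) (suc u)) \<in> set (kids T) \<and>
     ant T = map Box (ant u) \<and> suc u = [a] \<and> suc T = [Box a])"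

definition dia_node :: "ptree \<Rightarrow> bool" where
  "dia_node T \<longleftrightarrow> (\<exists>u a X. (u, modal_link (ant u) (suc u)) \<in> set (kids T) \<and>
     ant u = a # X \<and> ant T = Dia a # map Box X \<and> suc T = map Dia (suc u))"

definition clash_node :: "ptree \<Rightarrow> bool" where
  "clash_node T \<longleftrightarrow> (\<exists>x. root T = ([Var x, NVar x], []))"

definition identity_node :: "ptree \<Rightarrow> bool" where
  "identity_node T \<longleftrightarrow> (\<exists>x. root T = ([Var x], [Var x]))"

text \<open>In a soft tree the right formula is not the principal formula of a logical rule, so the last rule
  commutes with a cut on it.\<close>

definition soft :: "ptree \<Rightarrow> bool" where
  "soft T \<longleftrightarrow> structural_node T \<or> weakening_node T \<or> left_node T"

text \<open>Constructivity removes the rules showing two formulas on the right: \<open>ax2\<close>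
  and \<open>exR\<close> in the conclusion, \<open>ctR\<close> in the premise. In the other right
  rules it forces the side context on the right to be empty.\<close>

lemma node_cases:
  assumes "good_tree T"
  shows "clash_node T \<or> identity_node T \<or> soft T \<or> right_node T \<or> box_node T \<or> dia_node T"
proof -
  have w: "wfd T" using assms by (rule good_tree_wfd)
  have c: "length (suc T) \<le> 1" using assms constructive_root by (auto simp: good_tree_def)
  have cu: "length (suc u) \<le> 1" if "(u, l) \<in> set (kids T)" for u l
    using good_tree_kid[OF assms that] constructive_root by (auto simp: good_tree_def)
  define Ps where "Ps = map (\<lambda>(u, l). (root u, l)) (kids T)"
  have kid: "\<exists>u. (u, l) \<in> set (kids T) \<and> root u = S" if "(S, l) \<in> set Ps" for S l
    using that by (auto simp: Ps_def)
  have cP: "length (snd S) \<le> 1" if "(S, l) \<in> set Ps" for S l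
    using kid[OF that] cu by metis
  have "step (logic T) (root T) Ps" using wfd_step(1)[OF w] by (simp add: Ps_def)
  then show ?thesis
  proof cases
    case (ax1 x)
    then show ?thesis by (simp add: clash_node_def)
  next
    case (ax2 x)
    then show ?thesis using c by simp
  next
    case (ax3 x)
    then show ?thesis by (simp add: identity_node_def)
  next
    case (exL \<Phi>1 a b \<Phi>2 \<Psi>)
    let ?l = "cp Lft (swp (length \<Phi>1)) (length \<Phi>1 + 2 + length \<Phi>2) \<union> cp Rgt id (length \<Psi>)"
    obtain u where u: "(u, ?l) \<in> set (kids T)" "root u = (\<Phi>1 @ b # a # \<Phi>2, \<Psi>)"
      using kid[of "(\<Phi>1 @ b # a # \<Phi>2, \<Psi>)" ?l] exL by auto
    have "structural_node T" unfolding structural_node_def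
      by (intro exI[of _ u] exI[of _ "swp (length \<Phi>1)"])
        (use u exL in \<open>auto simp: cpf_def swp_def nth_append nth_Cons'\<close>)
    then show ?thesis by (simp add: soft_def)
  next
    case (exR \<Phi> \<Psi>1 a b \<Psi>2)
    then show ?thesis using c by simp
  next
    case (ctL a \<Phi> \<Psi>)
    let ?l = "cp Lft (\<lambda>i. i - 1) (length \<Phi> + 2) \<union> cp Rgt id (length \<Psi>)"
    obtain u where u: "(u, ?l) \<in> set (kids T)" "root u = (a # a # \<Phi>, \<Psi>)"
      using kid[of "(a # a # \<Phi>, \<Psi>)" ?l] ctL by auto
    have "structural_node T" unfolding structural_node_def
      by (intro exI[of _ u] exI[of _ "\<lambda>i. i - 1"])
        (use u ctL in \<open>auto simp: cpf_def nth_Cons'\<close>)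
    then show ?thesis by (simp add: soft_def)
  next
    case (ctR \<Phi> \<Psi> a)
    then show ?thesis using cP[of "(\<Phi>, \<Psi> @ [a, a])"] by auto
  next
    case (wkL a \<Phi> \<Psi>)
    let ?l = "cp Lft Suc (length \<Phi>) \<union> cp Rgt id (length \<Psi>)"
    obtain u where u: "(u, ?l) \<in> set (kids T)" "root u = (\<Phi>, \<Psi>)"
      using kid[of "(\<Phi>, \<Psi>)" ?l] wkL by auto
    have "structural_node T" unfolding structural_node_def
      by (intro exI[of _ u] exI[of _ Suc]) (use u wkL in \<open>auto simp: cpf_def\<close>)
    then show ?thesis by (simp add: soft_def)
  next
    case (wkR \<Phi> \<Psi> a)
    then have \<Psi>: "\<Psi> = []" using c by simp
    obtain u where u: "(u, cp Lft id (length \<Phi>) \<union> cp Rgt id (length \<Psi>)) \<in> set (kids T)" "root u = (\<Phi>, \<Psi>)"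
      using kid[of "(\<Phi>, \<Psi>)"] wkR by auto
    have "cp Rgt id (length \<Psi>) = {}" by (simp add: \<Psi> cp_def)
    then have "weakening_node T" unfolding weakening_node_def
      by (intro exI[of _ u] exI[of _ a]) (use u wkR \<Psi> in auto)
    then show ?thesis by (simp add: soft_def)
  next
    case (conjL g G \<Phi> \<Psi>)
    have "left_node T" unfolding left_node_def
      by (intro exI[of _ "Conj G"] exI[of _ \<Phi>] exI[of _ "[g]"])
        (use conjL kid[of "(g # \<Phi>, \<Psi>)" "lkL \<Phi> \<Psi>"] in \<open>auto simp: lrule_def\<close>)
    then show ?thesis by (simp add: soft_def)
  next
    case (disjL gs G \<Phi> \<Psi>)
    have "\<exists>u. (u, lkL \<Phi> \<Psi>) \<in> set (kids T) \<and> root u = (g # \<Phi>, \<Psi>)" if "g \<in> set gs" for g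
      using kid[of "(g # \<Phi>, \<Psi>)" "lkL \<Phi> \<Psi>"] disjL that by auto
    then have "left_node T" unfolding left_node_def
      by (intro exI[of _ "Disj G"] exI[of _ \<Phi>] exI[of _ gs])
        (use disjL in \<open>auto simp: lrule_def\<close>)
    then show ?thesis by (simp add: soft_def)
  next
    case (muL a \<Phi> \<Psi>)
    have "left_node T" unfolding left_node_def
      by (intro exI[of _ "Mu a"] exI[of _ \<Phi>] exI[of _ "[app a (Mu a)]"])
        (use muL kid[of "(app a (Mu a) # \<Phi>, \<Psi>)" "lkL \<Phi> \<Psi>"] in \<open>auto simp: lrule_def\<close>)
    then show ?thesis by (simp add: soft_def)
  next
    case (nuL a \<Phi> \<Psi>)
    have "left_node T" unfolding left_node_def
      by (intro exI[of _ "Nu a"] exI[of _ \<Phi>] exI[of _ "[app a (Nu a)]"])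
        (use nuL kid[of "(app a (Nu a) # \<Phi>, \<Psi>)" "lkL \<Phi> \<Psi>"] in \<open>auto simp: lrule_def\<close>)
    then show ?thesis by (simp add: soft_def)
  next
    case (diaL a \<Phi> \<Psi>)
    obtain u where u: "(u, modal_link (a # \<Phi>) \<Psi>) \<in> set (kids T)" "root u = (a # \<Phi>, \<Psi>)"
      using diaL kid[of "(a # \<Phi>, \<Psi>)" "modal_link (a # \<Phi>) \<Psi>"] by (auto simp: modal_link_def)
    have "dia_node T" unfolding dia_node_def
      by (intro exI[of _ u] exI[of _ a] exI[of _ \<Phi>]) (use u diaL in simp)
    then show ?thesis by simp
  next
    case (conjR gs G \<Phi> \<Psi>)
    then have \<Psi>: "\<Psi> = []" using c by simp
    have "\<exists>u. (u, lkR \<Phi> []) \<in> set (kids T) \<and> root u = (\<Phi>, [g])" if "g \<in> set gs" for g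
      using kid[of "(\<Phi>, [g])" "lkR \<Phi> []"] conjR \<Psi> that by auto
    then have "right_node T" unfolding right_node_def
      by (intro exI[of _ "Conj G"] exI[of _ gs]) (use conjR \<Psi> in \<open>auto simp: rrule_def\<close>)
    then show ?thesis by simp
  next
    case (disjR g G \<Phi> \<Psi>)
    then have \<Psi>: "\<Psi> = []" using c by simp
    have "right_node T" unfolding right_node_def
      by (intro exI[of _ "Disj G"] exI[of _ "[g]"])
        (use disjR \<Psi> kid[of "(\<Phi>, [g])" "lkR \<Phi> []"] in \<open>auto simp: rrule_def\<close>)
    then show ?thesis by simp
  next
    case (muR \<Phi> \<Psi> a)
    then have \<Psi>: "\<Psi> = []" using c by simp
    have "right_node T" unfolding right_node_def
      by (intro exI[of _ "Mu a"] exI[of _ "[app a (Mu a)]"])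
        (use muR \<Psi> kid[of "(\<Phi>, [app a (Mu a)])" "lkR \<Phi> []"] in \<open>auto simp: rrule_def\<close>)
    then show ?thesis by simp
  next
    case (nuR \<Phi> \<Psi> a)
    then have \<Psi>: "\<Psi> = []" using c by simp
    have "right_node T" unfolding right_node_def
      by (intro exI[of _ "Nu a"] exI[of _ "[app a (Nu a)]"])
        (use nuR \<Psi> kid[of "(\<Phi>, [app a (Nu a)])" "lkR \<Phi> []"] in \<open>auto simp: rrule_def\<close>)
    then show ?thesis by simp
  next
    case (boxR \<Phi> \<Psi> a)
    then have \<Psi>: "\<Psi> = []" using c by simp
    obtain u where u: "(u, modal_link \<Phi> [a]) \<in> set (kids T)" "root u = (\<Phi>, [a])"
      using boxR \<Psi> kid[of "(\<Phi>, [a])" "modal_link \<Phi> [a]"] by (auto simp: modal_link_def)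
    have "box_node T" unfolding box_node_def
      by (intro exI[of _ u] exI[of _ a]) (use u boxR \<Psi> in simp)
    then show ?thesis by simp
  qed
qed

lemma llinks_simps:
  "(i, i', b) \<in> llinks (cpf f \<Phi> \<Delta>) \<longleftrightarrow> i = f i' \<and> i' < length \<Phi> \<and> \<not> b"
  "(i, i', b) \<in> llinks (cp Lft id n) \<longleftrightarrow> i = i' \<and> i' < n \<and> \<not> b"
  "(i, i', b) \<in> llinks (lkL \<Phi> \<Delta>) \<longleftrightarrow> i = i' \<and> i' \<le> length \<Phi> \<and> (b \<longleftrightarrow> i' = 0)"
  "(i, i', b) \<in> llinks (lkR \<Phi> \<Delta>) \<longleftrightarrow> i = i' \<and> i' < length \<Phi> \<and> \<not> b"
  "(i, i', b) \<in> llinks (modal_link \<Phi> \<Delta>) \<longleftrightarrow> i = i' \<and> i' < length \<Phi> \<and> b"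
  by (auto simp: llinks_def cpf_def cp_def lkL_def lkR_def idl_def modal_link_def)

lemma right_links_simps:
  "right_links False l = {False}"
  "right_links True (cpf f \<Phi> \<Delta>) \<subseteq> {False}"
  "right_links True (lkL \<Phi> \<Delta>) \<subseteq> {False}"
  "right_links True (lkR \<Phi> []) \<subseteq> {True}"
  "right_links True (modal_link \<Phi> \<Delta>) \<subseteq> {True}"
  by (auto simp: right_links_def cpf_def cp_def lkL_def lkR_def idl_def modal_link_def)

lemma no_right_links:
  "((Rgt, a), (Rgt, a'), True) \<notin> cpf f \<Phi> \<Delta>"
  "((Rgt, a), (Rgt, a'), True) \<notin> lkL \<Phi> \<Delta>"
  by (auto simp: cpf_def cp_def lkL_def idl_def)

lemma pinv_suc: "valid_state s \<Longrightarrow> length (suc (fst s)) \<le> 1"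
  using constructive_root by (auto simp: valid_state_def good_tree_def)

section \<open>From moves on names to derivations of sequents\<close>

definition valid_transition :: "pstate \<Rightarrow> pstate \<Rightarrow> link \<Rightarrow> bool" where
  "valid_transition s s' A \<longleftrightarrow> transition s s' A \<and> valid_state s'"

text \<open>A leaf may promise fewer links than its derivation offers, so it suffices to bound the
  links of a move from above by simple sets \<open>N\<close> and \<open>R\<close>.\<close>

definition good_move where
  "good_move s s' N R \<longleftrightarrow> valid_state s' \<and> (\<exists>mv l mu lu. is_move s s' mv l mu lu \<and>
     name_links s s' mv l mu lu \<subseteq> N \<and> right_links mv l \<subseteq> R)"

lemma plink_mono: "N \<subseteq> N' \<Longrightarrow> R \<subseteq> R' \<Longrightarrow> state_link s s' N R \<subseteq> state_link s s' N' R'"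
  unfolding state_link_def by (intro Un_mono Collect_mono) blast+

lemma good_move_der:
  assumes "good_move s s' N R" "state_link s s' N R \<subseteq> L"
  shows "derivable state_seqt (valid_transition s) L (state_seqt s')"
proof -
  obtain mv l mu lu where *: "valid_state s'" "is_move s s' mv l mu lu" "name_links s s' mv l mu lu \<subseteq> N"
    "right_links mv l \<subseteq> R"
    using assms(1) unfolding good_move_def by blast
  have "state_link s s' (name_links s s' mv l mu lu) (right_links mv l) \<subseteq> state_link s s' N R"
    using *(3,4) by (rule plink_mono)
  then have "state_link s s' (name_links s s' mv l mu lu) (right_links mv l) \<subseteq> L"
    using assms(2) by (rule subset_trans)
  moreover have "valid_transition s s' (state_link s s' (name_links s s' mv l mu lu) (right_links mv l))"
    using *(1,2) unfolding valid_transition_def transition_def by blast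
  ultimately show ?thesis by (intro derivable_leaf)
qed

lemma index_names:
  assumes "n \<in> set (names s)"
  obtains p where "p < length (names s)" "names s ! p = n"
  using assms by (metis in_set_conv_nth)

lemma names_inj: "p < length (names s) \<Longrightarrow> q < length (names s) \<Longrightarrow> names s ! p = names s ! q \<Longrightarrow> p = q"
  using distinct_names nth_eq_iff_index_eq by blast

definition fpos :: "pstate \<Rightarrow> pstate \<Rightarrow> (nat \<times> nat \<Rightarrow> nat \<times> nat) \<Rightarrow> nat \<Rightarrow> nat" where
  "fpos s s' fn p' = (SOME p. p < length (names s) \<and> names s ! p = fn (names s' ! p'))"

lemma fpos:
  assumes "\<And>n. n \<in> set (names s') \<Longrightarrow> fn n \<in> set (names s)" "p' < length (names s')"
  shows "fpos s s' fn p' < length (names s)" "names s ! fpos s s' fn p' = fn (names s' ! p')"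
proof -
  have "\<exists>p. p < length (names s) \<and> names s ! p = fn (names s' ! p')"
    using assms by (metis in_set_conv_nth nth_mem)
  then have "fpos s s' fn p' < length (names s) \<and> names s ! fpos s s' fn p' = fn (names s' ! p')"
    unfolding fpos_def by (rule someI_ex)
  then show "fpos s s' fn p' < length (names s)" "names s ! fpos s s' fn p' = fn (names s' ! p')"
    by auto
qed

text \<open>Serves the structural rules of M and of attached proofs, and also the principal
  reduction, where the visible sequent does not change and \<open>fn\<close> is
  \<open>id\<close>.\<close>

lemma derivable_pstr:
  assumes "valid_state s" "good_move s s' {(fn n, n, False) | n. True} {False}" "suc (fst s') = suc (fst s)"
    and fn: "\<And>n. n \<in> set (names s') \<Longrightarrow> fn n \<in> set (names s) \<and> label s' n = label s (fn n)"
  shows "derivable state_seqt (valid_transition s) stay (state_seqt s)"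
proof -
  let ?f = "fpos s s' fn"
  have f: "?f p < length (names s)" "names s ! ?f p = fn (names s' ! p)" if "p < length (names s')" for p
    using fpos[of s' fn s p] fn that by auto
  have "state_link s s' {(fn n, n, False) | n. True} {False} \<subseteq> cpf ?f (map (label s') (names s')) (suc (fst s))"
    using f names_inj[of _ s "?f _"] by (fastforce simp: state_link_def cpf_def cp_def)
  then have D: "derivable state_seqt (valid_transition s) (lcomp stay (cpf ?f (map (label s') (names s')) (suc (fst s)))) (map (label s') (names s'), suc (fst s))"
    using good_move_der[OF assms(2)] assms(3) by (simp add: state_seqt_def)
  show ?thesis
    unfolding state_seqt_def[of s]
  proof (rule derivable_str[OF _ pinv_suc[OF assms(1)] D])
    fix p assume "p < length (map (label s') (names s'))"
    then show "?f p < length (map (label s) (names s)) \<and> map (label s') (names s') ! p = map (label s) (names s) ! ?f p"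
      using f[of p] fn[of "names s' ! p"] by simp
  qed
qed

lemma derivable_preset:
  assumes "valid_state s" "valid_state s'" "snd s i \<noteq> None" "\<And>i. snd s' i = None"
    "suc (fst s') = suc (fst s) \<or> suc (fst s') = []"
    and fn: "\<And>n. n \<in> set (names s') \<Longrightarrow> fn n \<in> set (names s) \<and> label s' n = label s (fn n)"
  shows "derivable state_seqt (valid_transition s) stay (state_seqt s)"
proof -
  let ?f = "fpos s s' fn"
  have f: "?f p < length (names s)" "names s ! ?f p = fn (names s' ! p)" if "p < length (names s')" for p
    using fpos[of s' fn s p] fn that by auto
  have "valid_transition s s' {}" using assms(2-4) by (auto simp: valid_transition_def transition_def)
  then have "derivable state_seqt (valid_transition s) {} (state_seqt s')" by (rule derivable_leaf) simp
  then have D: "derivable state_seqt (valid_transition s) {} (map (label s') (names s'), suc (fst s'))" by (simp add: state_seqt_def)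
  show ?thesis
    unfolding state_seqt_def[of s]
  proof (rule derivable_restart[OF _ pinv_suc[OF assms(1)] assms(5) D])
    fix p assume "p < length (map (label s') (names s'))"
    then show "?f p < length (map (label s) (names s)) \<and> map (label s') (names s') ! p = map (label s) (names s) ! ?f p"
      using f[of p] fn[of "names s' ! p"] by simp
  qed
qed

lemma plink_same:
  assumes "names s' = names s"
  shows "state_link s s' {(n, n, b n) | n. True} R \<subseteq>
    {((Lft, p), (Lft, p), b (names s ! p)) | p. p < length (names s)} \<union>
    {((Rgt, 0), (Rgt, 0), b) | b. b \<in> R \<and> suc (fst s) \<noteq> [] \<and> suc (fst s') \<noteq> []}"
  using names_inj[of _ s] unfolding state_link_def assms by auto

lemma derivable_pwkR:
  assumes "good_move s s' {(n, n, False) | n. True} R" "names s' = names s" "suc (fst s) = [a]" "suc (fst s') = []"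
    and "\<And>n. n \<in> set (names s) \<Longrightarrow> label s' n = label s n"
  shows "derivable state_seqt (valid_transition s) stay (state_seqt s)"
proof -
  have "state_link s s' {(n, n, False) | n. True} R \<subseteq> cp Lft id (length (map (label s) (names s)))"
    using plink_same[OF assms(2), of "\<lambda>_. False" R] assms(4) by (auto simp: cp_def)
  from good_move_der[OF assms(1) this]
  have "derivable state_seqt (valid_transition s) (lcomp stay (cp Lft id (length (map (label s) (names s))))) (map (label s) (names s), [])"
    using assms(2,4,5) by (simp add: state_seqt_def cong: map_cong)
  then show ?thesis unfolding state_seqt_def[of s] assms(3) by (rule derivable_wkR)
qed

lemma derivable_pleft:
  assumes "valid_state s" "lrule C gs" "n0 \<in> set (names s)" "label s n0 = C"
    and "\<And>g. g \<in> set gs \<Longrightarrow> \<exists>s'. good_move s s' {(n, n, n = n0) | n. True} {False} \<and>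
      names s' = names s \<and> suc (fst s') = suc (fst s) \<and>
      (\<forall>n\<in>set (names s). label s' n = (if n = n0 then g else label s n))"
  shows "derivable state_seqt (valid_transition s) stay (state_seqt s)"
proof -
  obtain p where p: "p < length (names s)" "names s ! p = n0" using assms(3) by (rule index_names)
  have eq: "q = p \<longleftrightarrow> names s ! q = n0" if "q < length (names s)" for q
    using p that names_inj by blast
  show ?thesis
    unfolding state_seqt_def[of s]
  proof (rule derivable_left[OF assms(2), of p])
    fix g assume "g \<in> set gs"
    then obtain s' where s': "good_move s s' {(n, n, n = n0) | n. True} {False}"
      "names s' = names s" "suc (fst s') = suc (fst s)"
      "\<And>n. n\<in>set (names s) \<Longrightarrow> label s' n = (if n = n0 then g else label s n)"
      using assms(5) by blast
    have "state_link s s' {(n, n, n = n0) | n. True} {False} \<subseteq>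
      {((Lft, i), (Lft, i), i = p) | i. i < length (map (label s) (names s))} \<union> cp Rgt id (length (suc (fst s)))"
      using plink_same[OF s'(2), of "\<lambda>n. n = n0" "{False}"] eq by (fastforce simp: cp_def)
    moreover have "(map (label s) (names s))[p := g] ! i = map (label s') (names s') ! i" if "i < length (names s)" for i
      using s'(4)[of "names s ! i"] eq[OF that] that s'(2) by (auto simp: nth_list_update)
    then have "(map (label s) (names s))[p := g] = map (label s') (names s')"
      by (intro nth_equalityI) (simp_all add: s'(2))
    ultimately show "derivable state_seqt (valid_transition s) ({((Lft, i), (Lft, i), i = p) | i. i < length (map (label s) (names s))} \<union>
        cp Rgt id (length (suc (fst s)))) ((map (label s) (names s))[p := g], suc (fst s))"
      using good_move_der[OF s'(1)] s'(3) by (simp add: state_seqt_def)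
  qed (use p assms pinv_suc in auto)
qed

lemma derivable_pright:
  assumes "rrule C gs" "suc (fst s) = [C]"
    and "\<And>g. g \<in> set gs \<Longrightarrow> \<exists>s'. good_move s s' {(n, n, False) | n. True} {True} \<and>
      names s' = names s \<and> suc (fst s') = [g] \<and> (\<forall>n\<in>set (names s). label s' n = label s n)"
  shows "derivable state_seqt (valid_transition s) stay (state_seqt s)"
  unfolding state_seqt_def[of s] assms(2)
proof (rule derivable_right[OF assms(1)])
  fix g assume "g \<in> set gs"
  then obtain s' where s': "good_move s s' {(n, n, False) | n. True} {True}"
    "names s' = names s" "suc (fst s') = [g]" "\<And>n. n\<in>set (names s) \<Longrightarrow> label s' n = label s n"
    using assms(3) by blast
  have "state_link s s' {(n, n, False) | n. True} {True} \<subseteq> lkR (map (label s) (names s)) []"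
    using plink_same[OF s'(2), of "\<lambda>n. False" "{True}"] by (fastforce simp: lkR_def idl_def)
  then show "derivable state_seqt (valid_transition s) (lkR (map (label s) (names s)) []) (map (label s) (names s), [g])"
    using good_move_der[OF s'(1)] s'(2-4) by (simp add: state_seqt_def cong: map_cong)
qed

lemma plink_modal:
  assumes "names s' = names s" "length (suc (fst s')) \<le> 1"
  shows "state_link s s' {(n, n, True) | n. True} {True} \<subseteq> modal_link (map (label s') (names s')) (suc (fst s'))"
  using plink_same[OF assms(1), of "\<lambda>n. True" "{True}"] assms
  by (fastforce simp: modal_link_def idl_def)

lemma derivable_pbox:
  assumes "good_move s s' {(n, n, True) | n. True} {True}" "names s' = names s"
    and "suc (fst s) = [Box a]" "suc (fst s') = [a]"
    and "\<And>n. n \<in> set (names s) \<Longrightarrow> label s n = Box (label s' n)"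
  shows "derivable state_seqt (valid_transition s) stay (state_seqt s)"
proof -
  have "map (label s) (names s) = map Box (map (label s') (names s'))" using assms(2,5) by simp
  moreover have "derivable state_seqt (valid_transition s) (modal_link (map (label s') (names s')) [a]) (map (label s') (names s'), [a])"
    using good_move_der[OF assms(1) plink_modal] assms(2,4) by (simp add: state_seqt_def)
  ultimately show ?thesis
    unfolding state_seqt_def[of s] assms(3) using derivable_box by metis
qed

lemma derivable_pdia:
  assumes "good_move s s' {(n, n, True) | n. True} {True}" "names s' = names s" "valid_state s'"
    and "suc (fst s) = map Dia (suc (fst s'))" "n0 \<in> set (names s)" "label s n0 = Dia (label s' n0)"
    and "\<And>n. n \<in> set (names s) \<Longrightarrow> n \<noteq> n0 \<Longrightarrow> label s n = Box (label s' n)"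
  shows "derivable state_seqt (valid_transition s) stay (state_seqt s)"
proof -
  obtain p where p: "p < length (names s)" "names s ! p = n0" using assms(5) by (rule index_names)
  have eq: "q = p \<longleftrightarrow> names s ! q = n0" if "q < length (names s)" for q
    using p that names_inj by blast
  have len: "length (suc (fst s')) \<le> 1" using pinv_suc[OF assms(3)] .
  have D: "derivable state_seqt (valid_transition s) (modal_link (map (label s') (names s')) (suc (fst s'))) (map (label s') (names s'), suc (fst s'))"
    using good_move_der[OF assms(1) plink_modal[OF assms(2) len]] by (simp add: state_seqt_def)
  show ?thesis
    unfolding state_seqt_def[of s] assms(4)
    by (rule derivable_dia[OF _ _ _ _ len D, of p]) (use p eq assms(2,6,7) in auto)
qed

section \<open>Cut elimination\<close>

lemma names_cong:
  assumes "length (ant (fst s')) = length (ant (fst s))"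
    and "\<And>i. i < length (ant (fst s)) \<Longrightarrow> width s' i = width s i"
  shows "names s' = names s"
  unfolding names_def assms(1) by (rule arg_cong[where f = concat], rule map_cong) (use assms(2) in auto)

lemma good_moveI:
  assumes "valid_state s'" "is_move s s' mv l mu lu" "name_links s s' mv l mu lu \<subseteq> N" "right_links mv l \<subseteq> R"
  shows "good_move s s' N R"
  using assms unfolding good_move_def by blast

lemma derivable_soft:
  assumes inv: "valid_state s" and i: "i < length (ant (fst s))" "snd s i = Some U" and "soft U"
  shows "derivable state_seqt (valid_transition s) stay (state_seqt s)"
proof -
  obtain M c where s: "s = (M, c)" by (cases s)
  have iM: "i < length (ant M)" and ci: "c i = Some U" using i by (simp_all add: s)
  have U: "good_tree U" "suc U = [ant M ! i]" using inv i by (auto simp: valid_state_def s)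
  from \<open>soft U\<close> consider "structural_node U" | "weakening_node U" | "left_node U" by (auto simp: soft_def)
  then show ?thesis
  proof cases
    case 1
    then obtain u f where u: "(u, cpf f (ant u) (suc U)) \<in> set (kids U)" "suc u = suc U"
      "\<And>j. j < length (ant u) \<Longrightarrow> f j < length (ant U) \<and> ant u ! j = ant U ! f j"
      by (auto simp: structural_node_def)
    define s' where "s' = (M, c(i := Some u))"
    have "valid_state s'"
      using inv good_tree_kid[OF U(1) u(1)] u(2) U(2) by (auto simp: valid_state_def s s'_def)
    moreover have "is_move s s' False {} (\<lambda>k. k = i) (\<lambda>_. cpf f (ant u) (suc U))"
      using iM ci u(1) by (auto simp: is_move_def s s'_def main_links_def no_right_links)
    moreover have "name_links s s' False {} (\<lambda>k. k = i) (\<lambda>_. cpf f (ant u) (suc U)) \<subseteq>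
        {((\<lambda>(k, j). if k = i then (k, f j) else (k, j)) n, n, False) | n. True}"
      by (auto simp: name_links_def main_links_def cut_links_def llinks_simps s s'_def split: if_splits)
    ultimately have "good_move s s' {((\<lambda>(k, j). if k = i then (k, f j) else (k, j)) n, n, False) | n. True} {False}"
      by (rule good_moveI) (simp add: right_links_simps)
    then show ?thesis
    proof (rule derivable_pstr[OF inv])
      show "suc (fst s') = suc (fst s)" by (simp add: s s'_def)
      fix n assume n: "n \<in> set (names s')"
      obtain k j where kj: "n = (k, j)" by (cases n)
      show "(\<lambda>(k, j). if k = i then (k, f j) else (k, j)) n \<in> set (names s) \<and>
          label s' n = label s ((\<lambda>(k, j). if k = i then (k, f j) else (k, j)) n)"
        using u(3) ci n by (auto simp: kj set_names width_def label_def s'_def s split: if_splits option.splits)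
    qed
  next
    case 2
    then obtain u a where u: "(u, cp Lft id (length (ant U))) \<in> set (kids U)"
      "ant u = ant U" "suc u = []" by (auto simp: weakening_node_def)
    \<comment> \<open>The premise of the right weakening has an empty right side, so it can stand
      alone: it takes over as main proof, and all other formulas of the sequent are weakened
      away.\<close>
    have "valid_state (u, \<lambda>_. None)"
      using good_tree_kid[OF U(1) u(1)] by (simp add: valid_state_def)
    then show ?thesis
      by (rule derivable_preset[OF inv, of _ i "\<lambda>(j, _). (i, j)"])
        (use iM ci u in \<open>auto simp: set_names width_def label_def s\<close>)
  next
    case 3
    then obtain C X gs where u: "ant U = C # X" "lrule C gs"
      "\<And>g. g \<in> set gs \<Longrightarrow> \<exists>u. (u, lkL X (suc U)) \<in> set (kids U) \<and> root u = (g # X, suc U)"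
      unfolding left_node_def by blast
    show ?thesis
    proof (rule derivable_pleft[OF inv u(2), of "(i, 0)"])
      show "(i, 0) \<in> set (names s)" using iM ci u(1) by (simp add: set_names width_def s)
      show "label s (i, 0) = C" using ci u(1) by (simp add: label_def s)
      fix g assume "g \<in> set gs"
      then obtain v where v: "(v, lkL X (suc U)) \<in> set (kids U)" "root v = (g # X, suc U)"
        using u(3) by blast
      define s' where "s' = (M, c(i := Some v))"
      have "valid_state s'"
        using inv good_tree_kid[OF U(1) v(1)] v(2) U(2) by (auto simp: valid_state_def s s'_def)
      moreover have "is_move s s' False {} (\<lambda>k. k = i) (\<lambda>_. lkL X (suc U))"
        using iM ci v(1) by (auto simp: is_move_def s s'_def main_links_def no_right_links)
      moreover have "name_links s s' False {} (\<lambda>k. k = i) (\<lambda>_. lkL X (suc U)) \<subseteq>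
          {(n, n, n = (i, 0)) | n. True}"
        using ci by (auto simp: name_links_def main_links_def cut_links_def llinks_simps s s'_def split: if_splits)
      ultimately have "good_move s s' {(n, n, n = (i, 0)) | n. True} {False}"
        by (rule good_moveI) (simp add: right_links_simps)
      moreover have "names s' = names s"
        by (rule names_cong) (use ci u(1) v(2) in \<open>auto simp: s s'_def width_def\<close>)
      moreover have "label s' (k, j) = (if (k, j) = (i, 0) then g else label s (k, j))" for k j
        using ci u(1) v(2) by (auto simp: s s'_def label_def nth_Cons' split: option.splits)
      then have "\<forall>n\<in>set (names s). label s' n = (if n = (i, 0) then g else label s n)"
        by (metis surj_pair)
      moreover have "suc (fst s') = suc (fst s)" by (simp add: s s'_def)
      ultimately show "\<exists>s'. good_move s s' {(n, n, n = (i, 0)) | n. True} {False} \<and>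
        names s' = names s \<and> suc (fst s') = suc (fst s) \<and>
        (\<forall>n\<in>set (names s). label s' n = (if n = (i, 0) then g else label s n))"
        by blast
    qed
  qed
qed

text \<open>The right side of \<open>U\<close> is exactly the cut formula. This excludes a clash,
  and the last rule of \<open>U\<close> then determines the outermost symbol of the cut
  formula.\<close>

lemma not_soft_cut:
  assumes "valid_state s" "i < length (ant (fst s))" "snd s i = Some U" "\<not> soft U"
  shows "(\<exists>x. ant (fst s) ! i = Var x \<and> ant U = [Var x] \<and> suc U = [Var x]) \<or>
    (\<exists>gs. rrule (ant (fst s) ! i) gs \<and>
       (\<forall>g\<in>set gs. \<exists>u. (u, lkR (ant U) []) \<in> set (kids U) \<and> root u = (ant U, [g]))) \<or>
    (\<exists>a. ant (fst s) ! i = Box a \<and> box_node U) \<or> (\<exists>a. ant (fst s) ! i = Dia a \<and> dia_node U)"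
proof -
  have U: "good_tree U" "suc U = [ant (fst s) ! i]" using assms(1-3) by (auto simp: valid_state_def)
  from node_cases[OF U(1)] assms(4)
  consider "clash_node U" | "identity_node U" | "right_node U" | "box_node U" | "dia_node U" by blast
  then show ?thesis
  proof cases
    case 1 then show ?thesis using U(2) by (auto simp: clash_node_def)
  next
    case 2
    then obtain x where x: "root U = ([Var x], [Var x])" by (auto simp: identity_node_def)
    then have "ant (fst s) ! i = Var x" using U(2) by simp
    then show ?thesis using x by simp
  next
    case 3
    then obtain C gs where "suc U = [C]" "rrule C gs"
      "\<forall>g\<in>set gs. \<exists>u. (u, lkR (ant U) []) \<in> set (kids U) \<and> root u = (ant U, [g])"
      unfolding right_node_def by blast
    moreover from this(1) have "C = ant (fst s) ! i" using U(2) by simp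
    ultimately show ?thesis by blast
  next
    case 4
    then obtain a where "suc U = [Box a]" unfolding box_node_def by blast
    then have "ant (fst s) ! i = Box a" using U(2) by simp
    then show ?thesis using 4 by blast
  next
    case 5
    then obtain u where "suc U = map Dia (suc u)" unfolding dia_node_def by blast
    then obtain a where "ant (fst s) ! i = Dia a" using U(2) by (cases "suc u") auto
    then show ?thesis using 5 by blast
  qed
qed

lemma rrule_simps [simp]:
  "\<not> rrule (Var x) gs" "\<not> rrule (NVar x) gs" "\<not> rrule (Box a) gs" "\<not> rrule (Dia a) gs"
  by (auto simp: rrule_def)

lemma lrule_simps [simp]:
  "\<not> lrule (Var x) gs" "\<not> lrule (NVar x) gs" "\<not> lrule (Box a) gs" "\<not> lrule (Dia a) gs"
  by (auto simp: lrule_def)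

section \<open>One macro step for each last rule of the main proof\<close>

lemma derivable_main_str:
  assumes inv: "valid_state s" and "structural_node (fst s)"
  shows "derivable state_seqt (valid_transition s) stay (state_seqt s)"
proof -
  obtain M c where s: "s = (M, c)" by (cases s)
  have M: "good_tree M" using inv by (simp add: valid_state_def s)
  obtain u f where u: "(u, cpf f (ant u) (suc M)) \<in> set (kids M)" "suc u = suc M"
      "\<And>j. j < length (ant u) \<Longrightarrow> f j < length (ant M) \<and> ant u ! j = ant M ! f j"
    using assms(2) by (auto simp: structural_node_def s)
  \<comment> \<open>Precomposition with \<open>f\<close> duplicates attached proofs at contractions,
    drops them at weakenings and permutes them at exchanges.\<close>
  define s' where "s' = (u, \<lambda>i. c (f i))"
  let ?l = "cpf f (ant u) (suc M)" and ?fn = "\<lambda>(k, j). (f k, j)"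
  have "valid_state s'"
    using inv good_tree_kid[OF M u(1)] u(3) by (auto simp: valid_state_def s s'_def)
  moreover have "is_move s s' True ?l (\<lambda>_. False) (\<lambda>_. {})"
    using u(1) by (auto simp: is_move_def s s'_def main_links_def llinks_simps)
  moreover have "name_links s s' True ?l (\<lambda>_. False) (\<lambda>_. {}) \<subseteq> {(?fn n, n, False) | n. True}"
    by (auto simp: name_links_def main_links_def cut_links_def llinks_simps s s'_def)
  ultimately have "good_move s s' {(?fn n, n, False) | n. True} {False}"
    by (rule good_moveI) (rule right_links_simps)
  then show ?thesis
  proof (rule derivable_pstr[OF inv])
    show "suc (fst s') = suc (fst s)" by (simp add: s s'_def u)
    fix n assume n: "n \<in> set (names s')"
    obtain k j where kj: "n = (k, j)" by (cases n)
    show "?fn n \<in> set (names s) \<and> label s' n = label s (?fn n)"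
      using u(3) n by (auto simp: kj set_names width_def label_def s'_def s split: option.split)
  qed
qed

lemma derivable_main_wkR:
  assumes inv: "valid_state s" and "weakening_node (fst s)"
  shows "derivable state_seqt (valid_transition s) stay (state_seqt s)"
proof -
  obtain M c where s: "s = (M, c)" by (cases s)
  have M: "good_tree M" using inv by (simp add: valid_state_def s)
  obtain u a where u: "(u, cp Lft id (length (ant M))) \<in> set (kids M)"
      "ant u = ant M" "suc u = []" "suc M = [a]"
    using assms(2) by (auto simp: weakening_node_def s)
  define s' where "s' = (u, c)"
  let ?l = "cp Lft id (length (ant M))"
  have "valid_state s'"
    using inv good_tree_kid[OF M u(1)] u(2) by (auto simp: valid_state_def s s'_def)
  moreover have "is_move s s' True ?l (\<lambda>_. False) (\<lambda>_. {})"
    using u(1) by (auto simp: is_move_def s s'_def main_links_def llinks_simps)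
  moreover have "name_links s s' True ?l (\<lambda>_. False) (\<lambda>_. {}) \<subseteq> {(n, n, False) | n. True}"
    by (auto simp: name_links_def main_links_def cut_links_def llinks_simps s s'_def)
  ultimately have "good_move s s' {(n, n, False) | n. True} UNIV"
    by (rule good_moveI) simp
  moreover have "names s' = names s"
    by (rule names_cong) (use u in \<open>auto simp: s s'_def width_def\<close>)
  ultimately show ?thesis
    by (rule derivable_pwkR) (use u in \<open>auto simp: s s'_def label_def split: option.split\<close>)
qed

lemma derivable_main_left:
  assumes inv: "valid_state s" and "left_node (fst s)"
  shows "derivable state_seqt (valid_transition s) stay (state_seqt s)"
proof -
  obtain M c where s: "s = (M, c)" by (cases s)
  have M: "good_tree M" using inv by (simp add: valid_state_def s)
  obtain C X gs where u: "ant M = C # X" "lrule C gs"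
      "\<And>g. g \<in> set gs \<Longrightarrow> \<exists>u. (u, lkL X (suc M)) \<in> set (kids M) \<and> root u = (g # X, suc M)"
    using assms(2) unfolding left_node_def s by auto
  let ?l = "lkL X (suc M)"
  show ?thesis
  proof (cases "c 0")
    case None
    show ?thesis
    proof (rule derivable_pleft[OF inv u(2), of "(0, 0)"])
      show "(0, 0) \<in> set (names s)" using None u(1) by (simp add: set_names width_def s)
      show "label s (0, 0) = C" using None u(1) by (simp add: label_def s)
      fix g assume "g \<in> set gs"
      then obtain v where v: "(v, ?l) \<in> set (kids M)" "root v = (g # X, suc M)"
        using u(3) by blast
      define s' where "s' = (v, c)"
      have "valid_state s'"
        using inv good_tree_kid[OF M v(1)] u(1) v(2) None
        by (auto simp: valid_state_def s s'_def nth_Cons split: nat.split)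
      moreover have "is_move s s' True ?l (\<lambda>_. False) (\<lambda>_. {})"
        using v(1) None
        by (auto simp: is_move_def s s'_def main_links_def llinks_simps) (metis gr0I option.distinct(1))
      moreover have "name_links s s' True ?l (\<lambda>_. False) (\<lambda>_. {}) \<subseteq> {(n, n, n = (0, 0)) | n. True}"
        using None
        by (auto simp: name_links_def main_links_def cut_links_def llinks_simps s s'_def)
          (metis gr0I option.distinct(1))
      ultimately have "good_move s s' {(n, n, n = (0, 0)) | n. True} {False}"
        by (rule good_moveI) (rule right_links_simps)
      moreover have "names s' = names s"
        by (rule names_cong) (use u(1) v(2) in \<open>auto simp: s s'_def width_def\<close>)
      moreover have "label s' (i, j) = (if (i, j) = (0, 0) then g else label s (i, j))"
        if "(i, j) \<in> set (names s)" for i j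
        using None u(1) v(2) that
        by (auto simp: s s'_def label_def nth_Cons' set_names width_def split: option.splits)
      then have "\<forall>n\<in>set (names s). label s' n = (if n = (0, 0) then g else label s n)"
        by (metis surj_pair)
      moreover have "suc (fst s') = suc (fst s)" by (simp add: s s'_def v(2))
      ultimately show "\<exists>s'. good_move s s' {(n, n, n = (0, 0)) | n. True} {False} \<and>
        names s' = names s \<and> suc (fst s') = suc (fst s) \<and>
        (\<forall>n\<in>set (names s). label s' n = (if n = (0, 0) then g else label s n))"
        by blast
    qed
  next
    case (Some U)
    show ?thesis
    proof (cases "soft U")
      case True
      then show ?thesis using derivable_soft[OF inv, of 0 U] Some u(1) by (simp add: s)
    next
      case False
      then obtain hs where hs: "rrule C hs"
        "\<And>g. g \<in> set hs \<Longrightarrow> \<exists>u. (u, lkR (ant U) []) \<in> set (kids U) \<and> root u = (ant U, [g])"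
        using not_soft_cut[OF inv, of 0 U] Some u(1,2) by (auto simp: s)
      \<comment> \<open>Both rules act on the cut formula; a minor formula common to them becomes
        the new cut formula.\<close>
      obtain g where g: "g \<in> set gs" "g \<in> set hs" using lrule_rrule[OF u(2) hs(1)] by blast
      obtain v where v: "(v, ?l) \<in> set (kids M)" "root v = (g # X, suc M)"
        using u(3) g by blast
      obtain w where w: "(w, lkR (ant U) []) \<in> set (kids U)" "root w = (ant U, [g])"
        using hs(2) g by blast
      have U: "good_tree U" using inv Some u(1) by (auto simp: valid_state_def s)
      define s' where "s' = (v, c(0 := Some w))"
      let ?mu = "\<lambda>i::nat. i = 0" and ?lu = "\<lambda>_::nat. lkR (ant U) []"
      have "snd s' i = Some T \<Longrightarrow> good_tree T \<and> suc T = [ant v ! i]" if "i < length (ant v)" for i T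
      proof (cases i)
        case 0
        assume "snd s' i = Some T"
        then show ?thesis using 0 good_tree_kid[OF U w(1)] v(2) w(2) by (simp add: s'_def)
      next
        case (Suc j)
        assume "snd s' i = Some T"
        then show ?thesis using Suc inv that u(1) v(2) by (auto simp: s'_def s valid_state_def)
      qed
      then have "valid_state s'"
        using good_tree_kid[OF M v(1)] by (simp add: valid_state_def s'_def)
      moreover have "is_move s s' True ?l ?mu ?lu"
        using v(1) w(1) Some by (auto simp: is_move_def s s'_def main_links_def llinks_simps)
      \<comment> \<open>The principal step of M is at the hidden position 0 and that of the attached
        proof is on its right, so no visible link is principal.\<close>
      moreover have "name_links s s' True ?l ?mu ?lu \<subseteq> {(id n, n, False) | n. True}"
        using Some by (auto simp: name_links_def main_links_def cut_links_def llinks_simps s s'_def split: if_splits)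
      ultimately have "good_move s s' {(id n, n, False) | n. True} {False}"
        by (rule good_moveI) (rule right_links_simps)
      then show ?thesis
      proof (rule derivable_pstr[OF inv])
        show "suc (fst s') = suc (fst s)" by (simp add: s s'_def v)
        fix n assume n: "n \<in> set (names s')"
        obtain k j where kj: "n = (k, j)" by (cases n)
        show "id n \<in> set (names s) \<and> label s' n = label s (id n)"
          using u(1) v(2) w(2) Some n
          by (auto simp: kj set_names width_def label_def s'_def s nth_Cons' split: option.split if_splits)
      qed
    qed
  qed
qed

lemma derivable_main_right:
  assumes inv: "valid_state s" and "right_node (fst s)"
  shows "derivable state_seqt (valid_transition s) stay (state_seqt s)"
proof -
  obtain M c where s: "s = (M, c)" by (cases s)
  have M: "good_tree M" using inv by (simp add: valid_state_def s)
  obtain C gs where u: "suc M = [C]" "rrule C gs"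
      "\<And>g. g \<in> set gs \<Longrightarrow> \<exists>u. (u, lkR (ant M) []) \<in> set (kids M) \<and> root u = (ant M, [g])"
    using assms(2) unfolding right_node_def s by auto
  let ?l = "lkR (ant M) []"
  show ?thesis
  proof (rule derivable_pright[OF u(2)])
    show "suc (fst s) = [C]" using u(1) by (simp add: s)
    fix g assume "g \<in> set gs"
    then obtain v where v: "(v, ?l) \<in> set (kids M)" "root v = (ant M, [g])"
      using u(3) by blast
    define s' where "s' = (v, c)"
    have "valid_state s'"
      using inv good_tree_kid[OF M v(1)] v(2) by (auto simp: valid_state_def s s'_def)
    moreover have "is_move s s' True ?l (\<lambda>_. False) (\<lambda>_. {})"
      using v(1) by (auto simp: is_move_def s s'_def main_links_def llinks_simps)
    moreover have "name_links s s' True ?l (\<lambda>_. False) (\<lambda>_. {}) \<subseteq> {(n, n, False) | n. True}"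
      by (auto simp: name_links_def main_links_def cut_links_def llinks_simps s s'_def)
    ultimately have "good_move s s' {(n, n, False) | n. True} {True}"
      by (rule good_moveI) (rule right_links_simps)
    moreover have "names s' = names s"
      by (rule names_cong) (use v(2) in \<open>auto simp: s s'_def width_def\<close>)
    moreover have "label s' n = label s n" for n
      using v(2) by (simp add: s s'_def label_def split: option.split)
    ultimately show "\<exists>s'. good_move s s' {(n, n, False) | n. True} {True} \<and>
      names s' = names s \<and> suc (fst s') = [g] \<and> (\<forall>n\<in>set (names s). label s' n = label s n)"
      by (intro exI[of _ s']) (simp add: s s'_def v(2))
  qed
qed

lemma derivable_main_ax1:
  assumes inv: "valid_state s" and "clash_node (fst s)"
  shows "derivable state_seqt (valid_transition s) stay (state_seqt s)"
proof -
  obtain M c where s: "s = (M, c)" by (cases s)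
  obtain x where M: "root M = ([Var x, NVar x], [])" using assms(2) by (auto simp: clash_node_def s)
  show ?thesis
  proof (cases "\<exists>i U. i < 2 \<and> c i = Some U \<and> soft U")
    case True
    then obtain i U where "i < 2" "c i = Some U" "soft U" by blast
    then show ?thesis using derivable_soft[OF inv, of i U] M by (simp add: s numeral_2_eq_2)
  next
    case False
    then have ns: "\<not> soft U" if "i < Suc (Suc 0)" "c i = Some U" for i U
      using that by (simp add: numeral_2_eq_2)
    \<comment> \<open>No constructive proof can end with \<open>NVar x\<close> principal on the
      right: no logical rule introduces it, and the only axiom with it on the right has two formulas
      there.\<close>
    have c1: "c 1 = None"
    proof (rule ccontr)
      assume "c 1 \<noteq> None"
      then obtain U where U: "c 1 = Some U" by blast
      then show False using not_soft_cut[OF inv, of 1 U] ns[of 1 U] M by (auto simp: s)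
    qed
    have "(0, 0) \<in> set (names s) \<and> label s (0, 0) = Var x"
    proof (cases "c 0")
      case None
      then show ?thesis using M by (simp add: set_names width_def label_def s)
    next
      case (Some U)
      then have "ant U = [Var x]" using not_soft_cut[OF inv, of 0 U] ns[of 0 U] M by (auto simp: s)
      then show ?thesis using Some M by (simp add: set_names width_def label_def s)
    qed
    moreover have "(1, 0) \<in> set (names s) \<and> label s (1, 0) = NVar x"
      using c1 M by (simp add: set_names width_def label_def s)
    ultimately have "Var x \<in> set (map (label s) (names s))" "NVar x \<in> set (map (label s) (names s))"
      by (auto simp: image_iff) (metis+)
    moreover have "suc (fst s) = []" by (simp add: s M)
    ultimately show ?thesis
      unfolding state_seqt_def[of s] by (simp only: derivable_ax1)
  qed
qed

lemma derivable_main_ax3: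
  assumes inv: "valid_state s" and "identity_node (fst s)"
  shows "derivable state_seqt (valid_transition s) stay (state_seqt s)"
proof -
  obtain M c where s: "s = (M, c)" by (cases s)
  obtain x where M: "root M = ([Var x], [Var x])" using assms(2) by (auto simp: identity_node_def s)
  show ?thesis
  proof (cases "c 0")
    case None
    then have "(0, 0) \<in> set (names s)" "label s (0, 0) = Var x"
      using M by (simp_all add: set_names width_def label_def s)
    then have "Var x \<in> set (map (label s) (names s))" by (auto simp: image_iff) metis
    moreover have "suc (fst s) = [Var x]" by (simp add: s M)
    ultimately show ?thesis
      unfolding state_seqt_def[of s] by (simp only: derivable_ax3)
  next
    \<comment> \<open>The attached proof already proves the right formula of M, so it takes over as
      main proof.\<close>
    case (Some U)
    then have U: "good_tree U" "suc U = [Var x]" using inv M by (auto simp: valid_state_def s)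
    then have "valid_state (U, \<lambda>_. None)" by (simp add: valid_state_def)
    then show ?thesis
      by (rule derivable_preset[OF inv, of _ 0 "\<lambda>(j, _). (0, j)"])
        (use Some M U in \<open>auto simp: set_names width_def label_def s\<close>)
  qed
qed

text \<open>A modal rule changes all formulas at once, so all attached proofs must be ready
  together: as long as one of them is soft, it goes first. When none is, each ends in a modal rule
  as well, because its right formula is a \<open>Box\<close> or a \<open>Dia\<close>, and all
  premises are taken simultaneously. The merged sequent fits the rule of M: a proof of a boxed
  formula then has only boxes on the left, and a proof of a \<open>Dia\<close> formula has exactly
  one \<open>Dia\<close> there.\<close>

lemma derivable_main_modal:
  assumes inv: "valid_state s" and modal: "box_node (fst s) \<or> dia_node (fst s)"
  shows "derivable state_seqt (valid_transition s) stay (state_seqt s)"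
proof (cases "\<exists>i U. i < length (ant (fst s)) \<and> snd s i = Some U \<and> soft U")
  case True
  then show ?thesis using derivable_soft[OF inv] by blast
next
  case False
  obtain M c where s: "s = (M, c)" by (cases s)
  have M: "good_tree M" using inv by (simp add: valid_state_def s)
  have G: "good_tree U" "suc U = [ant M ! i]" if "i < length (ant M)" "c i = Some U" for i U
    using inv that by (auto simp: valid_state_def s)
  obtain v where v: "(v, modal_link (ant v) (suc v)) \<in> set (kids M)" "length (ant v) = length (ant M)"
    "\<And>i. i < length (ant M) \<Longrightarrow> ant M ! i = Box (ant v ! i) \<or> ant M ! i = Dia (ant v ! i)"
    and vb: "box_node M \<Longrightarrow> ant M = map Box (ant v) \<and> (\<exists>a. suc v = [a] \<and> suc M = [Box a])"
    and vd: "\<not> box_node M \<Longrightarrow> (\<exists>a X. ant v = a # X \<and> ant M = Dia a # map Box X) \<and> suc M = map Dia (suc v)"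
  proof (cases "box_node M")
    case True
    then obtain u a where u: "(u, modal_link (ant u) (suc u)) \<in> set (kids M)"
      "ant M = map Box (ant u)" "suc u = [a]" "suc M = [Box a]" unfolding box_node_def by blast
    show ?thesis by (rule that[of u]) (use u True in simp_all)
  next
    case False
    then have "dia_node M" using modal by (simp add: s)
    then obtain u a X where u: "(u, modal_link (ant u) (suc u)) \<in> set (kids M)"
      "ant u = a # X" "ant M = Dia a # map Box X" "suc M = map Dia (suc u)"
      unfolding dia_node_def by blast
    show ?thesis by (rule that[of u]) (use u False in \<open>simp_all add: nth_Cons split: nat.split\<close>)
  qed
  define step_of where "step_of i U u \<longleftrightarrow> (u, modal_link (ant u) (suc u)) \<in> set (kids U) \<and>
    length (ant u) = length (ant U) \<and> suc u = [ant v ! i] \<and>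
    (ant M ! i = Box (ant v ! i) \<longrightarrow> ant U = map Box (ant u)) \<and>
    (ant M ! i = Dia (ant v ! i) \<longrightarrow> (\<exists>a X. ant u = a # X \<and> ant U = Dia a # map Box X))" for i U u
  have ex: "\<exists>u. step_of i U u" if i: "i < length (ant M)" "c i = Some U" for i U
  proof -
    have "\<not> soft U" using False i by (auto simp: s)
    then consider "\<exists>a. ant M ! i = Box a \<and> box_node U" | "\<exists>a. ant M ! i = Dia a \<and> dia_node U"
      using not_soft_cut[OF inv, of i U] i v(3)[OF i(1)] by (auto simp: s)
    then show ?thesis
    proof cases
      case 1
      then show ?thesis using G(2)[OF i] v(3)[OF i(1)] unfolding step_of_def box_node_def by fastforce
    next
      case 2
      then obtain u a X where u: "(u, modal_link (ant u) (suc u)) \<in> set (kids U)"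
        "ant u = a # X" "ant U = Dia a # map Box X" "suc U = map Dia (suc u)"
        unfolding dia_node_def by blast
      have "suc u = [ant v ! i]" using u(4) G(2)[OF i] v(3)[OF i(1)] 2 by auto
      then have "step_of i U u" using u 2 by (auto simp: step_of_def)
      then show ?thesis by blast
    qed
  qed
  define kd where "kd i = (SOME u. step_of i (the (c i)) u)" for i
  have kd: "step_of i U (kd i)" if "i < length (ant M)" "c i = Some U" for i U
    using someI_ex[OF ex[OF that]] that(2) by (simp add: kd_def)
  define s' where "s' = (v, \<lambda>i. map_option (\<lambda>_. kd i) (c i))"
  let ?l = "modal_link (ant v) (suc v)" and ?mu = "\<lambda>_::nat. True"
    and ?lu = "\<lambda>i. modal_link (ant (kd i)) (suc (kd i))"
  have kdk: "(kd i, ?lu i) \<in> set (kids U)" if "i < length (ant M)" "c i = Some U" for i U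
    using kd[OF that] unfolding step_of_def by blast
  have inv': "valid_state s'"
    unfolding valid_state_def
  proof (intro conjI allI impI)
    show "good_tree (fst s')" using good_tree_kid[OF M v(1)] by (simp add: s'_def)
    fix i U assume i: "i < length (ant (fst s'))" "snd s' i = Some U"
    then obtain U0 where U0: "c i = Some U0" "U = kd i" "i < length (ant M)"
      using v(2) by (auto simp: s'_def)
    show "good_tree U" using good_tree_kid[OF G(1) kdk] U0 by blast
    show "suc U = [ant (fst s') ! i]" using kd[OF U0(3,1)] U0(2) by (simp add: step_of_def s'_def)
  qed
  moreover have "is_move s s' True ?l ?mu ?lu"
  proof -
    have "c i = None \<or> (\<exists>U. c i = Some U \<and> (kd i, ?lu i) \<in> set (kids U))" if "i < length (ant v)" for i
      using kdk[of i] that v(2) by (cases "c i") auto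
    then show ?thesis
      using v(1) by (fastforce simp: is_move_def s s'_def main_links_def llinks_simps)
  qed
  moreover have "name_links s s' True ?l ?mu ?lu \<subseteq> {(n, n, True) | n. True}"
    by (auto simp: name_links_def main_links_def cut_links_def llinks_simps)
  ultimately have gm: "good_move s s' {(n, n, True) | n. True} {True}"
    by (rule good_moveI) (rule right_links_simps)
  have names: "names s' = names s"
    by (rule names_cong) (use v(2) kd in \<open>auto simp: s s'_def width_def step_of_def split: option.split\<close>)
  have lab_box: "label s (i, j) = Box (label s' (i, j))"
    if n: "(i, j) \<in> set (names s)" and b: "ant M ! i = Box (ant v ! i)" for i j
  proof (cases "c i")
    case None
    then show ?thesis using b by (simp add: s s'_def label_def)
  next
    case (Some U)
    have i: "i < length (ant M)" and j: "j < length (ant U)"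
      using n Some by (simp_all add: set_names s width_def)
    have U: "ant U = map Box (ant (kd i))"
      using kd[OF i Some] b unfolding step_of_def by blast
    then have "label s (i, j) = Box (ant (kd i) ! j)" using Some j by (simp add: s label_def)
    then show ?thesis using Some by (simp add: s'_def label_def)
  qed
  show ?thesis
  proof (cases "box_node M")
    case True
    then obtain a where a: "ant M = map Box (ant v)" "suc v = [a]" "suc M = [Box a]" using vb by blast
    show ?thesis
    proof (rule derivable_pbox[OF gm names])
      fix n assume "n \<in> set (names s)"
      moreover obtain i j where "n = (i, j)" by (cases n)
      moreover from calculation have "i < length (ant M)" by (simp add: set_names s)
      ultimately show "label s n = Box (label s' n)" using lab_box a(1) by simp
    qed (use a in \<open>simp_all add: s s'_def\<close>)
  next
    case False
    then obtain a X where a: "ant v = a # X" "ant M = Dia a # map Box X" "suc M = map Dia (suc v)"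
      using vd by blast
    have kd0: "\<exists>b Y. ant (kd 0) = b # Y \<and> ant U = Dia b # map Box Y" if "c 0 = Some U" for U
    proof -
      have "ant M ! 0 = Dia (ant v ! 0)" "0 < length (ant M)" using a by simp_all
      then show ?thesis using kd[OF _ that] unfolding step_of_def by blast
    qed
    \<comment> \<open>The principal \<open>Dia\<close> has the name \<open>(0, 0)\<close> both when
      it is visible and when it is the front formula of the proof attached at position 0.\<close>
    have 0: "(0, 0) \<in> set (names s) \<and> label s (0, 0) = Dia (label s' (0, 0))"
    proof (cases "c 0")
      case None
      then show ?thesis using a by (simp add: set_names width_def label_def s s'_def)
    next
      case (Some U)
      obtain b Y where "ant (kd 0) = b # Y" "ant U = Dia b # map Box Y" using kd0[OF Some] by blast
      then show ?thesis using Some a by (simp add: set_names width_def label_def s s'_def)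
    qed
    show ?thesis
    proof (rule derivable_pdia[OF gm names inv' _ conjunct1[OF 0] conjunct2[OF 0]])
      show "suc (fst s) = map Dia (suc (fst s'))" using a by (simp add: s s'_def)
      fix n assume n: "n \<in> set (names s)" "n \<noteq> (0, 0)"
      obtain i j where ij: "n = (i, j)" by (cases n)
      have i: "i < length (ant M)" using n ij by (simp add: set_names s)
      show "label s n = Box (label s' n)"
      proof (cases i)
        case (Suc k)
        then have "ant M ! i = Box (ant v ! i)" using i a by simp
        then show ?thesis using lab_box n ij by simp
      next
        case 0
        show ?thesis
        proof (cases "c 0")
          case None
          then show ?thesis using n ij 0 by (simp add: set_names width_def s)
        next
          case (Some U)
          obtain b Y where "ant (kd 0) = b # Y" "ant U = Dia b # map Box Y" using kd0[OF Some] by blast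
          then show ?thesis using Some n ij 0
            by (cases j) (simp_all add: set_names width_def label_def s s'_def)
        qed
      qed
    qed
  qed
qed

lemma derivable_pstate:
  assumes "valid_state s"
  shows "derivable state_seqt (valid_transition s) stay (state_seqt s)"
proof -
  have "good_tree (fst s)" using assms by (simp add: valid_state_def)
  from node_cases[OF this] show ?thesis
    using derivable_main_ax1 derivable_main_ax3 derivable_main_str derivable_main_wkR derivable_main_left derivable_main_right
      derivable_main_modal assms unfolding soft_def by metis
qed

lemma concat_singletons: "concat (map (\<lambda>i. [f i]) xs) = map f xs"
  by (induction xs) auto

theorem theorem4p10:
  fixes \<Phi> \<Psi> :: "fm list" and \<alpha> \<beta> :: fm
  assumes "\<forall>\<phi>\<in>set \<Phi>. wff \<phi>" and "\<forall>\<psi>\<in>set \<Psi>. wff \<psi>" and "wff \<alpha>" and "wff \<beta>"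
    and "forces \<Phi> \<alpha>" and "forces (\<alpha> # \<Psi>) \<beta>"
  shows "forces (\<Phi> @ \<Psi>) \<beta>"
proof -
  obtain T where T: "coproof T" "constructive T" "root T = (\<Phi>, [\<alpha>])"
    using assms(5) by (auto simp: forces_def)
  obtain M where M: "coproof M" "constructive M" "root M = (\<alpha> # \<Psi>, [\<beta>])"
    using assms(6) by (auto simp: forces_def)
  define s0 :: pstate where "s0 = (M, (\<lambda>_. None)(0 := Some T))"
  \<comment> \<open>Well-formedness enters the invariant here; it is what
    \<open>sthread_least_unique\<close> needs for threads of cut formulas.\<close>
  have "valid_state s0"
    using T M assms(1-4) by (auto simp: valid_state_def s0_def good_tree_def)
  \<comment> \<open>The antecedent of \<open>T\<close> stands in for position 0, so it precedes the
    visible formulas of \<open>\<Psi>\<close>.\<close>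
  have "names s0 = map (Pair 0) [0..<length \<Phi>] @ map (\<lambda>i. (Suc i, 0)) [0..<length \<Psi>]"
    unfolding names_def by (simp add: s0_def width_def T M upt_conv_Cons map_Suc_upt[symmetric]
        concat_singletons comp_def del: upt_Suc map_Suc_upt)
  then have "state_seqt s0 = (\<Phi> @ \<Psi>, [\<beta>])"
    by (simp add: state_seqt_def s0_def label_def T M comp_def map_nth)
  moreover have "\<exists>T. coproof T \<and> constructive T \<and> root T = state_seqt s0"
  proof (rule realize[where Inv = valid_state and tr = transition])
    fix s assume "valid_state s"
    from derivable_pstate[OF this]
    show "\<exists>d. dseq state_seqt d = state_seqt s \<and> valid_deriv state_seqt (\<lambda>s' A. transition s s' A \<and> valid_state s') stay d"
      unfolding derivable_def valid_transition_def[abs_def] .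
  next
    fix s A assume "\<And>n. valid_state (s n)" "\<And>n. transition (s n) (s (Suc n)) (A n)"
    then show "\<exists>k oc pf. good_trace (\<lambda>n. state_seqt (s n)) A k oc pf" by (rule ptr_run_good)
  qed (rule \<open>valid_state s0\<close>)
  ultimately show ?thesis by (simp add: forces_def)
qed

end
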